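(* Let $m>1$ and let the cyclic group $G_m$ of order $m$, with generator $g$, act on $U(sl_2)$ by algebra automorphisms with $g(h)=h$, $g(e)=\xi e$, $g(f)=\xi^{-1}f$, where $\xi$ is a fixed primitive $m$-th root of unity. Then $$\mathrm{Frac}\bigl(U(sl_2)^{G_m}\bigr)\cong\mathrm{Frac}\bigl(\mathsf{k}[C]\otimes A_1(\mathsf{k})\bigr)\cong\mathrm{Frac}\bigl(U(sl_2)\bigr).$$
   Context: $\mathsf{k}$ is an algebraically closed field of characteristic $0$. $U(sl_2)$ is the universal enveloping algebra over $\mathsf{k}$ of $sl_2$ with basis $e,f,h$ and brackets $[h,e]=e$, $[h,f]=-f$, $[e,f]=2h$. $\mathsf{k}[C]$ is the polynomial algebra in one variable $C$ (corresponding to $h(h+1)+fe$), $A_1(\mathsf{k})$ is the first Weyl algebra generated by $x,\partial$ with $\partial x-x\partial=1$, and $\mathrm{Frac}$ denotes the skew field of fractions. *)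

theory Defs
  imports
    "HOL-Computational_Algebra.Polynomial"
    "HOL-Library.Poly_Mapping"
    "HOL-Algebra.Module"
    "HOL-Algebra.QuotRing"
    "HOL-Algebra.Group_Action"
    "HOL-Algebra.Generated_Groups"
begin

text \<open>
  A \<open>k\<close>-algebra (unital, associative, not necessarily commutative) is represented by a record of
  type \<open>('k, 'a) module\<close>, whose ring part carries the multiplication and whose scalars are all
  elements of the field type \<open>'k\<close>.  The locale \<open>algebra\<close> of the library is not used because it
  is restricted to commutative algebras.
\<close>

definition alg_iso :: "('k, 'a) module \<Rightarrow> ('k, 'b) module \<Rightarrow> ('a \<Rightarrow> 'b) set" where
  "alg_iso A B =
     {\<phi> \<in> ring_iso A B. \<forall>c. \<forall>x \<in> carrier A. \<phi> (c \<odot>\<^bsub>A\<^esub> x) = c \<odot>\<^bsub>B\<^esub> \<phi> x}"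

definition alg_isomorphic :: "('k, 'a) module \<Rightarrow> ('k, 'b) module \<Rightarrow> bool"
    (infix \<open>\<cong>\<^sub>a\<close> 50) where
  "A \<cong>\<^sub>a B \<longleftrightarrow> alg_iso A B \<noteq> {}"

text \<open>
  The ring structure is that of \<^const>\<open>FactRing\<close>; the scalar multiplication follows the same
  union-over-representatives scheme as \<^const>\<open>rcoset_mult\<close>.
\<close>

definition quot_alg :: "('k, 'a) module \<Rightarrow> 'a set \<Rightarrow> ('k, 'a set) module" where
  "quot_alg A I =
     ring.extend (A Quot I)
       (module.fields (\<lambda>c S. \<Union>x\<in>S. I +>\<^bsub>A\<^esub> (c \<odot>\<^bsub>A\<^esub> x)))"


subsection \<open>Free algebras\<close>

text \<open>
  Lists under concatenation are the free monoid, written additively so that the convolution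
  product on \<^typ>\<open>'x list \<Rightarrow>\<^sub>0 'k\<close> is the product of the free associative algebra
  on \<^typ>\<open>'x\<close>.
\<close>

instantiation list :: (type) monoid_add
begin

definition zero_list :: "'a list" where "zero_list = []"

definition plus_list :: "'a list \<Rightarrow> 'a list \<Rightarrow> 'a list" where "plus_list xs ys = xs @ ys"

instance
  by standard (simp_all add: zero_list_def plus_list_def)

end

definition free_alg :: "('k::field, 'x list \<Rightarrow>\<^sub>0 'k) module" where
  "free_alg =
     \<lparr>carrier = UNIV, mult = (*), one = 1, zero = 0, add = (+),
      smult = (\<lambda>c. Poly_Mapping.map ((*) c))\<rparr>"

abbreviation free_gen :: "'x \<Rightarrow> ('x list \<Rightarrow>\<^sub>0 'k::field)" where
  "free_gen b \<equiv> Poly_Mapping.single [b] 1"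


subsection \<open>The universal enveloping algebra of \<open>sl\<^sub>2\<close>\<close>

text \<open>
  A finite-dimensional Lie algebra with basis \<^typ>\<open>'b\<close> is given by a bracket on coordinate
  vectors \<^typ>\<open>'b \<Rightarrow> 'k\<close>.  Its tensor algebra is the free algebra on the basis,
  \<open>lie_embed\<close> is the inclusion of the Lie algebra as the degree one part, and the relations
  \<open>x y - y x = [x, y]\<close> are imposed for all elements of the Lie algebra.
\<close>

definition lie_embed :: "('b::finite \<Rightarrow> 'k) \<Rightarrow> ('b list \<Rightarrow>\<^sub>0 'k::field)" where
  "lie_embed x = (\<Sum>b\<in>UNIV. Poly_Mapping.single [b] (x b))"

definition env_ideal ::
    "(('b::finite \<Rightarrow> 'k::field) \<Rightarrow> ('b \<Rightarrow> 'k) \<Rightarrow> ('b \<Rightarrow> 'k)) \<Rightarrow> ('b list \<Rightarrow>\<^sub>0 'k) set" where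
  "env_ideal br =
     Idl\<^bsub>free_alg\<^esub>
       {lie_embed x * lie_embed y - lie_embed y * lie_embed x - lie_embed (br x y) | x y. True}"

datatype sl2_basis = E | F | H

instance sl2_basis :: finite
proof
  have "(UNIV :: sl2_basis set) = {E, F, H}"
    by (auto intro: sl2_basis.exhaust)
  then show "finite (UNIV :: sl2_basis set)"
    by (metis finite.emptyI finite.insertI)
qed

fun sl2_bracket :: "(sl2_basis \<Rightarrow> 'k::field) \<Rightarrow> (sl2_basis \<Rightarrow> 'k) \<Rightarrow> (sl2_basis \<Rightarrow> 'k)" where
  "sl2_bracket x y E = x H * y E - x E * y H"
| "sl2_bracket x y F = x F * y H - x H * y F"
| "sl2_bracket x y H = 2 * (x E * y F - x F * y E)"

text \<open>
  This is the bilinear alternating extension of \<open>[h, e] = e\<close>, \<open>[h, f] = - f\<close>, \<open>[e, f] = 2 h\<close>.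
\<close>

lemma sl2_bracket_basis:
  fixes u :: "sl2_basis \<Rightarrow> sl2_basis \<Rightarrow> 'k::field"
  defines "u \<equiv> (\<lambda>a b. if a = b then 1 else 0)"
  shows "sl2_bracket (u H) (u E) b = u E b"
    and "sl2_bracket (u H) (u F) b = - u F b"
    and "sl2_bracket (u E) (u F) b = 2 * u H b"
    and "sl2_bracket x x b = 0"
  by (cases b; simp add: u_def)+

definition U_sl2 :: "('k::field, (sl2_basis list \<Rightarrow>\<^sub>0 'k) set) module" where
  "U_sl2 = quot_alg free_alg (env_ideal sl2_bracket)"

definition U_gen :: "sl2_basis \<Rightarrow> (sl2_basis list \<Rightarrow>\<^sub>0 'k::field) set" where
  "U_gen b = env_ideal sl2_bracket +>\<^bsub>free_alg\<^esub> free_gen b"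


subsection \<open>Polynomials, the first Weyl algebra, tensor products\<close>

definition poly_alg :: "('k::field, 'k poly) module" where
  "poly_alg =
     \<lparr>carrier = UNIV, mult = (*), one = 1, zero = 0, add = (+), smult = Polynomial.smult\<rparr>"

datatype weyl_gen = WX | WD

definition weyl_ideal :: "(weyl_gen list \<Rightarrow>\<^sub>0 'k::field) set" where
  "weyl_ideal =
     Idl\<^bsub>free_alg\<^esub> {free_gen WD * free_gen WX - free_gen WX * free_gen WD - 1}"

definition weyl_alg :: "('k::field, (weyl_gen list \<Rightarrow>\<^sub>0 'k) set) module" where
  "weyl_alg = quot_alg free_alg weyl_ideal"

text \<open>
  \<open>tensor_free A B\<close> is the vector space with basis \<open>carrier A \<times> carrier B\<close>, made into an algebra
  by multiplying basis elements componentwise.  The bilinearity relations are stable under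
  multiplication by basis elements on either side, so the ideal they generate is just their linear
  span and \<open>tensor_alg A B\<close> is the tensor product over \<open>'k\<close>, with the product determined by
  \<open>(a \<otimes> b) (a' \<otimes> b') = a a' \<otimes> b b'\<close>.
\<close>

definition tensor_free ::
    "('k::field, 'a) module \<Rightarrow> ('k, 'b) module \<Rightarrow> ('k, 'a \<times> 'b \<Rightarrow>\<^sub>0 'k) module" where
  "tensor_free A B =
     \<lparr>carrier = {p. Poly_Mapping.keys p \<subseteq> carrier A \<times> carrier B},
      mult = (\<lambda>p q. \<Sum>(a, b)\<in>Poly_Mapping.keys p. \<Sum>(a', b')\<in>Poly_Mapping.keys q.
        Poly_Mapping.single (a \<otimes>\<^bsub>A\<^esub> a', b \<otimes>\<^bsub>B\<^esub> b')
          (Poly_Mapping.lookup p (a, b) * Poly_Mapping.lookup q (a', b'))),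
      one = Poly_Mapping.single (\<one>\<^bsub>A\<^esub>, \<one>\<^bsub>B\<^esub>) 1,
      zero = 0,
      add = (+),
      smult = (\<lambda>c. Poly_Mapping.map ((*) c))\<rparr>"

definition tensor_rels ::
    "('k::field, 'a) module \<Rightarrow> ('k, 'b) module \<Rightarrow> ('a \<times> 'b \<Rightarrow>\<^sub>0 'k) set" where
  "tensor_rels A B =
     {Poly_Mapping.single (a \<oplus>\<^bsub>A\<^esub> a', b) 1 - Poly_Mapping.single (a, b) 1
        - Poly_Mapping.single (a', b) 1 | a a' b.
        a \<in> carrier A \<and> a' \<in> carrier A \<and> b \<in> carrier B} \<union>
     {Poly_Mapping.single (a, b \<oplus>\<^bsub>B\<^esub> b') 1 - Poly_Mapping.single (a, b) 1
        - Poly_Mapping.single (a, b') 1 | a b b'.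
        a \<in> carrier A \<and> b \<in> carrier B \<and> b' \<in> carrier B} \<union>
     {Poly_Mapping.single (c \<odot>\<^bsub>A\<^esub> a, b) 1 - Poly_Mapping.single (a, b) c | c a b.
        a \<in> carrier A \<and> b \<in> carrier B} \<union>
     {Poly_Mapping.single (a, c \<odot>\<^bsub>B\<^esub> b) 1 - Poly_Mapping.single (a, b) c | c a b.
        a \<in> carrier A \<and> b \<in> carrier B}"

definition tensor_alg ::
    "('k::field, 'a) module \<Rightarrow> ('k, 'b) module \<Rightarrow> ('k, ('a \<times> 'b \<Rightarrow>\<^sub>0 'k) set) module" where
  "tensor_alg A B = quot_alg (tensor_free A B) (Idl\<^bsub>tensor_free A B\<^esub> (tensor_rels A B))"


subsection \<open>Skew fields of fractions\<close>

text \<open>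
  The Ore localisation of a right Ore domain at its nonzero elements.  A pair \<open>(a, b)\<close> stands
  for the right fraction \<open>a b\<^sup>-\<^sup>1\<close>; two pairs are identified iff they become equal after being
  brought to a common nonzero denominator.
\<close>

definition ore_pairs :: "('k, 'a) module \<Rightarrow> ('a \<times> 'a) set" where
  "ore_pairs R = carrier R \<times> (carrier R - {\<zero>\<^bsub>R\<^esub>})"

definition ore_rel :: "('k, 'a) module \<Rightarrow> (('a \<times> 'a) \<times> ('a \<times> 'a)) set" where
  "ore_rel R =
     {((a, b), (c, d)). (a, b) \<in> ore_pairs R \<and> (c, d) \<in> ore_pairs R \<and>
        (\<exists>u\<in>carrier R. \<exists>v\<in>carrier R.
           a \<otimes>\<^bsub>R\<^esub> u = c \<otimes>\<^bsub>R\<^esub> v \<and> b \<otimes>\<^bsub>R\<^esub> u = d \<otimes>\<^bsub>R\<^esub> v \<and> b \<otimes>\<^bsub>R\<^esub> u \<noteq> \<zero>\<^bsub>R\<^esub>)}"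

definition ore_frac :: "('k, 'a) module \<Rightarrow> 'a \<Rightarrow> 'a \<Rightarrow> ('a \<times> 'a) set" where
  "ore_frac R a b = ore_rel R `` {(a, b)}"

text \<open>
  Sum: if \<open>b u = d v\<close> is nonzero then \<open>a b\<^sup>-\<^sup>1 + c d\<^sup>-\<^sup>1 = (a u + c v) (b u)\<^sup>-\<^sup>1\<close>.
  Product: if \<open>b u = c v\<close> with \<open>v\<close> nonzero then \<open>b\<^sup>-\<^sup>1 c = u v\<^sup>-\<^sup>1\<close>, hence
  \<open>a b\<^sup>-\<^sup>1 c d\<^sup>-\<^sup>1 = (a u) (d v)\<^sup>-\<^sup>1\<close>.  As for quotient rings, the operations are unions over all
  representatives and all admissible choices of \<open>u\<close> and \<open>v\<close>; over a right Ore domain every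
  member of such a union is the same class.
\<close>

definition Frac :: "('k, 'a) module \<Rightarrow> ('k, ('a \<times> 'a) set) module" where
  "Frac R =
     \<lparr>carrier = ore_pairs R // ore_rel R,
      mult = (\<lambda>P Q. \<Union>(a, b)\<in>P. \<Union>(c, d)\<in>Q.
        \<Union>{ore_frac R (a \<otimes>\<^bsub>R\<^esub> u) (d \<otimes>\<^bsub>R\<^esub> v) | u v.
            u \<in> carrier R \<and> v \<in> carrier R - {\<zero>\<^bsub>R\<^esub>} \<and> b \<otimes>\<^bsub>R\<^esub> u = c \<otimes>\<^bsub>R\<^esub> v}),
      one = ore_frac R \<one>\<^bsub>R\<^esub> \<one>\<^bsub>R\<^esub>,
      zero = ore_frac R \<zero>\<^bsub>R\<^esub> \<one>\<^bsub>R\<^esub>,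
      add = (\<lambda>P Q. \<Union>(a, b)\<in>P. \<Union>(c, d)\<in>Q.
        \<Union>{ore_frac R (a \<otimes>\<^bsub>R\<^esub> u \<oplus>\<^bsub>R\<^esub> c \<otimes>\<^bsub>R\<^esub> v) (b \<otimes>\<^bsub>R\<^esub> u) | u v.
            u \<in> carrier R \<and> v \<in> carrier R \<and>
            b \<otimes>\<^bsub>R\<^esub> u = d \<otimes>\<^bsub>R\<^esub> v \<and> b \<otimes>\<^bsub>R\<^esub> u \<noteq> \<zero>\<^bsub>R\<^esub>}),
      smult = (\<lambda>c P. \<Union>(a, b)\<in>P. ore_frac R (c \<odot>\<^bsub>R\<^esub> a) b)\<rparr>"


subsection \<open>Group actions by algebra automorphisms\<close>

definition alg_action :: "'g monoid \<Rightarrow> ('k, 'a) module \<Rightarrow> ('g \<Rightarrow> 'a \<Rightarrow> 'a) \<Rightarrow> bool" where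
  "alg_action G A \<phi> \<longleftrightarrow>
     group_action G (carrier A) \<phi> \<and> (\<forall>s\<in>carrier G. \<phi> s \<in> alg_iso A A)"

definition invariant_subalg ::
    "'g monoid \<Rightarrow> ('g \<Rightarrow> 'a \<Rightarrow> 'a) \<Rightarrow> ('k, 'a) module \<Rightarrow> ('k, 'a) module" where
  "invariant_subalg G \<phi> A = A\<lparr>carrier := {a \<in> carrier A. \<forall>s\<in>carrier G. \<phi> s a = a}\<rparr>"

definition primitive_root :: "nat \<Rightarrow> 'k::field \<Rightarrow> bool" where
  "primitive_root m \<xi> \<longleftrightarrow> \<xi> ^ m = 1 \<and> (\<forall>j. 0 < j \<and> j < m \<longrightarrow> \<xi> ^ j \<noteq> 1)"

end

theory Submission
  imports Defs
begin

text \<open>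
  All three algebras have the same quotient skew field because each of them embeds densely into one
  Ore domain \<open>L\<close>, the skew Laurent polynomials \<open>k[C, h][\<sigma>, \<sigma>\<^sup>-\<^sup>1]\<close> in which \<open>\<sigma>\<close> shifts \<open>h\<close> to
  \<open>h - 1\<close>; dense means that every element of \<open>L\<close> is a right fraction of elements of the subalgebra.
  A dense embedding induces an isomorphism of skew fields of fractions (\<open>Frac_isomorphic\<close>), and it
  even transports the Ore condition from \<open>L\<close> back to the subalgebra.

  \<open>L\<close> is realised by operators on the polynomial ring \<open>k[C][h]\<close>: coefficients act by
  multiplication and \<open>\<sigma>\<close> acts by \<open>p(h) \<mapsto> p(h - 1)\<close>.  Powers of \<open>\<sigma>\<close> are independent over the
  coefficients because the characteristic is zero (\<open>skew_sum_eq_0D\<close>); comparison of leading terms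
  and a Euclidean algorithm then show that \<open>L\<close> is an Ore domain.

  In \<open>U(sl\<^sub>2)\<close> put \<open>C = h (h + 1) + f e\<close>.  The assignment \<open>e \<mapsto> \<sigma>\<close>, \<open>h \<mapsto> h\<close>,
  \<open>f \<mapsto> (C - h - h\<^sup>2) \<sigma>\<^sup>-\<^sup>1\<close> respects the relations.  In \<open>k[C] \<otimes> A\<^sub>1\<close> the same is done by
  \<open>x \<mapsto> \<sigma>\<close>, \<open>\<partial> \<mapsto> (h + 1) \<sigma>\<^sup>-\<^sup>1\<close>, so that \<open>x \<partial> \<mapsto> h\<close>.  Both algebras are generalised Weyl algebras:
  they are spanned by \<open>k[C, h] e\<^sup>n\<close> and \<open>k[C, h] f\<^sup>n\<close>, and these normal forms are sent to
  independent operators, so the maps are injective (\<open>generalised_weyl.rep_inj\<close>).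

  An invariant of \<open>G\<^sub>m\<close> only involves powers \<open>\<sigma>\<^sup>n\<close> with \<open>m\<close> dividing \<open>n\<close>.  Conjugation with the
  substitution \<open>h \<mapsto> m h\<close> turns \<open>\<sigma>\<^sup>m\<close>, which shifts \<open>h\<close> by \<open>m\<close>, into \<open>\<sigma>\<close>.  Hence the invariants
  also embed into \<open>L\<close>, and this embedding is dense again because \<open>C\<close>, \<open>h\<close> and \<open>e\<^sup>m\<close> are invariant.
\<close>

section \<open>Fractions over Ore domains\<close>

locale nc_algebra = ring R for R :: "('k::field, 'a) module" (structure) +
  assumes smult_closed [simp, intro]: "x \<in> carrier R \<Longrightarrow> c \<odot> x \<in> carrier R"
    and smult_add_left: "x \<in> carrier R \<Longrightarrow> (c + d) \<odot> x = c \<odot> x \<oplus> d \<odot> x"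
    and smult_add_right:
      "x \<in> carrier R \<Longrightarrow> y \<in> carrier R \<Longrightarrow> c \<odot> (x \<oplus> y) = c \<odot> x \<oplus> c \<odot> y"
    and smult_assoc: "x \<in> carrier R \<Longrightarrow> (c * d) \<odot> x = c \<odot> (d \<odot> x)"
    and smult_one [simp]: "x \<in> carrier R \<Longrightarrow> 1 \<odot> x = x"
    and smult_mult_left:
      "x \<in> carrier R \<Longrightarrow> y \<in> carrier R \<Longrightarrow> (c \<odot> x) \<otimes> y = c \<odot> (x \<otimes> y)"
    and smult_mult_right:
      "x \<in> carrier R \<Longrightarrow> y \<in> carrier R \<Longrightarrow> x \<otimes> (c \<odot> y) = c \<odot> (x \<otimes> y)"

locale ore_domain = nc_algebra +
  assumes one_neq_zero: "\<one> \<noteq> \<zero>"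
    and no_zero_divisors:
      "x \<in> carrier R \<Longrightarrow> y \<in> carrier R \<Longrightarrow> x \<otimes> y = \<zero> \<Longrightarrow> x = \<zero> \<or> y = \<zero>"
    and ore: "a \<in> carrier R \<Longrightarrow> b \<in> carrier R \<Longrightarrow> a \<noteq> \<zero> \<Longrightarrow> b \<noteq> \<zero> \<Longrightarrow>
      \<exists>u\<in>carrier R. \<exists>v\<in>carrier R. a \<otimes> u = b \<otimes> v \<and> a \<otimes> u \<noteq> \<zero>"
begin

lemma mult_nonzero:
  "x \<in> carrier R \<Longrightarrow> y \<in> carrier R \<Longrightarrow> x \<noteq> \<zero> \<Longrightarrow> y \<noteq> \<zero> \<Longrightarrow> x \<otimes> y \<noteq> \<zero>"
  using no_zero_divisors by blast

lemma minus_eq_zeroD: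
  assumes "y \<in> carrier R" "z \<in> carrier R" "y \<ominus> z = \<zero>"
  shows "y = z"
proof -
  have "y = (y \<ominus> z) \<oplus> z"
    using assms(1,2) by (simp add: minus_eq a_assoc l_neg)
  then show ?thesis using assms by simp
qed

lemma cancel_left:
  assumes "x \<in> carrier R" "y \<in> carrier R" "z \<in> carrier R" "x \<noteq> \<zero>" "x \<otimes> y = x \<otimes> z"
  shows "y = z"
proof -
  have "x \<otimes> (y \<ominus> z) = \<zero>"
    using assms by (simp add: minus_eq r_distr r_minus r_neg)
  with assms no_zero_divisors[of x "y \<ominus> z"] have "y \<ominus> z = \<zero>"
    by simp
  then show ?thesis by (rule minus_eq_zeroD[OF assms(2,3)])
qed

lemma cancel_right:
  assumes "x \<in> carrier R" "y \<in> carrier R" "z \<in> carrier R" "x \<noteq> \<zero>" "y \<otimes> x = z \<otimes> x"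
  shows "y = z"
proof -
  have "(y \<ominus> z) \<otimes> x = \<zero>"
    using assms by (simp add: minus_eq l_distr l_minus r_neg)
  with assms no_zero_divisors[of "y \<ominus> z" x] have "y \<ominus> z = \<zero>"
    by simp
  then show ?thesis by (rule minus_eq_zeroD[OF assms(2,3)])
qed

lemma ore_relI:
  assumes "(a, b) \<in> ore_pairs R" "(c, d) \<in> ore_pairs R" "u \<in> carrier R" "v \<in> carrier R"
    "a \<otimes> u = c \<otimes> v" "b \<otimes> u = d \<otimes> v" "b \<otimes> u \<noteq> \<zero>"
  shows "((a, b), (c, d)) \<in> ore_rel R"
  using assms unfolding ore_rel_def by blast

text \<open>
  Two common multiples \<open>b u = d v\<close> and \<open>b u' = d v'\<close> have a common right multiple again, so an
  equality of numerators that holds for one of them passes to the other by cancellation.  Equality of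
  fractions can therefore be tested with any nonzero common multiple.
\<close>

lemma ore_rel_any:
  assumes rel: "((a, b), (c, d)) \<in> ore_rel R"
    and uv: "u' \<in> carrier R" "v' \<in> carrier R" "b \<otimes> u' = d \<otimes> v'"
  shows "a \<otimes> u' = c \<otimes> v'"
proof -
  from rel obtain u v where *: "u \<in> carrier R" "v \<in> carrier R"
      "a \<otimes> u = c \<otimes> v" "b \<otimes> u = d \<otimes> v" "b \<otimes> u \<noteq> \<zero>"
    and ab: "a \<in> carrier R" "b \<in> carrier R" "b \<noteq> \<zero>"
    and cd: "c \<in> carrier R" "d \<in> carrier R" "d \<noteq> \<zero>"
    unfolding ore_rel_def ore_pairs_def by blast
  show ?thesis
  proof (cases "u' = \<zero>")
    case True
    then have "d \<otimes> v' = \<zero>" using uv ab by simp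
    then have "v' = \<zero>" using no_zero_divisors[of d v'] uv cd by blast
    with True ab cd show ?thesis by simp
  next
    case False
    have "u \<noteq> \<zero>" using *(5) ab(2) by (metis r_null)
    with False obtain w w' where w: "w \<in> carrier R" "w' \<in> carrier R" "u' \<otimes> w' = u \<otimes> w"
        "u' \<otimes> w' \<noteq> \<zero>"
      using ore[of u' u] uv * by blast
    have w'0: "w' \<noteq> \<zero>" using w uv by auto
    have "d \<otimes> (v \<otimes> w) = b \<otimes> (u \<otimes> w)"
      using * ab cd w by (simp add: m_assoc[symmetric])
    also have "\<dots> = b \<otimes> (u' \<otimes> w')" using w by simp
    also have "\<dots> = d \<otimes> (v' \<otimes> w')"
      using uv ab cd w(1,2) by (simp add: m_assoc[symmetric])
    finally have v: "v \<otimes> w = v' \<otimes> w'"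
      using cancel_left[of d "v \<otimes> w" "v' \<otimes> w'"] cd * uv w by simp
    have "(a \<otimes> u') \<otimes> w' = a \<otimes> (u \<otimes> w)" using ab uv w by (simp add: m_assoc)
    also have "\<dots> = c \<otimes> (v \<otimes> w)" using * ab cd w by (simp add: m_assoc[symmetric])
    also have "\<dots> = (c \<otimes> v') \<otimes> w'" using v cd uv w by (simp add: m_assoc)
    finally show ?thesis
      using cancel_right[of w' "a \<otimes> u'" "c \<otimes> v'"] w'0 w ab cd uv by simp
  qed
qed

lemma ore_pairsD:
  assumes "(a, b) \<in> ore_pairs R"
  shows "a \<in> carrier R" "b \<in> carrier R" "b \<noteq> \<zero>"
  using assms by (auto simp: ore_pairs_def)

lemma ore_rel_pairs:
  assumes "((a, b), (c, d)) \<in> ore_rel R"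
  shows "(a, b) \<in> ore_pairs R" "(c, d) \<in> ore_pairs R"
  using assms by (auto simp: ore_rel_def)

text \<open>
  For transitivity the witness \<open>b u = d v\<close> is extended to a common multiple of all three
  denominators.
\<close>

lemma equiv_ore_rel: "equiv (ore_pairs R) (ore_rel R)"
proof (rule equivI)
  show "ore_rel R \<subseteq> ore_pairs R \<times> ore_pairs R"
    by (auto simp: ore_rel_def)
  show "refl_on (ore_pairs R) (ore_rel R)"
  proof (rule refl_onI)
    fix x assume "x \<in> ore_pairs R"
    then obtain a b where "x = (a, b)" "(a, b) \<in> ore_pairs R" by (cases x) auto
    then show "(x, x) \<in> ore_rel R"
      using ore_relI[of a b a b \<one> \<one>] by (simp add: ore_pairsD)
  qed
  show "sym (ore_rel R)"
  proof (rule symI)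
    fix x y assume "(x, y) \<in> ore_rel R"
    then show "(y, x) \<in> ore_rel R"
      unfolding ore_rel_def by clarsimp (metis (no_types, lifting))
  qed
  show "trans (ore_rel R)"
  proof (rule transI)
    fix x y z assume xy: "(x, y) \<in> ore_rel R" and yz: "(y, z) \<in> ore_rel R"
    obtain a b c d a' b' where x: "x = (a, b)" and y: "y = (c, d)" and z: "z = (a', b')"
      by (metis surj_pair)
    have rel: "((a, b), (c, d)) \<in> ore_rel R" "((c, d), (a', b')) \<in> ore_rel R"
      using xy yz x y z by auto
    note P = ore_rel_pairs[OF rel(1)] ore_rel_pairs[OF rel(2)]
    note Q = ore_pairsD[OF P(1)] ore_pairsD[OF P(2)] ore_pairsD[OF P(4)]
    obtain u v where uv: "u \<in> carrier R" "v \<in> carrier R" "b \<otimes> u = d \<otimes> v" "b \<otimes> u \<noteq> \<zero>"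
      using ore[of b d] Q by blast
    obtain p q where pq: "p \<in> carrier R" "q \<in> carrier R" "(b \<otimes> u) \<otimes> p = b' \<otimes> q"
        "(b \<otimes> u) \<otimes> p \<noteq> \<zero>"
      using ore[of "b \<otimes> u" b'] Q uv by blast
    have 1: "a \<otimes> (u \<otimes> p) = c \<otimes> (v \<otimes> p)"
      by (rule ore_rel_any[OF rel(1)]) (use uv pq Q in \<open>simp_all add: m_assoc[symmetric]\<close>)
    have 2: "c \<otimes> (v \<otimes> p) = a' \<otimes> q"
      by (rule ore_rel_any[OF rel(2)]) (use uv pq Q in \<open>simp_all add: m_assoc[symmetric]\<close>)
    show "(x, z) \<in> ore_rel R" unfolding x z
      by (rule ore_relI[of _ _ _ _ "u \<otimes> p" q])
        (use 1 2 P uv pq Q in \<open>simp_all add: m_assoc[symmetric]\<close>)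
  qed
qed

lemma ore_frac_eq_iff:
  assumes "(a, b) \<in> ore_pairs R" "(c, d) \<in> ore_pairs R"
  shows "ore_frac R a b = ore_frac R c d \<longleftrightarrow> ((a, b), (c, d)) \<in> ore_rel R"
  unfolding ore_frac_def using eq_equiv_class_iff[OF equiv_ore_rel assms] .

lemma ore_frac_self: "(a, b) \<in> ore_pairs R \<Longrightarrow> (a, b) \<in> ore_frac R a b"
  unfolding ore_frac_def using equiv_class_self[OF equiv_ore_rel] .

lemma ore_frac_memD:
  assumes "(a', b') \<in> ore_frac R a b"
  shows "((a', b'), (a, b)) \<in> ore_rel R" "(a', b') \<in> ore_pairs R"
proof -
  have "((a, b), (a', b')) \<in> ore_rel R" using assms by (simp add: ore_frac_def)
  then show "((a', b'), (a, b)) \<in> ore_rel R" "(a', b') \<in> ore_pairs R"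
    using equivE[OF equiv_ore_rel] by (blast dest: symD, simp add: ore_rel_pairs)
qed

lemma ore_frac_in_Frac: "(a, b) \<in> ore_pairs R \<Longrightarrow> ore_frac R a b \<in> carrier (Frac R)"
  by (simp add: Frac_def ore_frac_def quotientI)

lemma Frac_carrierE:
  assumes "X \<in> carrier (Frac R)"
  obtains a b where "(a, b) \<in> ore_pairs R" "X = ore_frac R a b"
  using assms by (auto simp: Frac_def ore_frac_def elim!: quotientE)

lemma ore_pairsI:
  "a \<in> carrier R \<Longrightarrow> b \<in> carrier R \<Longrightarrow> b \<noteq> \<zero> \<Longrightarrow> (a, b) \<in> ore_pairs R"
  by (simp add: ore_pairs_def)

text \<open>
  Any two admissible choices of representatives and multipliers give denominators with a common
  right multiple, and after multiplying up the numerators agree as well.  So all classes in the union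
  that defines the sum coincide; the same reasoning applies to products and scalar multiples.
\<close>

lemma Frac_add:
  assumes ab: "(a, b) \<in> ore_pairs R" and cd: "(c, d) \<in> ore_pairs R"
    and uv: "u \<in> carrier R" "v \<in> carrier R" "b \<otimes> u = d \<otimes> v" "b \<otimes> u \<noteq> \<zero>"
  shows "ore_frac R a b \<oplus>\<^bsub>Frac R\<^esub> ore_frac R c d = ore_frac R (a \<otimes> u \<oplus> c \<otimes> v) (b \<otimes> u)"
proof -
  have wd: "ore_frac R (a' \<otimes> u' \<oplus> c' \<otimes> v') (b' \<otimes> u') = ore_frac R (a \<otimes> u \<oplus> c \<otimes> v) (b \<otimes> u)"
    if m: "(a', b') \<in> ore_frac R a b" "(c', d') \<in> ore_frac R c d"
      and uv': "u' \<in> carrier R" "v' \<in> carrier R" "b' \<otimes> u' = d' \<otimes> v'" "b' \<otimes> u' \<noteq> \<zero>"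
    for a' b' c' d' u' v'
  proof -
    note r = ore_frac_memD[OF m(1)] ore_frac_memD[OF m(2)]
    note Q = ore_pairsD[OF ab] ore_pairsD[OF cd] ore_pairsD[OF r(2)] ore_pairsD[OF r(4)]
    obtain p q where pq: "p \<in> carrier R" "q \<in> carrier R"
        "(b' \<otimes> u') \<otimes> p = (b \<otimes> u) \<otimes> q" "(b' \<otimes> u') \<otimes> p \<noteq> \<zero>"
      using ore[of "b' \<otimes> u'" "b \<otimes> u"] uv uv' Q by (metis m_closed)
    have 1: "a' \<otimes> (u' \<otimes> p) = a \<otimes> (u \<otimes> q)"
      by (rule ore_rel_any[OF r(1)]) (use uv uv' pq Q in \<open>simp_all add: m_assoc[symmetric]\<close>)
    have 2: "c' \<otimes> (v' \<otimes> p) = c \<otimes> (v \<otimes> q)"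
      by (rule ore_rel_any[OF r(3)]) (use uv uv' pq Q in \<open>simp_all add: m_assoc[symmetric]\<close>)
    have "((a' \<otimes> u' \<oplus> c' \<otimes> v', b' \<otimes> u'), (a \<otimes> u \<oplus> c \<otimes> v, b \<otimes> u)) \<in> ore_rel R"
      by (rule ore_relI[of _ _ _ _ p q])
        (use 1 2 uv uv' pq Q in \<open>simp_all add: ore_pairsI l_distr m_assoc\<close>)
    then show ?thesis
      by (subst ore_frac_eq_iff) (use uv uv' Q in \<open>simp_all add: ore_pairsI\<close>)
  qed
  show ?thesis
    unfolding Frac_def ring_record_simps monoid.simps
    using wd ore_frac_self[OF ab] ore_frac_self[OF cd] uv by fast
qed

lemma Frac_mult:
  assumes ab: "(a, b) \<in> ore_pairs R" and cd: "(c, d) \<in> ore_pairs R"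
    and uv: "u \<in> carrier R" "v \<in> carrier R" "v \<noteq> \<zero>" "b \<otimes> u = c \<otimes> v"
  shows "ore_frac R a b \<otimes>\<^bsub>Frac R\<^esub> ore_frac R c d = ore_frac R (a \<otimes> u) (d \<otimes> v)"
proof -
  have wd: "ore_frac R (a' \<otimes> u') (d' \<otimes> v') = ore_frac R (a \<otimes> u) (d \<otimes> v)"
    if m: "(a', b') \<in> ore_frac R a b" "(c', d') \<in> ore_frac R c d"
      and uv': "u' \<in> carrier R" "v' \<in> carrier R" "v' \<noteq> \<zero>" "b' \<otimes> u' = c' \<otimes> v'"
    for a' b' c' d' u' v'
  proof -
    note r = ore_frac_memD[OF m(1)] ore_frac_memD[OF m(2)]
    note Q = ore_pairsD[OF ab] ore_pairsD[OF cd] ore_pairsD[OF r(2)] ore_pairsD[OF r(4)]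
    note nz = mult_nonzero[OF Q(5) uv(2) Q(6) uv(3)] mult_nonzero[OF Q(11) uv'(2) Q(12) uv'(3)]
    obtain p q where pq: "p \<in> carrier R" "q \<in> carrier R"
        "(d' \<otimes> v') \<otimes> p = (d \<otimes> v) \<otimes> q" "(d' \<otimes> v') \<otimes> p \<noteq> \<zero>"
      using ore[of "d' \<otimes> v'" "d \<otimes> v"] uv uv' Q nz by (metis m_closed)
    have 1: "c' \<otimes> (v' \<otimes> p) = c \<otimes> (v \<otimes> q)"
      by (rule ore_rel_any[OF r(3)]) (use uv uv' pq Q in \<open>simp_all add: m_assoc[symmetric]\<close>)
    then have "b' \<otimes> (u' \<otimes> p) = b \<otimes> (u \<otimes> q)"
      using uv uv' pq Q by (simp add: m_assoc[symmetric])
    then have 2: "a' \<otimes> (u' \<otimes> p) = a \<otimes> (u \<otimes> q)"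
      by (rule ore_rel_any[OF r(1), rotated 2]) (use uv uv' pq Q in simp_all)
    have "((a' \<otimes> u', d' \<otimes> v'), (a \<otimes> u, d \<otimes> v)) \<in> ore_rel R"
      by (rule ore_relI[of _ _ _ _ p q])
        (use 2 uv uv' pq Q nz in \<open>simp_all add: ore_pairsI m_assoc\<close>)
    then show ?thesis
      by (subst ore_frac_eq_iff) (use uv uv' Q nz in \<open>simp_all add: ore_pairsI\<close>)
  qed
  show ?thesis
    unfolding Frac_def ring_record_simps monoid.simps
    using wd ore_frac_self[OF ab] ore_frac_self[OF cd] uv by fast
qed

lemma Frac_smult:
  assumes ab: "(a, b) \<in> ore_pairs R"
  shows "s \<odot>\<^bsub>Frac R\<^esub> ore_frac R a b = ore_frac R (s \<odot> a) b"
proof -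
  have wd: "ore_frac R (s \<odot> a') b' = ore_frac R (s \<odot> a) b" if m: "(a', b') \<in> ore_frac R a b"
    for a' b'
  proof -
    note r = ore_frac_memD[OF m]
    note Q = ore_pairsD[OF ab] ore_pairsD[OF r(2)]
    from r(1) obtain u v where uv: "u \<in> carrier R" "v \<in> carrier R" "a' \<otimes> u = a \<otimes> v"
        "b' \<otimes> u = b \<otimes> v" "b' \<otimes> u \<noteq> \<zero>"
      unfolding ore_rel_def by blast
    have "((s \<odot> a', b'), (s \<odot> a, b)) \<in> ore_rel R"
      by (rule ore_relI[of _ _ _ _ u v]) (use uv Q in \<open>simp_all add: ore_pairsI smult_mult_left\<close>)
    then show ?thesis
      by (subst ore_frac_eq_iff) (use uv Q in \<open>simp_all add: ore_pairsI\<close>)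
  qed
  show ?thesis
    unfolding Frac_def module.simps
    using wd ore_frac_self[OF ab] by fast
qed

lemma ore_mult:
  assumes "b \<in> carrier R" "c \<in> carrier R" "b \<noteq> \<zero>"
  obtains u v where "u \<in> carrier R" "v \<in> carrier R" "v \<noteq> \<zero>" "b \<otimes> u = c \<otimes> v"
proof (cases "c = \<zero>")
  case True
  show ?thesis by (rule that[of \<zero> \<one>]) (use True assms one_neq_zero in simp_all)
next
  case False
  then obtain u v where "u \<in> carrier R" "v \<in> carrier R" "b \<otimes> u = c \<otimes> v" "b \<otimes> u \<noteq> \<zero>"
    using ore[of b c] assms by blast
  moreover from this have "v \<noteq> \<zero>" using assms r_null by metis
  ultimately show ?thesis using that by blast
qed

lemma Frac_closed:
  assumes "X \<in> carrier (Frac R)" "Y \<in> carrier (Frac R)"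
  shows "X \<oplus>\<^bsub>Frac R\<^esub> Y \<in> carrier (Frac R)" "X \<otimes>\<^bsub>Frac R\<^esub> Y \<in> carrier (Frac R)"
    "s \<odot>\<^bsub>Frac R\<^esub> X \<in> carrier (Frac R)"
proof -
  obtain a b c d where ab: "(a, b) \<in> ore_pairs R" "X = ore_frac R a b"
    and cd: "(c, d) \<in> ore_pairs R" "Y = ore_frac R c d"
    using assms by (metis Frac_carrierE)
  note Q = ore_pairsD[OF ab(1)] ore_pairsD[OF cd(1)]
  show "s \<odot>\<^bsub>Frac R\<^esub> X \<in> carrier (Frac R)"
    using ab Q by (simp add: Frac_smult ore_frac_in_Frac ore_pairsI)
  obtain u v where "u \<in> carrier R" "v \<in> carrier R" "b \<otimes> u = d \<otimes> v" "b \<otimes> u \<noteq> \<zero>"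
    using ore[of b d] Q by blast
  then show "X \<oplus>\<^bsub>Frac R\<^esub> Y \<in> carrier (Frac R)"
    using ab cd Q by (simp add: Frac_add[of a b c d u v] ore_frac_in_Frac ore_pairsI)
  obtain u v where "u \<in> carrier R" "v \<in> carrier R" "v \<noteq> \<zero>" "b \<otimes> u = c \<otimes> v"
    using ore_mult[of b c] Q by blast
  then show "X \<otimes>\<^bsub>Frac R\<^esub> Y \<in> carrier (Frac R)"
    using ab cd Q
    by (simp add: Frac_mult[of a b c d u v] ore_frac_in_Frac ore_pairsI mult_nonzero)
qed

end

lemma alg_isomorphic_trans: "A \<cong>\<^sub>a B \<Longrightarrow> B \<cong>\<^sub>a C \<Longrightarrow> A \<cong>\<^sub>a C"
proof -
  assume "A \<cong>\<^sub>a B" "B \<cong>\<^sub>a C"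
  then obtain p q where p: "p \<in> alg_iso A B" and q: "q \<in> alg_iso B C"
    unfolding alg_isomorphic_def by blast
  then have "q \<circ> p \<in> alg_iso A C"
    unfolding alg_iso_def ring_iso_def ring_hom_def
    by (auto intro: bij_betw_trans simp: Pi_iff)
  then show ?thesis unfolding alg_isomorphic_def by blast
qed

text \<open>
  The inverse of an isomorphism \<open>p\<close> is multiplicative because \<open>p\<close> can be applied to a product in
  \<open>Frac R\<close>.  This uses that the product lies in the carrier again, which the Ore condition ensures.
\<close>

lemma alg_isomorphic_Frac_sym:
  assumes "ore_domain R" and "Frac R \<cong>\<^sub>a B"
  shows "B \<cong>\<^sub>a Frac R"
proof -
  interpret ore_domain R by fact
  from assms(2) obtain p where p: "p \<in> alg_iso (Frac R) B"
    unfolding alg_isomorphic_def by blast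
  then have bij: "bij_betw p (carrier (Frac R)) (carrier B)"
    by (simp add: alg_iso_def ring_iso_def)
  define q where "q = inv_into (carrier (Frac R)) p"
  have qbij: "bij_betw q (carrier B) (carrier (Frac R))"
    unfolding q_def by (rule bij_betw_inv_into[OF bij])
  have qc: "q x \<in> carrier (Frac R)" if "x \<in> carrier B" for x
    using bij_betwE[OF qbij] that by blast
  have pq: "p (q x) = x" if "x \<in> carrier B" for x
    unfolding q_def by (rule bij_betw_inv_into_right[OF bij that])
  have qp: "q (p X) = X" if "X \<in> carrier (Frac R)" for X
    unfolding q_def by (rule bij_betw_inv_into_left[OF bij that])
  have one: "\<one>\<^bsub>Frac R\<^esub> \<in> carrier (Frac R)"
    using ore_frac_in_Frac[of "\<one>\<^bsub>R\<^esub>" "\<one>\<^bsub>R\<^esub>"] one_neq_zero by (simp add: Frac_def ore_pairsI)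
  have hp: "p \<in> ring_iso (Frac R) B" and ps: "\<And>c X. X \<in> carrier (Frac R) \<Longrightarrow>
      p (c \<odot>\<^bsub>Frac R\<^esub> X) = c \<odot>\<^bsub>B\<^esub> p X"
    using p by (simp_all add: alg_iso_def)
  note h = ring_iso_memE[OF hp]
  have "q \<in> ring_iso B (Frac R)"
  proof (rule ring_iso_memI)
    fix x y assume x: "x \<in> carrier B" and y: "y \<in> carrier B"
    note xy = qc[OF x] qc[OF y]
    show "q x \<in> carrier (Frac R)" by fact
    have "p (q x \<otimes>\<^bsub>Frac R\<^esub> q y) = x \<otimes>\<^bsub>B\<^esub> y"
      by (simp add: h(2)[OF xy] pq x y)
    then show "q (x \<otimes>\<^bsub>B\<^esub> y) = q x \<otimes>\<^bsub>Frac R\<^esub> q y"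
      using qp[OF Frac_closed(2)[OF xy]] by simp
    have "p (q x \<oplus>\<^bsub>Frac R\<^esub> q y) = x \<oplus>\<^bsub>B\<^esub> y"
      by (simp add: h(3)[OF xy] pq x y)
    then show "q (x \<oplus>\<^bsub>B\<^esub> y) = q x \<oplus>\<^bsub>Frac R\<^esub> q y"
      using qp[OF Frac_closed(1)[OF xy]] by simp
  next
    show "q \<one>\<^bsub>B\<^esub> = \<one>\<^bsub>Frac R\<^esub>"
      using qp[OF one] h(4) by simp
  qed (rule qbij)
  moreover have "q (c \<odot>\<^bsub>B\<^esub> x) = c \<odot>\<^bsub>Frac R\<^esub> q x" if x: "x \<in> carrier B" for c x
  proof -
    have "p (c \<odot>\<^bsub>Frac R\<^esub> q x) = c \<odot>\<^bsub>B\<^esub> x"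
      by (simp add: ps[OF qc[OF x]] pq x)
    then show ?thesis
      using qp[OF Frac_closed(3)[OF qc[OF x] qc[OF x]]] by metis
  qed
  ultimately show ?thesis
    unfolding alg_isomorphic_def alg_iso_def by blast
qed


section \<open>Dense embeddings\<close>

text \<open>
  Density says that every element of \<open>L\<close> is a right fraction of elements of \<open>R\<close>.  The Ore condition
  is required of \<open>L\<close> only: a common multiple in \<open>L\<close> becomes one in \<open>R\<close> once its cofactors are
  multiplied on the right by their denominators.
\<close>

locale dense_embedding = R: nc_algebra R + L: ore_domain L
  for R :: "('k::field, 'a) module" and L :: "('k, 'b) module" +
  fixes \<iota> :: "'a \<Rightarrow> 'b"
  assumes hom: "\<iota> \<in> ring_hom R L"
    and hom_smult: "x \<in> carrier R \<Longrightarrow> \<iota> (c \<odot>\<^bsub>R\<^esub> x) = c \<odot>\<^bsub>L\<^esub> \<iota> x"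
    and inj: "inj_on \<iota> (carrier R)"
    and dense: "l \<in> carrier L \<Longrightarrow>
      \<exists>r\<in>carrier R. \<exists>s\<in>carrier R. s \<noteq> \<zero>\<^bsub>R\<^esub> \<and> l \<otimes>\<^bsub>L\<^esub> \<iota> s = \<iota> r"
begin

lemma hom_simps [simp]:
  "x \<in> carrier R \<Longrightarrow> \<iota> x \<in> carrier L"
  "x \<in> carrier R \<Longrightarrow> y \<in> carrier R \<Longrightarrow> \<iota> (x \<otimes>\<^bsub>R\<^esub> y) = \<iota> x \<otimes>\<^bsub>L\<^esub> \<iota> y"
  "x \<in> carrier R \<Longrightarrow> y \<in> carrier R \<Longrightarrow> \<iota> (x \<oplus>\<^bsub>R\<^esub> y) = \<iota> x \<oplus>\<^bsub>L\<^esub> \<iota> y"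
  "\<iota> \<one>\<^bsub>R\<^esub> = \<one>\<^bsub>L\<^esub>" "\<iota> \<zero>\<^bsub>R\<^esub> = \<zero>\<^bsub>L\<^esub>"
  using ring_hom_memE[OF hom] ring_hom_zero[OF hom] R.ring_axioms L.ring_axioms by blast+

lemma hom_eq_iff: "x \<in> carrier R \<Longrightarrow> y \<in> carrier R \<Longrightarrow> \<iota> x = \<iota> y \<longleftrightarrow> x = y"
  using inj by (auto dest: inj_onD)

lemma hom_eq_zero_iff: "x \<in> carrier R \<Longrightarrow> \<iota> x = \<zero>\<^bsub>L\<^esub> \<longleftrightarrow> x = \<zero>\<^bsub>R\<^esub>"
  using hom_eq_iff[of x "\<zero>\<^bsub>R\<^esub>"] by simp

sublocale R: ore_domain R
proof
  show "\<one>\<^bsub>R\<^esub> \<noteq> \<zero>\<^bsub>R\<^esub>"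
    using hom_eq_zero_iff[of "\<one>\<^bsub>R\<^esub>"] L.one_neq_zero by simp
  show "x = \<zero>\<^bsub>R\<^esub> \<or> y = \<zero>\<^bsub>R\<^esub>"
    if "x \<in> carrier R" "y \<in> carrier R" "x \<otimes>\<^bsub>R\<^esub> y = \<zero>\<^bsub>R\<^esub>" for x y
    using that L.no_zero_divisors[of "\<iota> x" "\<iota> y"] hom_simps(2)[of x y]
    by (simp add: hom_eq_zero_iff)
next
  fix a b assume ab: "a \<in> carrier R" "b \<in> carrier R" "a \<noteq> \<zero>\<^bsub>R\<^esub>" "b \<noteq> \<zero>\<^bsub>R\<^esub>"
  obtain u v where uv: "u \<in> carrier L" "v \<in> carrier L" "\<iota> a \<otimes>\<^bsub>L\<^esub> u = \<iota> b \<otimes>\<^bsub>L\<^esub> v"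
      "\<iota> a \<otimes>\<^bsub>L\<^esub> u \<noteq> \<zero>\<^bsub>L\<^esub>"
    using L.ore[of "\<iota> a" "\<iota> b"] ab by (auto simp: hom_eq_zero_iff)
  (* The second cofactor is cleared only after multiplication by s: both need the same multiplier s t. *)
  obtain u' s where s: "u' \<in> carrier R" "s \<in> carrier R" "s \<noteq> \<zero>\<^bsub>R\<^esub>" "u \<otimes>\<^bsub>L\<^esub> \<iota> s = \<iota> u'"
    using dense[OF uv(1)] by blast
  obtain v' t where t: "v' \<in> carrier R" "t \<in> carrier R" "t \<noteq> \<zero>\<^bsub>R\<^esub>"
      "(v \<otimes>\<^bsub>L\<^esub> \<iota> s) \<otimes>\<^bsub>L\<^esub> \<iota> t = \<iota> v'"
    using dense[of "v \<otimes>\<^bsub>L\<^esub> \<iota> s"] uv s by auto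
  have st: "\<iota> s \<otimes>\<^bsub>L\<^esub> \<iota> t \<noteq> \<zero>\<^bsub>L\<^esub>"
    using s t by (simp add: L.mult_nonzero hom_eq_zero_iff)
  have 1: "\<iota> (a \<otimes>\<^bsub>R\<^esub> (u' \<otimes>\<^bsub>R\<^esub> t)) = (\<iota> a \<otimes>\<^bsub>L\<^esub> u) \<otimes>\<^bsub>L\<^esub> (\<iota> s \<otimes>\<^bsub>L\<^esub> \<iota> t)"
    using ab s(1-3) t uv(1,2) by (simp add: s(4)[symmetric] L.m_assoc)
  have 2: "\<iota> (b \<otimes>\<^bsub>R\<^esub> v') = (\<iota> b \<otimes>\<^bsub>L\<^esub> v) \<otimes>\<^bsub>L\<^esub> (\<iota> s \<otimes>\<^bsub>L\<^esub> \<iota> t)"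
    using ab s t(1-3) uv(1,2) by (simp add: t(4)[symmetric] L.m_assoc)
  have "a \<otimes>\<^bsub>R\<^esub> (u' \<otimes>\<^bsub>R\<^esub> t) = b \<otimes>\<^bsub>R\<^esub> v'"
    using 1 2 uv ab s t hom_eq_iff[of "a \<otimes>\<^bsub>R\<^esub> (u' \<otimes>\<^bsub>R\<^esub> t)" "b \<otimes>\<^bsub>R\<^esub> v'"] by simp
  moreover have "a \<otimes>\<^bsub>R\<^esub> (u' \<otimes>\<^bsub>R\<^esub> t) \<noteq> \<zero>\<^bsub>R\<^esub>"
    using 1 L.mult_nonzero[OF _ _ uv(4) st] ab s t uv hom_eq_zero_iff[of "a \<otimes>\<^bsub>R\<^esub> (u' \<otimes>\<^bsub>R\<^esub> t)"]
    by simp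
  ultimately show "\<exists>u\<in>carrier R. \<exists>v\<in>carrier R. a \<otimes>\<^bsub>R\<^esub> u = b \<otimes>\<^bsub>R\<^esub> v \<and> a \<otimes>\<^bsub>R\<^esub> u \<noteq> \<zero>\<^bsub>R\<^esub>"
    using s t by (intro bexI[of _ "u' \<otimes>\<^bsub>R\<^esub> t"] bexI[of _ v']) simp_all
qed

lemma pairs_hom: "(a, b) \<in> ore_pairs R \<Longrightarrow> (\<iota> a, \<iota> b) \<in> ore_pairs L"
  by (auto simp: ore_pairs_def hom_eq_zero_iff)

text \<open>
  Equality of the images is tested with a common multiple taken from \<open>R\<close>, where injectivity applies.
\<close>

lemma ore_rel_iff:
  assumes ab: "(a, b) \<in> ore_pairs R" and cd: "(c, d) \<in> ore_pairs R"
  shows "((\<iota> a, \<iota> b), (\<iota> c, \<iota> d)) \<in> ore_rel L \<longleftrightarrow> ((a, b), (c, d)) \<in> ore_rel R"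
proof
  note Q = R.ore_pairsD[OF ab] R.ore_pairsD[OF cd]
  assume rel: "((\<iota> a, \<iota> b), (\<iota> c, \<iota> d)) \<in> ore_rel L"
  obtain u v where uv: "u \<in> carrier R" "v \<in> carrier R" "b \<otimes>\<^bsub>R\<^esub> u = d \<otimes>\<^bsub>R\<^esub> v"
      "b \<otimes>\<^bsub>R\<^esub> u \<noteq> \<zero>\<^bsub>R\<^esub>"
    using R.ore[of b d] Q by blast
  have "\<iota> a \<otimes>\<^bsub>L\<^esub> \<iota> u = \<iota> c \<otimes>\<^bsub>L\<^esub> \<iota> v"
    by (rule L.ore_rel_any[OF rel])
      (use uv Q hom_simps(2)[of b u] hom_simps(2)[of d v] in simp_all)
  then have "a \<otimes>\<^bsub>R\<^esub> u = c \<otimes>\<^bsub>R\<^esub> v"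
    using hom_eq_iff[of "a \<otimes>\<^bsub>R\<^esub> u" "c \<otimes>\<^bsub>R\<^esub> v"] uv Q by simp
  with uv show "((a, b), (c, d)) \<in> ore_rel R"
    using R.ore_relI[OF ab cd] by blast
next
  note Q = R.ore_pairsD[OF ab] R.ore_pairsD[OF cd]
  assume "((a, b), (c, d)) \<in> ore_rel R"
  then obtain u v where uv: "u \<in> carrier R" "v \<in> carrier R" "a \<otimes>\<^bsub>R\<^esub> u = c \<otimes>\<^bsub>R\<^esub> v"
      "b \<otimes>\<^bsub>R\<^esub> u = d \<otimes>\<^bsub>R\<^esub> v" "b \<otimes>\<^bsub>R\<^esub> u \<noteq> \<zero>\<^bsub>R\<^esub>"
    unfolding ore_rel_def by blast
  show "((\<iota> a, \<iota> b), (\<iota> c, \<iota> d)) \<in> ore_rel L"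
    by (rule L.ore_relI[OF pairs_hom[OF ab] pairs_hom[OF cd], of "\<iota> u" "\<iota> v"])
      (use uv Q in \<open>simp_all flip: hom_simps(2) add: hom_eq_iff hom_eq_zero_iff\<close>)
qed

definition frac_map :: "('a \<times> 'a) set \<Rightarrow> ('b \<times> 'b) set" where
  "frac_map X = (\<Union>(a, b)\<in>X. ore_frac L (\<iota> a) (\<iota> b))"

lemma frac_map_ore_frac:
  assumes ab: "(a, b) \<in> ore_pairs R"
  shows "frac_map (ore_frac R a b) = ore_frac L (\<iota> a) (\<iota> b)"
proof -
  have "ore_frac L (\<iota> a') (\<iota> b') = ore_frac L (\<iota> a) (\<iota> b)" if "(a', b') \<in> ore_frac R a b" for a' b'
    using R.ore_frac_memD[OF that] ab
    by (simp add: L.ore_frac_eq_iff pairs_hom ore_rel_iff)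
  then show ?thesis
    unfolding frac_map_def using R.ore_frac_self[OF ab] by fast
qed

theorem Frac_isomorphic: "Frac R \<cong>\<^sub>a Frac L"
proof -
  have "frac_map \<in> ring_iso (Frac R) (Frac L)"
  proof (rule ring_iso_memI)
    fix X Y assume "X \<in> carrier (Frac R)" "Y \<in> carrier (Frac R)"
    then obtain a b c d where ab: "(a, b) \<in> ore_pairs R" "X = ore_frac R a b"
      and cd: "(c, d) \<in> ore_pairs R" "Y = ore_frac R c d"
      by (metis R.Frac_carrierE)
    note Q = R.ore_pairsD[OF ab(1)] R.ore_pairsD[OF cd(1)]
    show "frac_map X \<in> carrier (Frac L)"
      using ab by (simp add: frac_map_ore_frac L.ore_frac_in_Frac pairs_hom)
    obtain u v where uv: "u \<in> carrier R" "v \<in> carrier R" "b \<otimes>\<^bsub>R\<^esub> u = d \<otimes>\<^bsub>R\<^esub> v"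
        "b \<otimes>\<^bsub>R\<^esub> u \<noteq> \<zero>\<^bsub>R\<^esub>"
      using R.ore[of b d] Q by blast
    have "ore_frac L (\<iota> a) (\<iota> b) \<oplus>\<^bsub>Frac L\<^esub> ore_frac L (\<iota> c) (\<iota> d) =
        ore_frac L (\<iota> a \<otimes>\<^bsub>L\<^esub> \<iota> u \<oplus>\<^bsub>L\<^esub> \<iota> c \<otimes>\<^bsub>L\<^esub> \<iota> v) (\<iota> b \<otimes>\<^bsub>L\<^esub> \<iota> u)"
      by (rule L.Frac_add)
        (use uv Q ab cd in \<open>simp_all flip: hom_simps(2) add: hom_eq_zero_iff pairs_hom\<close>)
    then show "frac_map (X \<oplus>\<^bsub>Frac R\<^esub> Y) = frac_map X \<oplus>\<^bsub>Frac L\<^esub> frac_map Y"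
      using ab cd uv(1,2,4) Q
      by (simp add: R.Frac_add[OF ab(1) cd(1) uv] frac_map_ore_frac R.ore_pairsI)
    obtain u v where uv: "u \<in> carrier R" "v \<in> carrier R" "v \<noteq> \<zero>\<^bsub>R\<^esub>" "b \<otimes>\<^bsub>R\<^esub> u = c \<otimes>\<^bsub>R\<^esub> v"
      using R.ore_mult[of b c] Q by blast
    have "ore_frac L (\<iota> a) (\<iota> b) \<otimes>\<^bsub>Frac L\<^esub> ore_frac L (\<iota> c) (\<iota> d) =
        ore_frac L (\<iota> a \<otimes>\<^bsub>L\<^esub> \<iota> u) (\<iota> d \<otimes>\<^bsub>L\<^esub> \<iota> v)"
      by (rule L.Frac_mult)
        (use uv Q ab cd in \<open>simp_all flip: hom_simps(2) add: hom_eq_zero_iff pairs_hom\<close>)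
    then show "frac_map (X \<otimes>\<^bsub>Frac R\<^esub> Y) = frac_map X \<otimes>\<^bsub>Frac L\<^esub> frac_map Y"
      using ab cd uv Q
      by (simp add: R.Frac_mult[of a b c d u v] frac_map_ore_frac R.ore_pairsI R.mult_nonzero)
  next
    have "frac_map (ore_frac R \<one>\<^bsub>R\<^esub> \<one>\<^bsub>R\<^esub>) = ore_frac L \<one>\<^bsub>L\<^esub> \<one>\<^bsub>L\<^esub>"
      by (simp add: frac_map_ore_frac R.ore_pairsI R.one_neq_zero)
    then show "frac_map \<one>\<^bsub>Frac R\<^esub> = \<one>\<^bsub>Frac L\<^esub>"
      by (simp add: Frac_def)
  next
    show "bij_betw frac_map (carrier (Frac R)) (carrier (Frac L))"
    proof (rule bij_betw_imageI)
      show "inj_on frac_map (carrier (Frac R))"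
      proof (rule inj_onI)
        fix X Y assume "X \<in> carrier (Frac R)" "Y \<in> carrier (Frac R)"
          and eq: "frac_map X = frac_map Y"
        then obtain a b c d where ab: "(a, b) \<in> ore_pairs R" "X = ore_frac R a b"
          and cd: "(c, d) \<in> ore_pairs R" "Y = ore_frac R c d"
          by (metis R.Frac_carrierE)
        with eq show "X = Y"
          by (simp add: frac_map_ore_frac L.ore_frac_eq_iff R.ore_frac_eq_iff pairs_hom ore_rel_iff)
      qed
      show "frac_map ` carrier (Frac R) = carrier (Frac L)"
      proof (intro equalityI subsetI)
        fix Y assume "Y \<in> frac_map ` carrier (Frac R)"
        then obtain X where X: "X \<in> carrier (Frac R)" "Y = frac_map X" by blast
        from X(1) obtain a b where "(a, b) \<in> ore_pairs R" "X = ore_frac R a b"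
          by (rule R.Frac_carrierE)
        with X(2) show "Y \<in> carrier (Frac L)"
          by (simp add: frac_map_ore_frac L.ore_frac_in_Frac pairs_hom)
      next
        fix Y assume "Y \<in> carrier (Frac L)"
        then obtain l k where lk: "(l, k) \<in> ore_pairs L" "Y = ore_frac L l k"
          by (rule L.Frac_carrierE)
        note Q = L.ore_pairsD[OF lk(1)]
        obtain r s where rs: "r \<in> carrier R" "s \<in> carrier R" "s \<noteq> \<zero>\<^bsub>R\<^esub>" "l \<otimes>\<^bsub>L\<^esub> \<iota> s = \<iota> r"
          using dense[OF Q(1)] by blast
        obtain r' t where rt: "r' \<in> carrier R" "t \<in> carrier R" "t \<noteq> \<zero>\<^bsub>R\<^esub>"
            "(k \<otimes>\<^bsub>L\<^esub> \<iota> s) \<otimes>\<^bsub>L\<^esub> \<iota> t = \<iota> r'"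
          using dense[of "k \<otimes>\<^bsub>L\<^esub> \<iota> s"] Q rs by auto
        have "\<iota> r' \<noteq> \<zero>\<^bsub>L\<^esub>"
          using rt rs Q by (simp add: rt(4)[symmetric] L.mult_nonzero hom_eq_zero_iff)
        then have p: "(r \<otimes>\<^bsub>R\<^esub> t, r') \<in> ore_pairs R"
          using rs rt by (auto simp: R.ore_pairsI hom_eq_zero_iff)
        have "((l, k), (\<iota> (r \<otimes>\<^bsub>R\<^esub> t), \<iota> r')) \<in> ore_rel L"
          by (rule L.ore_relI[OF lk(1) pairs_hom[OF p], of "\<iota> s \<otimes>\<^bsub>L\<^esub> \<iota> t" "\<one>\<^bsub>L\<^esub>"])
            (use rs rt Q \<open>\<iota> r' \<noteq> \<zero>\<^bsub>L\<^esub>\<close> in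
              \<open>simp_all add: rs(4)[symmetric] rt(4)[symmetric] L.m_assoc\<close>)
        then have "Y = frac_map (ore_frac R (r \<otimes>\<^bsub>R\<^esub> t) r')"
          using lk p by (simp only: frac_map_ore_frac[OF p] L.ore_frac_eq_iff pairs_hom)
        then show "Y \<in> frac_map ` carrier (Frac R)"
          using R.ore_frac_in_Frac[OF p] by blast
      qed
    qed
  qed
  moreover have "frac_map (c \<odot>\<^bsub>Frac R\<^esub> X) = c \<odot>\<^bsub>Frac L\<^esub> frac_map X"
    if "X \<in> carrier (Frac R)" for c X
  proof -
    from that obtain a b where ab: "(a, b) \<in> ore_pairs R" "X = ore_frac R a b"
      by (rule R.Frac_carrierE)
    then show ?thesis
      using R.ore_pairsD[OF ab(1)]
      by (simp add: frac_map_ore_frac R.Frac_smult L.Frac_smult pairs_hom R.ore_pairsI hom_smult)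
  qed
  ultimately show ?thesis
    unfolding alg_isomorphic_def alg_iso_def by blast
qed

end


section \<open>Skew Laurent polynomials as difference operators\<close>

text \<open>
  The coefficients \<open>'r\<close> will be \<open>k[C]\<close> and the polynomial variable is \<open>h\<close>.  Working with operators
  instead of formal skew Laurent polynomials makes the associativity of the product evident, and
  restricting to \<open>'r\<close>-linear operators makes \<open>C\<close> central.
\<close>

typedef (overloaded) 'r lin_op =
  "{T :: 'r::comm_ring_1 poly \<Rightarrow> 'r poly.
     (\<forall>p q. T (p + q) = T p + T q) \<and> (\<forall>c p. T (Polynomial.smult c p) = Polynomial.smult c (T p))}"
  morphisms apply_op Abs_lin_op
  by (rule exI[of _ id]) simp

setup_lifting type_definition_lin_op

lemma apply_op_smult: "apply_op T (Polynomial.smult c p) = Polynomial.smult c (apply_op T p)"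
  by transfer simp

lemma lin_op_eqI: "(\<And>p. apply_op T p = apply_op U p) \<Longrightarrow> T = U"
  by transfer auto

instantiation lin_op :: (comm_ring_1) ring_1
begin

lift_definition zero_lin_op :: "'a lin_op" is "\<lambda>_. 0" by simp
lift_definition one_lin_op :: "'a lin_op" is "\<lambda>p. p" by simp
lift_definition plus_lin_op :: "'a lin_op \<Rightarrow> 'a lin_op \<Rightarrow> 'a lin_op" is "\<lambda>T U p. T p + U p"
  by (simp add: smult_add_right)
lift_definition uminus_lin_op :: "'a lin_op \<Rightarrow> 'a lin_op" is "\<lambda>T p. - T p"
  by simp
lift_definition minus_lin_op :: "'a lin_op \<Rightarrow> 'a lin_op \<Rightarrow> 'a lin_op" is "\<lambda>T U p. T p - U p"
  by (simp add: smult_diff_right)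
lift_definition times_lin_op :: "'a lin_op \<Rightarrow> 'a lin_op \<Rightarrow> 'a lin_op" is "\<lambda>T U p. T (U p)"
  by simp

instance
proof
  fix a b c :: "'a lin_op"
  show "a * b * c = a * (b * c)" by transfer simp
  show "1 * a = a" by transfer simp
  show "a * 1 = a" by transfer simp
  show "a + b + c = a + (b + c)" by transfer (simp add: add.assoc)
  show "a + b = b + a" by transfer (simp add: add.commute)
  show "0 + a = a" by transfer simp
  show "- a + a = 0" by transfer simp
  show "a - b = a + - b" by transfer simp
  show "(a + b) * c = a * c + b * c" by transfer simp
  show "a * (b + c) = a * b + a * c" by transfer simp
  show "(0 :: 'a lin_op) \<noteq> 1" by transfer (metis zero_neq_one)
qed

end

lift_definition mult_op :: "'r::comm_ring_1 poly \<Rightarrow> 'r lin_op" is "\<lambda>(p :: 'r poly) (q :: 'r poly). p * q"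
  by (simp add: algebra_simps)

lift_definition subst_op :: "'r::comm_ring_1 poly \<Rightarrow> 'r lin_op" is "\<lambda>(q :: 'r poly) (p :: 'r poly). pcompose p q"
  by (simp add: pcompose_add pcompose_smult)

definition shift :: "int \<Rightarrow> 'r::comm_ring_1 poly \<Rightarrow> 'r poly" where
  "shift n p = pcompose p [:- of_int n, 1:]"

definition shift_op :: "int \<Rightarrow> 'r::comm_ring_1 lin_op" where
  "shift_op n = subst_op [:- of_int n, 1:]"

lemma apply_op_simps:
  "apply_op 0 p = 0" "apply_op 1 p = p" "apply_op (T + U) p = apply_op T p + apply_op U p"
  "apply_op (T - U) p = apply_op T p - apply_op U p" "apply_op (- T) p = - apply_op T p"
  "apply_op (T * U) p = apply_op T (apply_op U p)"
  by (simp_all add: zero_lin_op.rep_eq one_lin_op.rep_eq plus_lin_op.rep_eq minus_lin_op.rep_eq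
      uminus_lin_op.rep_eq times_lin_op.rep_eq)

lemma apply_mult_op: "apply_op (mult_op q) p = q * p"
  by (simp add: mult_op.rep_eq)

lemma apply_subst_op: "apply_op (subst_op q) p = pcompose p q"
  by (simp add: subst_op.rep_eq)

lemma apply_shift_op: "apply_op (shift_op n) p = shift n p"
  by (simp add: shift_op_def shift_def apply_subst_op)

lemma apply_op_sum: "apply_op (sum f A) p = (\<Sum>i\<in>A. apply_op (f i) p)"
  by (induction A rule: infinite_finite_induct) (simp_all add: apply_op_simps)

lemma mult_op_add: "mult_op (p + q) = mult_op p + mult_op q"
  and mult_op_diff: "mult_op (p - q) = mult_op p - mult_op q"
  and mult_op_uminus: "mult_op (- p) = - mult_op p"
  and mult_op_mult: "mult_op (p * q) = mult_op p * mult_op q"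
  and mult_op_0 [simp]: "mult_op 0 = 0"
  and mult_op_1 [simp]: "mult_op 1 = 1"
  by (rule lin_op_eqI, simp add: apply_op_simps apply_mult_op algebra_simps)+

lemma const_op_commute: "T * mult_op [:c:] = mult_op [:c:] * T"
  by (rule lin_op_eqI) (simp add: apply_op_simps apply_mult_op apply_op_smult)

lemma subst_op_mult: "subst_op q * subst_op r = subst_op (pcompose r q)"
  by (rule lin_op_eqI) (simp add: apply_op_simps apply_subst_op pcompose_assoc)

lemma subst_op_mult_op: "subst_op q * mult_op p = mult_op (pcompose p q) * subst_op q"
  by (rule lin_op_eqI) (simp add: apply_op_simps apply_subst_op apply_mult_op pcompose_mult)

lemma subst_op_id [simp]: "subst_op [:0, 1:] = 1"
  by (rule lin_op_eqI) (simp add: apply_op_simps apply_subst_op)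

lemma shift_op_0 [simp]: "shift_op 0 = 1"
  by (simp add: shift_op_def)

lemma shift_op_add: "shift_op n * shift_op k = shift_op (n + k)"
  by (simp add: shift_op_def subst_op_mult pcompose_pCons add.commute)

lemma shift_op_mult_op: "shift_op n * mult_op p = mult_op (shift n p) * shift_op n"
  by (simp add: shift_op_def shift_def subst_op_mult_op)

lemma monomial_mult:
  "(mult_op p * shift_op n) * (mult_op q * shift_op k) =
    mult_op (p * shift n q) * shift_op (n + k)"
proof -
  have "(mult_op p * shift_op n) * (mult_op q * shift_op k) =
      mult_op p * (shift_op n * mult_op q) * shift_op k"
    by (simp add: mult.assoc)
  also have "\<dots> = mult_op (p * shift n q) * shift_op (n + k)"
    by (simp add: shift_op_mult_op mult_op_mult mult.assoc shift_op_add)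
  finally show ?thesis .
qed

lemma shift_0 [simp]: "shift n 0 = 0"
  and shift_zero [simp]: "shift 0 p = p"
  and shift_1 [simp]: "shift n 1 = 1"
  and shift_add: "shift n (p + q) = shift n p + shift n q"
  and shift_mult: "shift n (p * q) = shift n p * shift n q"
  and shift_pCons: "shift n (pCons c p) = [:c:] + ([:0, 1:] - of_int n) * shift n p"
  by (simp_all add: shift_def pcompose_add pcompose_mult pcompose_pCons pcompose_1 of_int_poly)

lemma shift_shift: "shift n (shift k p) = shift (n + k) p"
  by (simp add: shift_def pcompose_assoc[symmetric] pcompose_pCons add.commute)

lemma shift_const [simp]: "shift n [:c:] = [:c:]"
  by (simp add: shift_def)

lemma shift_X: "shift n [:0, 1:] = [:0, 1:] - of_int n"
  by (simp add: shift_pCons)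

lemma shift_diff: "shift n (p - q) = shift n p - shift n q"
  by (simp add: shift_def pcompose_diff)

lemma shift_eq_0_iff [simp]: "shift n p = 0 \<longleftrightarrow> p = 0"
  by (metis shift_0 shift_shift shift_zero add.left_inverse)

definition skew_sum :: "int set \<Rightarrow> (int \<Rightarrow> 'r::comm_ring_1 poly) \<Rightarrow> 'r lin_op" where
  "skew_sum A a = (\<Sum>n\<in>A. mult_op (a n) * shift_op n)"

text \<open>
  The monomials \<open>h\<^sup>j\<close> are mapped to \<open>\<Sum>n. a n (h - n)\<^sup>j\<close>, so if the operator vanishes then
  \<open>\<Sum>n. a n Q(h - n) = 0\<close> for every polynomial \<open>Q\<close> with coefficients in the ring of
  polynomials in \<open>h\<close>.  Since the elements \<open>h - n\<close> are distinct, a polynomial \<open>Q\<close> vanishing at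
  all of them but one isolates a single coefficient.
\<close>

lemma skew_sum_eq_0D:
  fixes a :: "int \<Rightarrow> 'r::{idom, ring_char_0} poly"
  assumes "finite A" and 0: "skew_sum A a = 0" and m: "m \<in> A"
  shows "a m = 0"
proof -
  define x :: "int \<Rightarrow> 'r poly" where "x n = [:- of_int n, 1:]" for n
  have shift_power: "shift n ([:0, 1:] ^ j) = x n ^ j" for n j
    by (induction j) (simp_all add: shift_mult, simp add: x_def shift_def pcompose_pCons)
  have pow: "(\<Sum>n\<in>A. a n * x n ^ j) = 0" for j
    using arg_cong[OF 0, of "\<lambda>T. apply_op T ([:0, 1:] ^ j)"]
    by (simp add: skew_sum_def apply_op_sum apply_op_simps apply_mult_op apply_shift_op shift_power)
  have gen: "(\<Sum>n\<in>A. a n * poly Q (x n)) = 0" for Q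
  proof -
    have "(\<Sum>n\<in>A. a n * poly Q (x n)) = (\<Sum>n\<in>A. \<Sum>j\<le>degree Q. coeff Q j * (a n * x n ^ j))"
      by (simp add: poly_altdef sum_distrib_left mult_ac)
    also have "\<dots> = (\<Sum>j\<le>degree Q. coeff Q j * (\<Sum>n\<in>A. a n * x n ^ j))"
      by (subst sum.swap) (simp add: sum_distrib_left)
    finally show ?thesis by (simp add: pow)
  qed
  define Q where "Q = (\<Prod>k\<in>A - {m}. [:- x k, 1:])"
  have Q: "poly Q (x n) = (\<Prod>k\<in>A - {m}. x n - x k)" for n
    by (simp add: Q_def poly_prod)
  have van: "poly Q (x n) = 0" if "n \<in> A - {m}" for n
    unfolding Q using that assms(1) by (auto intro!: prod_zero)
  have "poly Q (x m) \<noteq> 0"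
    unfolding Q using assms(1) by (auto simp: x_def)
  moreover have "a m * poly Q (x m) = 0"
    using gen[of Q] sum.remove[OF assms(1) m, of "\<lambda>n. a n * poly Q (x n)"]
    by (simp add: van)
  ultimately show ?thesis by simp
qed

text \<open>
  The interval is half open so that \<open>T \<in> laurent_range s t\<close> is what remains below a leading term in
  degree \<open>t\<close>, and so that an empty interval is available at the end of an induction.
\<close>

definition laurent_range :: "int \<Rightarrow> int \<Rightarrow> 'r::comm_ring_1 lin_op set" where
  "laurent_range s t = range (skew_sum {s..<t})"

lemma skew_sum_add: "skew_sum A a + skew_sum A b = skew_sum A (\<lambda>n. a n + b n)"
  by (simp add: skew_sum_def mult_op_add sum.distrib algebra_simps)

lemma laurent_range_add:
  "T \<in> laurent_range s t \<Longrightarrow> U \<in> laurent_range s t \<Longrightarrow> T + U \<in> laurent_range s t"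
  by (auto simp: laurent_range_def skew_sum_add)

lemma laurent_range_0 [simp]: "0 \<in> laurent_range s t"
  unfolding laurent_range_def by (rule range_eqI[of _ _ "\<lambda>_. 0"]) (simp add: skew_sum_def)

lemma laurent_range_empty: "t \<le> s \<Longrightarrow> T \<in> laurent_range s t \<Longrightarrow> T = 0"
  by (auto simp: laurent_range_def skew_sum_def)

lemma laurent_range_sum:
  "(\<And>i. i \<in> I \<Longrightarrow> f i \<in> laurent_range s t) \<Longrightarrow> sum f I \<in> laurent_range s t"
  by (induction I rule: infinite_finite_induct) (simp_all add: laurent_range_add)

lemma laurent_range_monomial:
  assumes "s \<le> n" "n < t"
  shows "mult_op p * shift_op n \<in> laurent_range s t"
proof -
  have "skew_sum {s..<t} (\<lambda>k. if k = n then p else 0) =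
      (\<Sum>k\<in>{s..<t}. if k = n then mult_op p * shift_op k else 0)"
    unfolding skew_sum_def by (rule sum.cong) auto
  also have "\<dots> = mult_op p * shift_op n" using assms by simp
  finally show ?thesis unfolding laurent_range_def by (metis rangeI)
qed

lemma laurent_range_mono:
  assumes "T \<in> laurent_range s t" "s' \<le> s" "t \<le> t'"
  shows "T \<in> laurent_range s' t'"
proof -
  obtain a where T: "T = skew_sum {s..<t} a" using assms by (auto simp: laurent_range_def)
  show ?thesis unfolding T skew_sum_def
    by (rule laurent_range_sum, rule laurent_range_monomial) (use assms in auto)
qed

text \<open>
  Supports in the closed intervals \<open>{s..t}\<close> and \<open>{s'..t'}\<close> multiply into \<open>{s + s'..t + t'}\<close>; the
  half-open notation accounts for the three occurrences of \<open>+ 1\<close>.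
\<close>

lemma laurent_range_mult:
  assumes "T \<in> laurent_range s (t + 1)" "U \<in> laurent_range s' (t' + 1)"
  shows "T * U \<in> laurent_range (s + s') (t + t' + 1)"
proof -
  obtain a where T: "T = skew_sum {s..<t + 1} a" using assms by (auto simp: laurent_range_def)
  obtain b where U: "U = skew_sum {s'..<t' + 1} b" using assms by (auto simp: laurent_range_def)
  show ?thesis unfolding T U skew_sum_def sum_product monomial_mult
    by (intro laurent_range_sum laurent_range_monomial) auto
qed

lemma laurent_range_uminus:
  assumes "T \<in> laurent_range s t" shows "- T \<in> laurent_range s t"
proof -
  obtain a where T: "T = skew_sum {s..<t} a" using assms by (auto simp: laurent_range_def)
  have "- T = skew_sum {s..<t} (\<lambda>n. - a n)"
    by (simp add: T skew_sum_def mult_op_uminus sum_negf)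
  then show ?thesis unfolding laurent_range_def by simp
qed

lemma laurent_range_diff:
  "T \<in> laurent_range s t \<Longrightarrow> U \<in> laurent_range s t \<Longrightarrow> T - U \<in> laurent_range s t"
  using laurent_range_add[of T s t "- U"] laurent_range_uminus by fastforce

lemma laurent_range_split:
  assumes "T \<in> laurent_range s (t + 1)" "s \<le> t"
  obtains p T' where "T = mult_op p * shift_op t + T'" "T' \<in> laurent_range s t"
proof -
  obtain a where T: "T = skew_sum {s..<t + 1} a" using assms by (auto simp: laurent_range_def)
  have "{s..<t + 1} = insert t {s..<t}" using assms(2) by auto
  then have "T = mult_op (a t) * shift_op t + skew_sum {s..<t} a"
    unfolding T skew_sum_def by simp
  then show ?thesis using that by (auto simp: laurent_range_def)
qed

lemma laurent_range_leading_nonzero: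
  fixes p :: "'r::{idom, ring_char_0} poly"
  assumes "p \<noteq> 0" "T \<in> laurent_range s t"
  shows "mult_op p * shift_op t + T \<noteq> 0"
proof
  assume 0: "mult_op p * shift_op t + T = 0"
  obtain a where T: "T = skew_sum {s..<t} a" using assms by (auto simp: laurent_range_def)
  have "skew_sum (insert t {s..<t}) (a(t := p)) = mult_op p * shift_op t + T"
    unfolding T skew_sum_def by simp
  with 0 have "skew_sum (insert t {s..<t}) (a(t := p)) = 0" by simp
  from skew_sum_eq_0D[OF _ this, of t] assms(1) show False by simp
qed

definition laurent :: "'r::comm_ring_1 lin_op set" where
  "laurent = (\<Union>s t. laurent_range s t)"

lemma laurentE:
  assumes "T \<in> laurent"
  obtains N where "0 \<le> N" "T \<in> laurent_range (- N) (N + 1)"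
proof -
  obtain s t where "T \<in> laurent_range s t" using assms by (auto simp: laurent_def)
  then have "T \<in> laurent_range (- (\<bar>s\<bar> + \<bar>t\<bar>)) (\<bar>s\<bar> + \<bar>t\<bar> + 1)"
    by (rule laurent_range_mono) auto
  then show ?thesis using that[of "\<bar>s\<bar> + \<bar>t\<bar>"] by simp
qed

lemma laurent_rangeD: "T \<in> laurent_range s t \<Longrightarrow> T \<in> laurent"
  by (auto simp: laurent_def)

lemma laurent_monomial: "mult_op p * shift_op n \<in> laurent"
  by (rule laurent_rangeD[of _ n "n + 1"]) (simp add: laurent_range_monomial)

lemma laurent_mult_op [simp]: "mult_op p \<in> laurent"
  using laurent_monomial[of p 0] by simp

lemma laurent_shift_op [simp]: "shift_op n \<in> laurent"
  using laurent_monomial[of 1 n] by simp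

lemma laurent_0 [simp]: "0 \<in> laurent" and laurent_1 [simp]: "1 \<in> laurent"
  using laurent_mult_op[of 0] laurent_mult_op[of 1] by simp_all

lemma laurent_add [simp]:
  assumes "T \<in> laurent" "U \<in> laurent" shows "T + U \<in> laurent"
proof -
  obtain N M where "T \<in> laurent_range (- N) (N + 1)" "U \<in> laurent_range (- M) (M + 1)"
    using assms by (meson laurentE)
  then have "T \<in> laurent_range (- max N M) (max N M + 1)"
      "U \<in> laurent_range (- max N M) (max N M + 1)"
    by (auto elim!: laurent_range_mono)
  then show ?thesis by (blast intro: laurent_range_add laurent_rangeD)
qed

lemma laurent_uminus [simp]: "T \<in> laurent \<Longrightarrow> - T \<in> laurent"
  unfolding laurent_def using laurent_range_uminus by blast

lemma laurent_mult [simp]: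
  assumes "T \<in> laurent" "U \<in> laurent" shows "T * U \<in> laurent"
proof -
  obtain N M where "T \<in> laurent_range (- N) (N + 1)" "U \<in> laurent_range (- M) (M + 1)"
    using assms by (meson laurentE)
  from laurent_range_mult[OF this] show ?thesis by (rule laurent_rangeD)
qed

lemma laurent_range_leading:
  assumes "T \<in> laurent_range s t" "T \<noteq> 0"
  obtains n p T' where "T = mult_op p * shift_op n + T'" "T' \<in> laurent_range s n" "p \<noteq> 0"
    "s \<le> n" "n < t"
proof -
  have "\<exists>n p T'. T = mult_op p * shift_op n + T' \<and> T' \<in> laurent_range s n \<and> p \<noteq> 0 \<and>
      s \<le> n \<and> n < t"
    if "T \<in> laurent_range s t" "nat (t - s) = d" for t d
    using that
  proof (induction d arbitrary: t)
    case 0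
    then show ?case using assms(2) laurent_range_empty[of t s T] by simp
  next
    case (Suc d)
    then have st: "s \<le> t - 1" by simp
    have "T \<in> laurent_range s ((t - 1) + 1)" using Suc.prems by simp
    then obtain p T' where T: "T = mult_op p * shift_op (t - 1) + T'" "T' \<in> laurent_range s (t - 1)"
      using laurent_range_split[OF _ st] by blast
    show ?case
    proof (cases "p = 0")
      case True
      then have "T \<in> laurent_range s (t - 1)" using T by simp
      moreover have "nat (t - 1 - s) = d" using Suc.prems st by simp
      ultimately obtain n p T' where "T = mult_op p * shift_op n + T'" "T' \<in> laurent_range s n"
          "p \<noteq> 0" "s \<le> n" "n < t - 1"
        using Suc.IH by blast
      then show ?thesis by (intro exI[of _ n] exI[of _ p] exI[of _ T']) simp
    next
      case False
      then show ?thesis using T st by (intro exI[of _ "t - 1"] exI[of _ p] exI[of _ T']) simp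
    qed
  qed
  then show ?thesis using assms(1) that by blast
qed

text \<open>
  The leading coefficient of a product is \<open>p * shift n q\<close>, and a shift of a nonzero polynomial is
  nonzero.
\<close>

lemma laurent_no_zero_divisors:
  fixes T U :: "'r::{idom, ring_char_0} lin_op"
  assumes "T \<in> laurent" "U \<in> laurent" "T \<noteq> 0" "U \<noteq> 0"
  shows "T * U \<noteq> 0"
proof -
  obtain s t s' t' where r: "T \<in> laurent_range s t" "U \<in> laurent_range s' t'"
    using assms by (auto simp: laurent_def)
  obtain n p T' where T: "T = mult_op p * shift_op n + T'" "T' \<in> laurent_range s n" "p \<noteq> 0"
      "s \<le> n"
    using laurent_range_leading[OF r(1) assms(3)] by metis
  obtain k q U' where U: "U = mult_op q * shift_op k + U'" "U' \<in> laurent_range s' k" "q \<noteq> 0"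
      "s' \<le> k"
    using laurent_range_leading[OF r(2) assms(4)] by metis
  have "T' * U \<in> laurent_range (s + s') (n + k)"
    using laurent_range_mult[of T' s "n - 1" U s' k] T U
      laurent_range_add[OF laurent_range_monomial[of s' k "k + 1" q]
        laurent_range_mono[OF U(2), of s' "k + 1"]]
    by simp
  moreover have "mult_op p * shift_op n * U' \<in> laurent_range (s + s') (n + k)"
    using laurent_range_mult[OF laurent_range_monomial[of s n "n + 1" p], of U' s' "k - 1"] T U
    by simp
  ultimately have "mult_op p * shift_op n * U' + T' * U \<in> laurent_range (s + s') (n + k)"
    by (rule laurent_range_add[rotated])
  from laurent_range_leading_nonzero[OF _ this, of "p * shift n q"] T(3) U(3)
  have "mult_op (p * shift n q) * shift_op (n + k) + (mult_op p * shift_op n * U' + T' * U) \<noteq> 0"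
    by simp
  also have "mult_op (p * shift n q) * shift_op (n + k) + (mult_op p * shift_op n * U' + T' * U) =
      T * U"
    by (simp add: T(1) U(1) distrib_left distrib_right monomial_mult)
  finally show ?thesis .
qed

text \<open>
  Common multiples are found by the Euclidean algorithm on the widths of the supports: multiplying
  the wider of two elements on the right by a coefficient makes its leading term cancel against
  that of a right multiple of the other one.
\<close>

lemma laurent_ore:
  fixes T U :: "'r::{idom, ring_char_0} lin_op"
  assumes "T \<in> laurent" "U \<in> laurent" "T \<noteq> 0" "U \<noteq> 0"
  shows "\<exists>V\<in>laurent. \<exists>W\<in>laurent. T * V = U * W \<and> T * V \<noteq> 0"
proof -
  have *: "\<exists>V\<in>laurent. \<exists>W\<in>laurent. T * V = U * W \<and> T * V \<noteq> 0"
    if "T \<in> laurent_range s t" "U \<in> laurent_range s' t'" "T \<noteq> 0" "U \<noteq> 0"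
      "nat (t - s) + nat (t' - s') = d" for T U :: "'r lin_op" and s t s' t' d
    using that
  proof (induction d arbitrary: T U s t s' t' rule: less_induct)
    case (less d)
    obtain n p T' where T: "T = mult_op p * shift_op n + T'" "T' \<in> laurent_range s n" "p \<noteq> 0"
        "s \<le> n" "n < t"
      using laurent_range_leading[OF less.prems(1,3)] by metis
    obtain k q U' where U: "U = mult_op q * shift_op k + U'" "U' \<in> laurent_range s' k" "q \<noteq> 0"
        "s' \<le> k" "k < t'"
      using laurent_range_leading[OF less.prems(2,4)] by metis
    have step: "\<exists>V\<in>laurent. \<exists>W\<in>laurent. X * V = Y * W \<and> X * V \<noteq> 0"
      if X: "X = mult_op a * shift_op i + X'" "X' \<in> laurent_range u i" "a \<noteq> 0" "u \<le> i"
        and Y: "Y = mult_op b * shift_op j + Y'" "Y' \<in> laurent_range w j" "b \<noteq> 0" "w \<le> j"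
        and width: "j - w \<le> i - u" and measure: "nat (i - u) + nat (j + 1 - w) < d"
      for X Y X' Y' :: "'r lin_op" and a b i j u w
    proof -
      (* Moving c past the i-th and e past the j-th power of the shift yields b and a, so both
         leading coefficients become a * b. *)
      define c where "c = mult_op (shift (- i) b)"
      define e where "e = mult_op (shift (- j) a) * shift_op (i - j)"
      define Z where "Z = X * c - Y * e"
      have ce: "c \<in> laurent" "e \<in> laurent" by (simp_all add: c_def e_def laurent_monomial)
      have XY: "X \<noteq> 0" "Y \<noteq> 0" "X \<in> laurent" "Y \<in> laurent"
        using X Y laurent_range_leading_nonzero laurent_monomial laurent_rangeD laurent_add by metis+
      have c0: "c \<noteq> 0"
        using laurent_range_leading_nonzero[of "shift (- i) b" 0 0 0] Y(3) by (simp add: c_def)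
      have lead: "mult_op a * shift_op i * c = mult_op b * shift_op j * e"
        using monomial_mult[of a i "shift (- i) b" 0]
        by (simp add: c_def e_def monomial_mult shift_shift mult.commute)
      have Z: "Z = X' * c - Y' * e"
        using lead by (simp add: Z_def X(1) Y(1) distrib_right)
      have "X' * c \<in> laurent_range u i"
        using laurent_range_mult[of X' u "i - 1" c 0 0] X(2)
          laurent_range_monomial[of 0 0 1 "shift (- i) b"]
        by (simp add: c_def)
      moreover have "Y' * e \<in> laurent_range (w + (i - j)) i"
        using laurent_range_mult[of Y' w "j - 1" e "i - j" "i - j"] Y(2)
          laurent_range_monomial[of "i - j" "i - j" "i - j + 1" "shift (- j) a"]
        by (simp add: e_def)
      then have "Y' * e \<in> laurent_range u i"
        by (rule laurent_range_mono) (use width in auto)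
      ultimately have Zr: "Z \<in> laurent_range u i"
        unfolding Z by (rule laurent_range_diff)
      show ?thesis
      proof (cases "Z = 0")
        case True
        then have "X * c = Y * e" by (simp add: Z_def)
        then show ?thesis using ce laurent_no_zero_divisors[OF XY(3) ce(1) XY(1) c0] by blast
      next
        case False
        have Yr: "Y \<in> laurent_range w (j + 1)"
          unfolding Y(1)
          by (intro laurent_range_add laurent_range_monomial laurent_range_mono[OF Y(2)])
            (use Y(4) in auto)
        obtain V W where VW: "V \<in> laurent" "W \<in> laurent" "Z * V = Y * W" "Z * V \<noteq> 0"
          using less.IH[OF measure Zr Yr False XY(2) refl] by blast
        have "X * (c * V) = Y * (W + e * V)"
          using VW(3) by (simp add: Z_def algebra_simps)
        moreover have "V \<noteq> 0" using VW(4) by auto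
        then have "c * V \<noteq> 0" by (rule laurent_no_zero_divisors[OF ce(1) VW(1) c0])
        then have "X * (c * V) \<noteq> 0"
          using laurent_no_zero_divisors[OF XY(3) _ XY(1), of "c * V"] ce VW by simp
        ultimately show ?thesis using ce VW
          by (intro bexI[of _ "c * V"] bexI[of _ "W + e * V"]) simp_all
      qed
    qed
    show ?case
    proof (cases "k - s' \<le> n - s")
      case True
      show ?thesis
        by (rule step[OF T(1-4) U(1-4) True]) (use T U less.prems(5) in linarith)
    next
      case False
      have "\<exists>V\<in>laurent. \<exists>W\<in>laurent. U * V = T * W \<and> U * V \<noteq> 0"
        by (rule step[OF U(1-4) T(1-4)]) (use T U less.prems(5) False in linarith)+
      then show ?thesis by metis
    qed
  qed
  obtain s t s' t' where "T \<in> laurent_range s t" "U \<in> laurent_range s' t'"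
    using assms by (auto simp: laurent_def)
  from *[OF this assms(3,4) refl] show ?thesis .
qed

definition scalar_op :: "'k::field \<Rightarrow> 'k poly lin_op" where
  "scalar_op c = mult_op [:[:c:]:]"

lemma scalar_op_add: "scalar_op (c + d) = scalar_op c + scalar_op d"
  and scalar_op_mult: "scalar_op (c * d) = scalar_op c * scalar_op d"
  and scalar_op_1 [simp]: "scalar_op 1 = 1"
  and scalar_op_0 [simp]: "scalar_op 0 = 0"
  by (simp_all add: scalar_op_def flip: mult_op_add mult_op_mult one_pCons)

lemma scalar_op_commute: "T * scalar_op c = scalar_op c * T"
  unfolding scalar_op_def by (rule const_op_commute)

lemma scalar_op_left_commute: "T * (scalar_op c * U) = scalar_op c * (T * U)"
  by (simp add: scalar_op_commute flip: mult.assoc)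

lemma laurent_scalar_op [simp]: "scalar_op c \<in> laurent"
  by (simp add: scalar_op_def)

definition skew_laurent_alg :: "('k::field, 'k poly lin_op) module" where
  "skew_laurent_alg =
     \<lparr>carrier = laurent, mult = (*), one = 1, zero = 0, add = (+),
      smult = (\<lambda>c T. scalar_op c * T)\<rparr>"

lemma skew_laurent_alg_simps [simp]:
  "carrier skew_laurent_alg = laurent" "mult skew_laurent_alg = (*)" "one skew_laurent_alg = 1"
  "zero skew_laurent_alg = 0" "add skew_laurent_alg = (+)"
  "c \<odot>\<^bsub>skew_laurent_alg\<^esub> T = scalar_op c * T"
  by (simp_all add: skew_laurent_alg_def)

lemma ring_of_class_subset:
  fixes R :: "('a::ring_1, 'm) ring_scheme"
  assumes "mult R = (*)" "one R = 1" "zero R = 0" "add R = (+)"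
    and "\<And>x y. x \<in> carrier R \<Longrightarrow> y \<in> carrier R \<Longrightarrow> x + y \<in> carrier R"
    and "\<And>x y. x \<in> carrier R \<Longrightarrow> y \<in> carrier R \<Longrightarrow> x * y \<in> carrier R"
    and "0 \<in> carrier R" "1 \<in> carrier R" "\<And>x. x \<in> carrier R \<Longrightarrow> - x \<in> carrier R"
  shows "ring R"
proof (rule ringI)
  show "abelian_group R"
    by (rule abelian_groupI)
      (use assms in \<open>auto simp: add.assoc add.commute intro!: bexI[of _ "- _"]\<close>)
  show "Group.monoid R"
    by (rule monoidI) (use assms in \<open>auto simp: mult.assoc\<close>)
qed (use assms in \<open>simp_all add: algebra_simps\<close>)

interpretation skew_laurent: ore_domain "skew_laurent_alg :: ('k::field_char_0, 'k poly lin_op) module"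
proof (intro ore_domain.intro nc_algebra.intro)
  show "ring (skew_laurent_alg :: ('k, 'k poly lin_op) module)"
    by (rule ring_of_class_subset) simp_all
  show "nc_algebra_axioms (skew_laurent_alg :: ('k, 'k poly lin_op) module)"
  proof
    fix x y :: "'k poly lin_op" and c :: 'k
    show "x \<otimes>\<^bsub>skew_laurent_alg\<^esub> (c \<odot>\<^bsub>skew_laurent_alg\<^esub> y) =
        c \<odot>\<^bsub>skew_laurent_alg\<^esub> (x \<otimes>\<^bsub>skew_laurent_alg\<^esub> y)"
      by (simp add: scalar_op_commute flip: mult.assoc)
  qed (simp_all add: scalar_op_add scalar_op_mult distrib_left distrib_right mult.assoc)
  show "ore_domain_axioms (skew_laurent_alg :: ('k, 'k poly lin_op) module)"
  proof
    fix x y :: "'k poly lin_op"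
    assume "x \<in> carrier skew_laurent_alg" "y \<in> carrier skew_laurent_alg"
    then show "x \<otimes>\<^bsub>skew_laurent_alg\<^esub> y = \<zero>\<^bsub>skew_laurent_alg\<^esub> \<Longrightarrow>
        x = \<zero>\<^bsub>skew_laurent_alg\<^esub> \<or> y = \<zero>\<^bsub>skew_laurent_alg\<^esub>"
      and "x \<noteq> \<zero>\<^bsub>skew_laurent_alg\<^esub> \<Longrightarrow> y \<noteq> \<zero>\<^bsub>skew_laurent_alg\<^esub> \<Longrightarrow>
        \<exists>u\<in>carrier skew_laurent_alg. \<exists>v\<in>carrier skew_laurent_alg.
          x \<otimes>\<^bsub>skew_laurent_alg\<^esub> u = y \<otimes>\<^bsub>skew_laurent_alg\<^esub> v \<and>
          x \<otimes>\<^bsub>skew_laurent_alg\<^esub> u \<noteq> \<zero>\<^bsub>skew_laurent_alg\<^esub>"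
      using laurent_no_zero_divisors[of x y] laurent_ore[of x y] by auto
  qed simp
qed


section \<open>Presentations of algebras and their operator representations\<close>

text \<open>
  Homomorphisms out of an algebra given by generators and relations are only needed with values in
  operators.  These form a ring in the sense of type classes, which keeps the computations free of
  carrier conditions.
\<close>

locale operator_rep = nc_algebra R for R :: "('k::field, 'a) module" (structure) +
  fixes \<rho> :: "'a \<Rightarrow> 'k poly lin_op"
  assumes rep_add: "x \<in> carrier R \<Longrightarrow> y \<in> carrier R \<Longrightarrow> \<rho> (x \<oplus> y) = \<rho> x + \<rho> y"
    and rep_mult: "x \<in> carrier R \<Longrightarrow> y \<in> carrier R \<Longrightarrow> \<rho> (x \<otimes> y) = \<rho> x * \<rho> y"
    and rep_one [simp]: "\<rho> \<one> = 1"
    and rep_smult: "x \<in> carrier R \<Longrightarrow> \<rho> (c \<odot> x) = scalar_op c * \<rho> x"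
begin

lemma rep_zero [simp]: "\<rho> \<zero> = 0"
  using rep_add[of \<zero> \<zero>] by simp

lemma rep_minus: "x \<in> carrier R \<Longrightarrow> \<rho> (\<ominus> x) = - \<rho> x"
  using rep_add[of x "\<ominus> x"] by (simp add: r_neg eq_neg_iff_add_eq_0 add.commute[of "\<rho> x"])

lemma rep_diff: "x \<in> carrier R \<Longrightarrow> y \<in> carrier R \<Longrightarrow> \<rho> (x \<ominus> y) = \<rho> x - \<rho> y"
  by (simp add: minus_eq rep_add rep_minus)

lemma kernel_ideal: "ideal {x \<in> carrier R. \<rho> x = 0} R"
proof (rule idealI)
  show "subgroup {x \<in> carrier R. \<rho> x = 0} (add_monoid R)"
    by (rule subgroup.intro) (simp_all add: rep_add rep_minus subset_iff flip: a_inv_def)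
qed (auto simp: rep_mult ring_axioms)

end

text \<open>
  This says that \<open>X\<close> generates \<open>R\<close> as an algebra, in the form of an induction principle: it is enough
  to multiply by generators from the left, since words can be built up one letter at a time.
\<close>

definition generated_by :: "('k, 'a) module \<Rightarrow> 'a set \<Rightarrow> bool" where
  "generated_by R X \<longleftrightarrow> X \<subseteq> carrier R \<and>
     (\<forall>N. N \<subseteq> carrier R \<longrightarrow> \<one>\<^bsub>R\<^esub> \<in> N \<longrightarrow>
        (\<forall>x\<in>N. \<forall>y\<in>N. x \<oplus>\<^bsub>R\<^esub> y \<in> N) \<longrightarrow> (\<forall>c. \<forall>x\<in>N. c \<odot>\<^bsub>R\<^esub> x \<in> N) \<longrightarrow>
        (\<forall>g\<in>X. \<forall>x\<in>N. g \<otimes>\<^bsub>R\<^esub> x \<in> N) \<longrightarrow> carrier R \<subseteq> N)"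

lemma generated_byD: "generated_by R X \<Longrightarrow> g \<in> X \<Longrightarrow> g \<in> carrier R"
  by (auto simp: generated_by_def)

lemma generated_by_induct [consumes 2, case_names one add smult mult]:
  assumes "generated_by R X" "x \<in> carrier R"
    and "\<one>\<^bsub>R\<^esub> \<in> carrier R \<Longrightarrow> P \<one>\<^bsub>R\<^esub>"
    and "\<And>x y. x \<in> carrier R \<Longrightarrow> y \<in> carrier R \<Longrightarrow> P x \<Longrightarrow> P y \<Longrightarrow> P (x \<oplus>\<^bsub>R\<^esub> y)"
    and "\<And>c x. x \<in> carrier R \<Longrightarrow> P x \<Longrightarrow> P (c \<odot>\<^bsub>R\<^esub> x)"
    and "\<And>g x. g \<in> X \<Longrightarrow> x \<in> carrier R \<Longrightarrow> P x \<Longrightarrow> P (g \<otimes>\<^bsub>R\<^esub> x)"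
    and "nc_algebra R"
  shows "P x"
proof -
  interpret nc_algebra R by fact
  have X: "X \<subseteq> carrier R" using assms(1) by (simp add: generated_by_def)
  have "carrier R \<subseteq> {x \<in> carrier R. P x}"
    using assms(1)[unfolded generated_by_def] X assms(3-6)
    by (elim conjE allE[of _ "{x \<in> carrier R. P x}"]) (auto simp: subset_iff)
  then show ?thesis using assms(2) by blast
qed

lemma generated_by_mono:
  assumes gen: "generated_by R X" and "X \<subseteq> Y" and Y: "Y \<subseteq> carrier R"
  shows "generated_by R Y"
  unfolding generated_by_def
proof (intro conjI allI impI Y)
  fix N assume N: "N \<subseteq> carrier R" "\<one>\<^bsub>R\<^esub> \<in> N" "\<forall>x\<in>N. \<forall>y\<in>N. x \<oplus>\<^bsub>R\<^esub> y \<in> N"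
    "\<forall>c. \<forall>x\<in>N. c \<odot>\<^bsub>R\<^esub> x \<in> N" "\<forall>g\<in>Y. \<forall>x\<in>N. g \<otimes>\<^bsub>R\<^esub> x \<in> N"
  have "\<forall>g\<in>X. \<forall>x\<in>N. g \<otimes>\<^bsub>R\<^esub> x \<in> N" using N(5) assms(2) by blast
  with gen N(1-4) show "carrier R \<subseteq> N"
    unfolding generated_by_def by (elim conjE allE[of _ N]) simp
qed


subsection \<open>Quotients\<close>

lemma ring_cong:
  assumes "ring R" "carrier S = carrier R" "mult S = mult R" "one S = one R" "zero S = zero R"
    "add S = add R"
  shows "ring S"
proof -
  interpret R: ring R by fact
  show ?thesis
  proof (rule ringI)
    show "abelian_group S"
      by (rule abelian_groupI) (use assms R.a_assoc R.a_comm R.l_neg in auto)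
    show "Group.monoid S"
      by (rule monoidI) (use assms R.m_assoc in auto)
  qed (use assms R.l_distr R.r_distr in auto)
qed

lemma quot_alg_simps:
  "carrier (quot_alg R I) = carrier (R Quot I)" "mult (quot_alg R I) = mult (R Quot I)"
  "one (quot_alg R I) = one (R Quot I)" "zero (quot_alg R I) = zero (R Quot I)"
  "add (quot_alg R I) = add (R Quot I)"
  "c \<odot>\<^bsub>quot_alg R I\<^esub> S = (\<Union>x\<in>S. I +>\<^bsub>R\<^esub> (c \<odot>\<^bsub>R\<^esub> x))"
  by (simp_all add: quot_alg_def ring.defs module.defs)

locale quotient_algebra = nc_algebra R + ideal I R for R (structure) and I
begin

abbreviation (input) "Q \<equiv> quot_alg R I"

lemma proj_simps:
  "x \<in> carrier R \<Longrightarrow> I +> x \<in> carrier Q"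
  "x \<in> carrier R \<Longrightarrow> y \<in> carrier R \<Longrightarrow> (I +> x) \<otimes>\<^bsub>Q\<^esub> (I +> y) = I +> (x \<otimes> y)"
  "x \<in> carrier R \<Longrightarrow> y \<in> carrier R \<Longrightarrow> (I +> x) \<oplus>\<^bsub>Q\<^esub> (I +> y) = I +> (x \<oplus> y)"
  "\<one>\<^bsub>Q\<^esub> = I +> \<one>"
  by (simp_all add: quot_alg_simps FactRing_def rcoset_mult_add a_rcos_sum a_rcosetsI a_subset)

lemma proj_eq_iff:
  assumes "x \<in> carrier R" "y \<in> carrier R"
  shows "I +> x = I +> y \<longleftrightarrow> x \<ominus> y \<in> I"
  using quotient_eq_iff_same_a_r_cos[OF ideal_axioms assms] by simp

lemma proj_smult:
  assumes x: "x \<in> carrier R"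
  shows "c \<odot>\<^bsub>Q\<^esub> (I +> x) = I +> (c \<odot> x)"
proof -
  have "I +> (c \<odot> y) = I +> (c \<odot> x)" if y: "y \<in> I +> x" for y
  proof -
    obtain i where i: "i \<in> I" "y = i \<oplus> x"
      using y by (auto simp: a_r_coset_def r_coset_def)
    have iR: "i \<in> carrier R" using i by (simp add: a_Hcarr)
    (* An ideal is stable under scalars because they are multiples of the unit. *)
    have "c \<odot> i = (c \<odot> \<one>) \<otimes> i" using iR by (simp add: smult_mult_left)
    then have ci: "c \<odot> i \<in> I" using i by (simp add: I_l_closed)
    have "c \<odot> y \<ominus> c \<odot> x = c \<odot> i"
      using iR x i(2) by (simp add: smult_add_right minus_eq a_assoc r_neg)
    then show ?thesis
      using ci x iR i(2) by (simp add: proj_eq_iff)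
  qed
  moreover have "x \<in> I +> x" using x by (rule a_rcos_self)
  ultimately show ?thesis unfolding quot_alg_simps by fast
qed

lemma proj_surj:
  assumes "X \<in> carrier Q" obtains x where "x \<in> carrier R" "X = I +> x"
  using assms by (auto simp: quot_alg_simps FactRing_def A_RCOSETS_def')

sublocale Q: nc_algebra Q
proof (intro nc_algebra.intro)
  show "ring Q"
    by (rule ring_cong[OF quotient_is_ring]) (simp_all add: quot_alg_simps)
  show "nc_algebra_axioms Q"
  proof
    fix X Y c d assume "X \<in> carrier Q" "Y \<in> carrier Q"
    then obtain x y where "x \<in> carrier R" "X = I +> x" "y \<in> carrier R" "Y = I +> y"
      by (metis proj_surj)
    then show "c \<odot>\<^bsub>Q\<^esub> (X \<oplus>\<^bsub>Q\<^esub> Y) = c \<odot>\<^bsub>Q\<^esub> X \<oplus>\<^bsub>Q\<^esub> c \<odot>\<^bsub>Q\<^esub> Y"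
      and "(c \<odot>\<^bsub>Q\<^esub> X) \<otimes>\<^bsub>Q\<^esub> Y = c \<odot>\<^bsub>Q\<^esub> (X \<otimes>\<^bsub>Q\<^esub> Y)"
      and "X \<otimes>\<^bsub>Q\<^esub> (c \<odot>\<^bsub>Q\<^esub> Y) = c \<odot>\<^bsub>Q\<^esub> (X \<otimes>\<^bsub>Q\<^esub> Y)"
      by (simp_all add: proj_simps proj_smult smult_add_right smult_mult_left smult_mult_right)
  next
    fix X c d assume "X \<in> carrier Q"
    then obtain x where "x \<in> carrier R" "X = I +> x" by (metis proj_surj)
    then show "c \<odot>\<^bsub>Q\<^esub> X \<in> carrier Q"
      and "(c + d) \<odot>\<^bsub>Q\<^esub> X = c \<odot>\<^bsub>Q\<^esub> X \<oplus>\<^bsub>Q\<^esub> d \<odot>\<^bsub>Q\<^esub> X"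
      and "(c * d) \<odot>\<^bsub>Q\<^esub> X = c \<odot>\<^bsub>Q\<^esub> (d \<odot>\<^bsub>Q\<^esub> X)" and "1 \<odot>\<^bsub>Q\<^esub> X = X"
      by (simp_all add: proj_simps proj_smult smult_add_left smult_assoc)
  qed
qed

lemma nc_algebra_quotient: "nc_algebra Q"
  by (rule Q.nc_algebra_axioms)

lemma generated_by_quotient:
  assumes gen: "generated_by R X"
  shows "generated_by Q ((+>) I ` X)"
  unfolding generated_by_def
proof (intro conjI allI impI)
  show "(+>) I ` X \<subseteq> carrier Q" using generated_byD[OF gen] by (auto simp: proj_simps)
  fix N assume N: "N \<subseteq> carrier Q" "\<one>\<^bsub>Q\<^esub> \<in> N" "\<forall>x\<in>N. \<forall>y\<in>N. x \<oplus>\<^bsub>Q\<^esub> y \<in> N"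
    "\<forall>c. \<forall>x\<in>N. c \<odot>\<^bsub>Q\<^esub> x \<in> N" "\<forall>g\<in>(+>) I ` X. \<forall>x\<in>N. g \<otimes>\<^bsub>Q\<^esub> x \<in> N"
  have "I +> x \<in> N" if "x \<in> carrier R" for x
    using gen that
  proof (induction rule: generated_by_induct)
    case one then show ?case using N(2) by (simp add: proj_simps)
  next
    case (add x y) then show ?case using N(3) by (metis proj_simps(3))
  next
    case (smult c x) then show ?case using N(4) by (metis proj_smult)
  next
    case (mult g x)
    then have "(I +> g) \<otimes>\<^bsub>Q\<^esub> (I +> x) \<in> N" using N(5) by blast
    then show ?case using mult generated_byD[OF gen] by (simp add: proj_simps)
  qed (rule nc_algebra_axioms)
  then show "carrier Q \<subseteq> N" by (metis proj_surj subsetI)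
qed

end

lemma quotient_algebra_genideal:
  "nc_algebra R \<Longrightarrow> S \<subseteq> carrier R \<Longrightarrow> quotient_algebra R (Idl\<^bsub>R\<^esub> S)"
  by (intro quotient_algebra.intro ring.genideal_ideal) (simp_all add: nc_algebra_def)

text \<open>
  The coset representative picked here is arbitrary; the choice is immaterial on the quotient by
  an ideal on which \<open>\<rho>\<close> vanishes.
\<close>

definition quot_rep :: "('a \<Rightarrow> 'b) \<Rightarrow> 'a set \<Rightarrow> 'b" where
  "quot_rep \<rho> X = \<rho> (SOME x. x \<in> X)"

lemma (in operator_rep) quot_rep_coset:
  assumes "ideal I R" "\<And>i. i \<in> I \<Longrightarrow> \<rho> i = 0" "x \<in> carrier R"
  shows "quot_rep \<rho> (I +> x) = \<rho> x"
proof -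
  interpret ideal I R by fact
  have "(SOME y. y \<in> I +> x) \<in> I +> x"
    using a_rcos_self[OF assms(3)] by (rule someI)
  then obtain i where "i \<in> I" "(SOME y. y \<in> I +> x) = i \<oplus> x"
    by (auto simp: a_r_coset_def r_coset_def)
  then show ?thesis
    using assms by (simp add: quot_rep_def rep_add)
qed

lemma (in operator_rep) operator_rep_quotient:
  assumes "ideal I R" "\<And>i. i \<in> I \<Longrightarrow> \<rho> i = 0"
  shows "operator_rep (quot_alg R I) (quot_rep \<rho>)"
proof -
  interpret quotient_algebra R I
    by (intro quotient_algebra.intro assms(1) nc_algebra_axioms)
  note [simp] = quot_rep_coset[OF assms] proj_simps proj_smult
  show ?thesis
  proof
    fix X Y assume "X \<in> carrier Q" "Y \<in> carrier Q"
    then obtain x y where "x \<in> carrier R" "X = I +> x" "y \<in> carrier R" "Y = I +> y"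
      by (metis proj_surj)
    then show "quot_rep \<rho> (X \<oplus>\<^bsub>Q\<^esub> Y) = quot_rep \<rho> X + quot_rep \<rho> Y"
      and "quot_rep \<rho> (X \<otimes>\<^bsub>Q\<^esub> Y) = quot_rep \<rho> X * quot_rep \<rho> Y"
      by (simp_all add: rep_add rep_mult)
  next
    fix X c assume "X \<in> carrier Q"
    then obtain x where "x \<in> carrier R" "X = I +> x" by (metis proj_surj)
    then show "quot_rep \<rho> (c \<odot>\<^bsub>Q\<^esub> X) = scalar_op c * quot_rep \<rho> X"
      by (simp add: rep_smult)
  qed simp
qed

lemma (in operator_rep) rep_genideal:
  assumes "S \<subseteq> carrier R" "\<And>x. x \<in> S \<Longrightarrow> \<rho> x = 0" "i \<in> Idl S"
  shows "\<rho> i = 0"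
  using genideal_minimal[OF kernel_ideal, of S] assms by blast


subsection \<open>Linear extension\<close>

definition linear_ext :: "('b \<Rightarrow> 'k poly lin_op) \<Rightarrow> ('b \<Rightarrow>\<^sub>0 'k::field) \<Rightarrow> 'k poly lin_op" where
  "linear_ext v p = (\<Sum>b\<in>Poly_Mapping.keys p. scalar_op (Poly_Mapping.lookup p b) * v b)"

lemma linear_ext_add: "linear_ext v (p + q) = linear_ext v p + linear_ext v q"
  unfolding linear_ext_def
  by (rule setsum_keys_plus_distrib) (simp_all add: scalar_op_add distrib_right)

lemma linear_ext_0 [simp]: "linear_ext v 0 = 0"
  by (simp add: linear_ext_def)

lemma linear_ext_single [simp]: "linear_ext v (Poly_Mapping.single b c) = scalar_op c * v b"
  by (simp add: linear_ext_def)

lemma linear_ext_uminus: "linear_ext v (- p) = - linear_ext v p"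
  using linear_ext_add[of v p "- p"] by (simp add: eq_neg_iff_add_eq_0 add.commute)

lemma linear_ext_diff: "linear_ext v (p - q) = linear_ext v p - linear_ext v q"
  using linear_ext_add[of v p "- q"] by (simp add: linear_ext_uminus)

lemma poly_mapping_keys_induct [consumes 1, case_names zero single add]:
  fixes p :: "'b \<Rightarrow>\<^sub>0 'k::comm_monoid_add"
  assumes "Poly_Mapping.keys p \<subseteq> S"
    and "P 0"
    and "\<And>b c. b \<in> S \<Longrightarrow> P (Poly_Mapping.single b c)"
    and "\<And>p q. Poly_Mapping.keys p \<subseteq> S \<Longrightarrow> Poly_Mapping.keys q \<subseteq> S \<Longrightarrow>
      P p \<Longrightarrow> P q \<Longrightarrow> P (p + q)"
  shows "P p"
  using assms(1)
proof (induction p rule: update_induct)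
  case (update f a b)
  have eq: "Poly_Mapping.update a b f = Poly_Mapping.single a b + f"
    by (rule poly_mapping_eqI)
      (use update(1) in \<open>auto simp: lookup_update lookup_add lookup_single in_keys_iff when_def\<close>)
  have "Poly_Mapping.keys (Poly_Mapping.update a b f) = insert a (Poly_Mapping.keys f)"
    using update(2) by (auto simp: keys_update)
  then have "a \<in> S" and f: "Poly_Mapping.keys f \<subseteq> S" using update.prems by auto
  show ?case
    unfolding eq
    by (rule assms(4)) (use update.IH f \<open>a \<in> S\<close> assms(3) in auto)
qed (simp add: assms)

lemmas poly_mapping_induct' =
  poly_mapping_keys_induct[OF subset_UNIV, case_names zero single add]


subsection \<open>Free algebras\<close>

lemma free_alg_simps [simp]:
  "carrier free_alg = UNIV" "mult free_alg = (*)" "one free_alg = 1" "zero free_alg = 0"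
  "add free_alg = (+)" "c \<odot>\<^bsub>free_alg\<^esub> p = Poly_Mapping.single [] c * p"
  by (simp_all add: free_alg_def mult_map_scale_conv_mult flip: zero_list_def)

lemma single_Nil_commute:
  "p * Poly_Mapping.single [] c = Poly_Mapping.single [] c * (p :: 'x list \<Rightarrow>\<^sub>0 'k::field)"
  by (induction p rule: poly_mapping_induct')
    (simp_all add: mult_single plus_list_def mult.commute distrib_left distrib_right)

lemma one_free: "(1 :: 'x list \<Rightarrow>\<^sub>0 'k::field) = Poly_Mapping.single [] 1"
  by (metis single_one zero_list_def)

interpretation free: nc_algebra "free_alg :: ('k::field, 'x list \<Rightarrow>\<^sub>0 'k) module"
proof (intro nc_algebra.intro)
  show "ring (free_alg :: ('k::field, 'x list \<Rightarrow>\<^sub>0 'k) module)"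
    by (rule ring_of_class_subset) simp_all
  show "nc_algebra_axioms (free_alg :: ('k::field, 'x list \<Rightarrow>\<^sub>0 'k) module)"
  proof
    fix x y :: "'x list \<Rightarrow>\<^sub>0 'k" and c
    show "x \<otimes>\<^bsub>free_alg\<^esub> (c \<odot>\<^bsub>free_alg\<^esub> y) = c \<odot>\<^bsub>free_alg\<^esub> (x \<otimes>\<^bsub>free_alg\<^esub> y)"
      by (simp add: single_Nil_commute flip: mult.assoc)
  qed (simp_all add: single_add distrib_left distrib_right mult.assoc mult_single plus_list_def
      flip: one_free mult.assoc)
qed

lemma free_a_minus: "x \<ominus>\<^bsub>free_alg\<^esub> y = x - (y :: 'x list \<Rightarrow>\<^sub>0 'k::field)"
proof -
  have "\<ominus>\<^bsub>free_alg\<^esub> y = - y"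
    by (rule free.add.inv_equality) simp_all
  then show ?thesis by (simp add: a_minus_def)
qed

definition free_eval :: "('x \<Rightarrow> 'k poly lin_op) \<Rightarrow> ('x list \<Rightarrow>\<^sub>0 'k::field) \<Rightarrow> 'k poly lin_op" where
  "free_eval u = linear_ext (\<lambda>l. prod_list (map u l))"

lemma free_eval_mult: "free_eval u (p * q) = free_eval u p * free_eval u q"
proof (induction p rule: poly_mapping_induct')
  case (single l c)
  show ?case
  proof (induction q rule: poly_mapping_induct')
    case (single l' c')
    have "prod_list (map u l) * (scalar_op c' * prod_list (map u l')) =
        scalar_op c' * (prod_list (map u l) * prod_list (map u l'))"
      by (simp add: scalar_op_commute flip: mult.assoc)
    then show ?case
      by (simp add: free_eval_def mult_single plus_list_def scalar_op_mult mult.assoc)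
  qed (simp_all add: free_eval_def distrib_left linear_ext_add)
qed (simp_all add: free_eval_def distrib_right linear_ext_add)

lemma free_eval_gen [simp]: "free_eval u (Poly_Mapping.single [b] c) = scalar_op c * u b"
  by (simp add: free_eval_def)

lemma free_eval_Nil [simp]: "free_eval u (Poly_Mapping.single [] c) = scalar_op c"
  by (simp add: free_eval_def)

lemma free_eval_add: "free_eval u (p + q) = free_eval u p + free_eval u q"
  and free_eval_diff: "free_eval u (p - q) = free_eval u p - free_eval u q"
  and free_eval_0 [simp]: "free_eval u 0 = 0"
  and free_eval_1 [simp]: "free_eval u 1 = 1"
  by (simp_all add: free_eval_def linear_ext_add linear_ext_diff one_free)

lemma operator_rep_free_eval:
  fixes u :: "'x \<Rightarrow> 'k::field poly lin_op"
  shows "operator_rep free_alg (free_eval u)"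
  by unfold_locales (simp_all add: free_eval_add free_eval_mult)

lemma generated_by_free_alg:
  "generated_by (free_alg :: ('k::field, 'x list \<Rightarrow>\<^sub>0 'k) module) (range free_gen)"
  unfolding generated_by_def
proof (intro conjI allI impI)
  fix N :: "('x list \<Rightarrow>\<^sub>0 'k) set"
  assume N: "\<one>\<^bsub>free_alg\<^esub> \<in> N" "\<forall>x\<in>N. \<forall>y\<in>N. x \<oplus>\<^bsub>free_alg\<^esub> y \<in> N"
    "\<forall>c. \<forall>x\<in>N. c \<odot>\<^bsub>free_alg\<^esub> x \<in> N" "\<forall>g\<in>range free_gen. \<forall>x\<in>N. g \<otimes>\<^bsub>free_alg\<^esub> x \<in> N"
  have word: "Poly_Mapping.single l 1 \<in> N" for l
  proof (induction l)
    case Nil then show ?case using N(1) by (simp add: one_free)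
  next
    case (Cons b l)
    then have "free_gen b * Poly_Mapping.single l 1 \<in> N" using N(4) by simp
    then show ?case by (simp add: mult_single plus_list_def)
  qed
  have single: "Poly_Mapping.single l c \<in> N" for l c
    using N(3)[rule_format, OF word, of c l] by (simp add: mult_single plus_list_def)
  have "p \<in> N" for p
  proof (induction p rule: poly_mapping_induct')
    case zero then show ?case using single[of _ 0] by simp
  qed (use single N(2) in auto)
  then show "carrier free_alg \<subseteq> N" by blast
qed simp


subsection \<open>Tensor products\<close>

lemma tensor_free_simps [simp]:
  "carrier (tensor_free A B) = {p. Poly_Mapping.keys p \<subseteq> carrier A \<times> carrier B}"
  "one (tensor_free A B) = Poly_Mapping.single (\<one>\<^bsub>A\<^esub>, \<one>\<^bsub>B\<^esub>) 1" "zero (tensor_free A B) = 0"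
  "add (tensor_free A B) = (+)"
  by (simp_all add: tensor_free_def)

lemma tensor_free_smult [simp]:
  "Poly_Mapping.lookup (c \<odot>\<^bsub>tensor_free A B\<^esub> p) x = c * Poly_Mapping.lookup p x"
  by (simp add: tensor_free_def Poly_Mapping.map.rep_eq when_def)

lemma tensor_free_mult:
  "p \<otimes>\<^bsub>tensor_free A B\<^esub> q =
    (\<Sum>x\<in>Poly_Mapping.keys p. \<Sum>y\<in>Poly_Mapping.keys q.
      Poly_Mapping.single (fst x \<otimes>\<^bsub>A\<^esub> fst y, snd x \<otimes>\<^bsub>B\<^esub> snd y)
        (Poly_Mapping.lookup p x * Poly_Mapping.lookup q y))"
  by (simp add: tensor_free_def case_prod_beta)

lemma tensor_free_mult_single [simp]:
  "Poly_Mapping.single (a, b) c \<otimes>\<^bsub>tensor_free A B\<^esub> Poly_Mapping.single (a', b') c' =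
    Poly_Mapping.single (a \<otimes>\<^bsub>A\<^esub> a', b \<otimes>\<^bsub>B\<^esub> b') (c * c')"
  by (simp add: tensor_free_mult)

lemma tensor_free_mult_add_left:
  "(p + p') \<otimes>\<^bsub>tensor_free A B\<^esub> q = p \<otimes>\<^bsub>tensor_free A B\<^esub> q + p' \<otimes>\<^bsub>tensor_free A B\<^esub> q"
  unfolding tensor_free_mult
  by (rule setsum_keys_plus_distrib[where f = "\<lambda>x c. \<Sum>y\<in>Poly_Mapping.keys q.
        Poly_Mapping.single (fst x \<otimes>\<^bsub>A\<^esub> fst y, snd x \<otimes>\<^bsub>B\<^esub> snd y) (c * Poly_Mapping.lookup q y)"])
    (simp_all add: distrib_right single_add sum.distrib)

lemma tensor_free_mult_add_right:
  "p \<otimes>\<^bsub>tensor_free A B\<^esub> (q + q') = p \<otimes>\<^bsub>tensor_free A B\<^esub> q + p \<otimes>\<^bsub>tensor_free A B\<^esub> q'"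
  unfolding tensor_free_mult sum.swap[of _ _ "Poly_Mapping.keys p"]
  by (rule setsum_keys_plus_distrib[where f = "\<lambda>y c. \<Sum>x\<in>Poly_Mapping.keys p.
        Poly_Mapping.single (fst x \<otimes>\<^bsub>A\<^esub> fst y, snd x \<otimes>\<^bsub>B\<^esub> snd y) (Poly_Mapping.lookup p x * c)"])
    (simp_all add: distrib_left single_add sum.distrib)

lemma tensor_free_mult_0 [simp]:
  "0 \<otimes>\<^bsub>tensor_free A B\<^esub> q = 0" "p \<otimes>\<^bsub>tensor_free A B\<^esub> 0 = 0"
  by (simp_all add: tensor_free_mult)

lemma tensor_free_smult_single [simp]:
  "c \<odot>\<^bsub>tensor_free A B\<^esub> Poly_Mapping.single x d = Poly_Mapping.single x (c * d)"
  by (rule poly_mapping_eqI) (simp add: lookup_single when_def)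

lemma tensor_free_smult_add:
  "c \<odot>\<^bsub>tensor_free A B\<^esub> (p + q) = c \<odot>\<^bsub>tensor_free A B\<^esub> p + c \<odot>\<^bsub>tensor_free A B\<^esub> q"
  by (rule poly_mapping_eqI) (simp add: lookup_add distrib_left)

lemma tensor_free_smult_0 [simp]: "c \<odot>\<^bsub>tensor_free A B\<^esub> 0 = 0"
  by (rule poly_mapping_eqI) simp

lemma keys_add_subset:
  "Poly_Mapping.keys p \<subseteq> S \<Longrightarrow> Poly_Mapping.keys q \<subseteq> S \<Longrightarrow> Poly_Mapping.keys (p + q) \<subseteq> S"
  using keys_add[of p q] by blast

locale algebra_pair = A: nc_algebra A + B: nc_algebra B
  for A :: "('k::field, 'a) module" and B :: "('k, 'b) module"
begin

abbreviation (input) "T \<equiv> tensor_free A B"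

lemma T_closed:
  assumes "p \<in> carrier T" "q \<in> carrier T"
  shows "p \<otimes>\<^bsub>T\<^esub> q \<in> carrier T"
proof -
  from assms(1) have "Poly_Mapping.keys p \<subseteq> carrier A \<times> carrier B" by simp
  then show ?thesis
  proof (induction p rule: poly_mapping_keys_induct)
    case (single x c)
    from assms(2) have "Poly_Mapping.keys q \<subseteq> carrier A \<times> carrier B" by simp
    then show ?case
    proof (induction q rule: poly_mapping_keys_induct)
      case (single y d)
      with \<open>x \<in> carrier A \<times> carrier B\<close> show ?case by (cases x, cases y) simp
    qed (simp_all add: tensor_free_mult_add_right keys_add_subset)
  next
    case (add p q)
    then show ?case by (simp add: tensor_free_mult_add_left keys_add_subset)
  qed simp
qed

lemma T_assoc:
  assumes "p \<in> carrier T" "q \<in> carrier T" "r \<in> carrier T"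
  shows "(p \<otimes>\<^bsub>T\<^esub> q) \<otimes>\<^bsub>T\<^esub> r = p \<otimes>\<^bsub>T\<^esub> (q \<otimes>\<^bsub>T\<^esub> r)"
proof -
  from assms(1) have "Poly_Mapping.keys p \<subseteq> carrier A \<times> carrier B" by simp
  then show ?thesis
  proof (induction p rule: poly_mapping_keys_induct)
    case p: (single x c)
    from assms(2) have "Poly_Mapping.keys q \<subseteq> carrier A \<times> carrier B" by simp
    then show ?case
    proof (induction q rule: poly_mapping_keys_induct)
      case q: (single y d)
      from assms(3) have "Poly_Mapping.keys r \<subseteq> carrier A \<times> carrier B" by simp
      then show ?case
        by (induction r rule: poly_mapping_keys_induct)
          (use p q in \<open>auto simp: tensor_free_mult_add_right A.m_assoc B.m_assoc mult.assoc\<close>)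
    qed (simp_all add: tensor_free_mult_add_right tensor_free_mult_add_left)
  qed (simp_all add: tensor_free_mult_add_left)
qed

lemma T_one:
  assumes "p \<in> carrier T"
  shows "\<one>\<^bsub>T\<^esub> \<otimes>\<^bsub>T\<^esub> p = p" "p \<otimes>\<^bsub>T\<^esub> \<one>\<^bsub>T\<^esub> = p"
proof -
  from assms have "Poly_Mapping.keys p \<subseteq> carrier A \<times> carrier B" by simp
  then show "\<one>\<^bsub>T\<^esub> \<otimes>\<^bsub>T\<^esub> p = p" "p \<otimes>\<^bsub>T\<^esub> \<one>\<^bsub>T\<^esub> = p"
    by (induction p rule: poly_mapping_keys_induct)
      (auto simp: tensor_free_mult_add_right tensor_free_mult_add_left)
qed

lemma T_smult_mult:
  "(c \<odot>\<^bsub>T\<^esub> p) \<otimes>\<^bsub>T\<^esub> q = c \<odot>\<^bsub>T\<^esub> (p \<otimes>\<^bsub>T\<^esub> q)" "p \<otimes>\<^bsub>T\<^esub> (c \<odot>\<^bsub>T\<^esub> q) = c \<odot>\<^bsub>T\<^esub> (p \<otimes>\<^bsub>T\<^esub> q)"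
proof -
  have "(c \<odot>\<^bsub>T\<^esub> p) \<otimes>\<^bsub>T\<^esub> q = c \<odot>\<^bsub>T\<^esub> (p \<otimes>\<^bsub>T\<^esub> q) \<and> p \<otimes>\<^bsub>T\<^esub> (c \<odot>\<^bsub>T\<^esub> q) = c \<odot>\<^bsub>T\<^esub> (p \<otimes>\<^bsub>T\<^esub> q)"
  proof (induction p rule: poly_mapping_induct')
    case p: (single x d)
    obtain a b where x: "x = (a, b)" by fastforce
    show ?case
      by (induction q rule: poly_mapping_induct')
        (auto simp: x tensor_free_mult_add_right tensor_free_smult_add mult_ac)
  qed (simp_all add: tensor_free_mult_add_left tensor_free_smult_add)
  then show "(c \<odot>\<^bsub>T\<^esub> p) \<otimes>\<^bsub>T\<^esub> q = c \<odot>\<^bsub>T\<^esub> (p \<otimes>\<^bsub>T\<^esub> q)" "p \<otimes>\<^bsub>T\<^esub> (c \<odot>\<^bsub>T\<^esub> q) = c \<odot>\<^bsub>T\<^esub> (p \<otimes>\<^bsub>T\<^esub> q)"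
    by blast+
qed

sublocale T: nc_algebra T
proof (intro nc_algebra.intro)
  show "ring T"
  proof (rule ringI)
    show "abelian_group T"
    proof (rule abelian_groupI)
      show "\<exists>y\<in>carrier T. y \<oplus>\<^bsub>T\<^esub> x = \<zero>\<^bsub>T\<^esub>" if "x \<in> carrier T" for x
        using that by (intro bexI[of _ "- x"]) simp_all
    qed (simp_all add: add_ac keys_add_subset)
    show "Group.monoid T"
      by (rule monoidI)
        (use T_closed T_assoc T_one A.one_closed B.one_closed in \<open>simp_all\<close>)
  qed (simp_all add: tensor_free_mult_add_left tensor_free_mult_add_right)
  show "nc_algebra_axioms T"
  proof
    show "c \<odot>\<^bsub>T\<^esub> p \<in> carrier T" if "p \<in> carrier T" for c p
      using that by (auto simp: in_keys_iff)
  qed (auto simp: T_smult_mult tensor_free_smult_add intro!: poly_mapping_eqI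
      simp: lookup_add algebra_simps)
qed

lemma T_genideal: "ideal (Idl\<^bsub>T\<^esub> (tensor_rels A B)) T"
  and tensor_rels_carrier: "tensor_rels A B \<subseteq> carrier T"
proof -
  have diff: "Poly_Mapping.keys (p - q) \<subseteq> S"
    if "Poly_Mapping.keys p \<subseteq> S" "Poly_Mapping.keys q \<subseteq> S"
    for p q :: "'a \<times> 'b \<Rightarrow>\<^sub>0 'k" and S
    using that keys_diff[of p q] by blast
  show "tensor_rels A B \<subseteq> carrier T"
  proof
    fix r assume "r \<in> tensor_rels A B"
    then show "r \<in> carrier T"
      unfolding tensor_rels_def by (elim UnE CollectE exE conjE) (simp_all add: diff)
  qed
  then show "ideal (Idl\<^bsub>T\<^esub> (tensor_rels A B)) T" by (rule T.genideal_ideal)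
qed

sublocale TA: quotient_algebra T "Idl\<^bsub>T\<^esub> (tensor_rels A B)"
  rewrites "quot_alg T (Idl\<^bsub>T\<^esub> (tensor_rels A B)) = tensor_alg A B"
  by (intro quotient_algebra.intro T_genideal T.nc_algebra_axioms) (simp add: tensor_alg_def)

definition pure :: "'a \<Rightarrow> 'b \<Rightarrow> ('a \<times> 'b \<Rightarrow>\<^sub>0 'k) set" where
  "pure a b = Idl\<^bsub>T\<^esub> (tensor_rels A B) +>\<^bsub>T\<^esub> Poly_Mapping.single (a, b) 1"

lemma pure_closed [simp]: "a \<in> carrier A \<Longrightarrow> b \<in> carrier B \<Longrightarrow> pure a b \<in> carrier (tensor_alg A B)"
  unfolding pure_def by (rule TA.proj_simps) simp

lemma pure_mult:
  "a \<in> carrier A \<Longrightarrow> b \<in> carrier B \<Longrightarrow> a' \<in> carrier A \<Longrightarrow> b' \<in> carrier B \<Longrightarrow>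
    pure a b \<otimes>\<^bsub>tensor_alg A B\<^esub> pure a' b' = pure (a \<otimes>\<^bsub>A\<^esub> a') (b \<otimes>\<^bsub>B\<^esub> b')"
  unfolding pure_def by (subst TA.proj_simps) simp_all

lemma pure_one: "pure \<one>\<^bsub>A\<^esub> \<one>\<^bsub>B\<^esub> = \<one>\<^bsub>tensor_alg A B\<^esub>"
  unfolding pure_def by (subst TA.proj_simps) simp

end


context algebra_pair
begin

lemma tensor_alg_rel:
  assumes "r \<in> tensor_rels A B" "r = p - q" "p \<in> carrier T" "q \<in> carrier T"
  shows "Idl\<^bsub>T\<^esub> (tensor_rels A B) +>\<^bsub>T\<^esub> p = Idl\<^bsub>T\<^esub> (tensor_rels A B) +>\<^bsub>T\<^esub> q"
proof -
  have "\<ominus>\<^bsub>T\<^esub> q = - q"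
    by (rule T.add.inv_equality) (use assms in auto)
  then have "p \<ominus>\<^bsub>T\<^esub> q = r" using assms(2) by (simp add: a_minus_def)
  then show ?thesis
    using assms T.genideal_self[OF tensor_rels_carrier] by (subst TA.proj_eq_iff) auto
qed

lemma pure_add_left:
  assumes "a \<in> carrier A" "a' \<in> carrier A" "b \<in> carrier B"
  shows "pure (a \<oplus>\<^bsub>A\<^esub> a') b = pure a b \<oplus>\<^bsub>tensor_alg A B\<^esub> pure a' b"
proof -
  let ?s = "\<lambda>x y. Poly_Mapping.single (x, y) (1 :: 'k)"
  have "?s (a \<oplus>\<^bsub>A\<^esub> a') b - ?s a b - ?s a' b \<in> tensor_rels A B"
    unfolding tensor_rels_def using assms by blast
  from tensor_alg_rel[OF this, of "?s (a \<oplus>\<^bsub>A\<^esub> a') b" "?s a b + ?s a' b"] show ?thesis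
    unfolding pure_def using assms by (subst TA.proj_simps) (simp_all add: keys_add_subset)
qed

lemma pure_add_right:
  assumes "a \<in> carrier A" "b \<in> carrier B" "b' \<in> carrier B"
  shows "pure a (b \<oplus>\<^bsub>B\<^esub> b') = pure a b \<oplus>\<^bsub>tensor_alg A B\<^esub> pure a b'"
proof -
  let ?s = "\<lambda>x y. Poly_Mapping.single (x, y) (1 :: 'k)"
  have "?s a (b \<oplus>\<^bsub>B\<^esub> b') - ?s a b - ?s a b' \<in> tensor_rels A B"
    unfolding tensor_rels_def using assms by blast
  from tensor_alg_rel[OF this, of "?s a (b \<oplus>\<^bsub>B\<^esub> b')" "?s a b + ?s a b'"] show ?thesis
    unfolding pure_def using assms by (subst TA.proj_simps) (simp_all add: keys_add_subset)
qed

lemma pure_smult_left: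
  assumes "a \<in> carrier A" "b \<in> carrier B"
  shows "pure (c \<odot>\<^bsub>A\<^esub> a) b = c \<odot>\<^bsub>tensor_alg A B\<^esub> pure a b"
proof -
  have "Poly_Mapping.single (c \<odot>\<^bsub>A\<^esub> a, b) 1 - Poly_Mapping.single (a, b) c \<in> tensor_rels A B"
    unfolding tensor_rels_def using assms by blast
  from tensor_alg_rel[OF this refl] show ?thesis
    unfolding pure_def using assms by (subst TA.proj_smult) simp_all
qed

lemma pure_smult_right:
  assumes "a \<in> carrier A" "b \<in> carrier B"
  shows "pure a (c \<odot>\<^bsub>B\<^esub> b) = c \<odot>\<^bsub>tensor_alg A B\<^esub> pure a b"
proof -
  have "Poly_Mapping.single (a, c \<odot>\<^bsub>B\<^esub> b) 1 - Poly_Mapping.single (a, b) c \<in> tensor_rels A B"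
    unfolding tensor_rels_def using assms by blast
  from tensor_alg_rel[OF this refl] show ?thesis
    unfolding pure_def using assms by (subst TA.proj_smult) simp_all
qed

text \<open>
  For a set \<open>N\<close> closed under left multiplication by the proposed generators, the elements \<open>a\<close> such
  that \<open>a \<otimes> 1\<close> maps \<open>N\<close> into itself form a set to which the induction principle of the first factor
  applies.  The second factor then gives \<open>1 \<otimes> b \<in> N\<close>, and \<open>a \<otimes> b\<close> is the product of the two.
\<close>

lemma generated_by_tensor:
  assumes X: "generated_by A X" and Y: "generated_by B Y"
  shows "generated_by (tensor_alg A B)
    ((\<lambda>x. pure x \<one>\<^bsub>B\<^esub>) ` X \<union> (\<lambda>y. pure \<one>\<^bsub>A\<^esub> y) ` Y)" (is "generated_by ?T ?G")
  unfolding generated_by_def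
proof (intro conjI allI impI)
  note XA = generated_byD[OF X] and YB = generated_byD[OF Y]
  show "?G \<subseteq> carrier ?T" using XA YB by auto
  fix N assume N: "N \<subseteq> carrier ?T" "\<one>\<^bsub>?T\<^esub> \<in> N" "\<forall>x\<in>N. \<forall>y\<in>N. x \<oplus>\<^bsub>?T\<^esub> y \<in> N"
    "\<forall>c. \<forall>x\<in>N. c \<odot>\<^bsub>?T\<^esub> x \<in> N" "\<forall>g\<in>?G. \<forall>x\<in>N. g \<otimes>\<^bsub>?T\<^esub> x \<in> N"
  have left: "pure a \<one>\<^bsub>B\<^esub> \<otimes>\<^bsub>?T\<^esub> z \<in> N" if "a \<in> carrier A" "z \<in> N" for a z
  proof -
    have z: "z \<in> carrier ?T" using N(1) that(2) by blast
    show ?thesis using X that(1)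
    proof (induction rule: generated_by_induct)
      case one then show ?case using z that(2) by (simp add: pure_one)
    next
      case (add x y)
      then have "pure (x \<oplus>\<^bsub>A\<^esub> y) \<one>\<^bsub>B\<^esub> \<otimes>\<^bsub>?T\<^esub> z =
          pure x \<one>\<^bsub>B\<^esub> \<otimes>\<^bsub>?T\<^esub> z \<oplus>\<^bsub>?T\<^esub> pure y \<one>\<^bsub>B\<^esub> \<otimes>\<^bsub>?T\<^esub> z"
        using z by (simp add: pure_add_left TA.Q.l_distr)
      then show ?case using add N(3) by simp
    next
      case (smult c x)
      then have "pure (c \<odot>\<^bsub>A\<^esub> x) \<one>\<^bsub>B\<^esub> \<otimes>\<^bsub>?T\<^esub> z = c \<odot>\<^bsub>?T\<^esub> (pure x \<one>\<^bsub>B\<^esub> \<otimes>\<^bsub>?T\<^esub> z)"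
        using z by (simp add: pure_smult_left TA.Q.smult_mult_left)
      then show ?case using smult N(4) by simp
    next
      case (mult g x)
      then have gA: "g \<in> carrier A" using XA by blast
      have "pure (g \<otimes>\<^bsub>A\<^esub> x) \<one>\<^bsub>B\<^esub> \<otimes>\<^bsub>?T\<^esub> z = pure g \<one>\<^bsub>B\<^esub> \<otimes>\<^bsub>?T\<^esub> (pure x \<one>\<^bsub>B\<^esub> \<otimes>\<^bsub>?T\<^esub> z)"
        using mult gA z pure_mult[of g "\<one>\<^bsub>B\<^esub>" x "\<one>\<^bsub>B\<^esub>"]
        by (simp flip: TA.Q.m_assoc)
      then show ?case using mult N(5) by simp
    qed (rule A.nc_algebra_axioms)
  qed
  have right: "pure \<one>\<^bsub>A\<^esub> b \<in> N" if "b \<in> carrier B" for b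
    using Y that
  proof (induction rule: generated_by_induct)
    case one then show ?case using N(2) by (simp add: pure_one)
  next
    case (add x y)
    then show ?case using N(3) by (simp add: pure_add_right)
  next
    case (smult c x)
    then show ?case using N(4) by (simp add: pure_smult_right)
  next
    case (mult g x)
    then have "pure \<one>\<^bsub>A\<^esub> g \<otimes>\<^bsub>?T\<^esub> pure \<one>\<^bsub>A\<^esub> x \<in> N" using N(5) by blast
    then show ?case using mult YB by (simp add: pure_mult)
  qed (rule B.nc_algebra_axioms)
  have pure: "pure a b \<in> N" if "a \<in> carrier A" "b \<in> carrier B" for a b
    using left[OF that(1) right[OF that(2)]] that by (simp add: pure_mult)
  let ?I = "Idl\<^bsub>T\<^esub> (tensor_rels A B)"
  have coset: "?I +>\<^bsub>T\<^esub> p \<in> N" if "Poly_Mapping.keys p \<subseteq> carrier A \<times> carrier B" for p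
    using that
  proof (induction p rule: poly_mapping_keys_induct)
    case zero
    have "0 \<odot>\<^bsub>?T\<^esub> pure \<one>\<^bsub>A\<^esub> \<one>\<^bsub>B\<^esub> \<in> N" using N(4) pure[of "\<one>\<^bsub>A\<^esub>" "\<one>\<^bsub>B\<^esub>"] by simp
    then show ?case unfolding pure_def by (subst (asm) TA.proj_smult) simp_all
  next
    case (single x c)
    then obtain a b where x: "x = (a, b)" "a \<in> carrier A" "b \<in> carrier B" by blast
    then have "c \<odot>\<^bsub>?T\<^esub> pure a b \<in> N" using N(4) pure by simp
    then show ?case unfolding pure_def x(1) using x by (subst (asm) TA.proj_smult) simp_all
  next
    case (add p q)
    then have "(?I +>\<^bsub>T\<^esub> p) \<oplus>\<^bsub>?T\<^esub> (?I +>\<^bsub>T\<^esub> q) \<in> N" using N(3) by blast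
    then show ?case using add by (subst (asm) TA.proj_simps) simp_all
  qed
  show "carrier ?T \<subseteq> N"
  proof
    fix Z assume "Z \<in> carrier ?T"
    then obtain p where "p \<in> carrier T" "Z = ?I +>\<^bsub>T\<^esub> p" by (rule TA.proj_surj)
    then show "Z \<in> N" using coset[of p] by simp
  qed
qed

text \<open>
  Two representations with commuting images combine to one of the tensor product, because
  \<open>\<alpha> a * \<beta> b\<close> is bilinear in \<open>a\<close> and \<open>b\<close> and multiplicative.
\<close>

lemma operator_rep_tensor:
  fixes \<alpha> \<beta>
  assumes "operator_rep A \<alpha>" "operator_rep B \<beta>"
    and comm: "\<And>a b. a \<in> carrier A \<Longrightarrow> b \<in> carrier B \<Longrightarrow> \<alpha> a * \<beta> b = \<beta> b * \<alpha> a"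
  obtains \<rho> where "operator_rep (tensor_alg A B) \<rho>"
    and "\<And>a b. a \<in> carrier A \<Longrightarrow> b \<in> carrier B \<Longrightarrow> \<rho> (pure a b) = \<alpha> a * \<beta> b"
proof -
  interpret \<alpha>: operator_rep A \<alpha> by fact
  interpret \<beta>: operator_rep B \<beta> by fact
  define v where "v x = \<alpha> (fst x) * \<beta> (snd x)" for x
  let ?\<tau> = "linear_ext v"
  have mult_single: "?\<tau> (Poly_Mapping.single x c \<otimes>\<^bsub>T\<^esub> Poly_Mapping.single y d) =
      ?\<tau> (Poly_Mapping.single x c) * ?\<tau> (Poly_Mapping.single y d)"
    if xy: "x \<in> carrier A \<times> carrier B" "y \<in> carrier A \<times> carrier B" for x y c d
  proof -
    obtain a b a' b' where x: "x = (a, b)" and y: "y = (a', b')" by fastforce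
    have car: "a \<in> carrier A" "b \<in> carrier B" "a' \<in> carrier A" "b' \<in> carrier B"
      using xy x y by auto
    have "(\<alpha> a * \<alpha> a') * (\<beta> b * \<beta> b') = \<alpha> a * (\<alpha> a' * \<beta> b) * \<beta> b'"
      by (simp add: mult.assoc)
    also have "\<dots> = (\<alpha> a * \<beta> b) * (\<alpha> a' * \<beta> b')"
      by (simp add: comm[OF car(3,2)] mult.assoc)
    finally have "scalar_op (c * d) * ((\<alpha> a * \<alpha> a') * (\<beta> b * \<beta> b')) =
        scalar_op c * (scalar_op d * ((\<alpha> a * \<beta> b) * (\<alpha> a' * \<beta> b')))"
      by (simp add: scalar_op_mult mult.assoc)
    also have "\<dots> = (scalar_op c * (\<alpha> a * \<beta> b)) * (scalar_op d * (\<alpha> a' * \<beta> b'))"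
      by (simp only: scalar_op_left_commute[of "\<alpha> a * \<beta> b"] mult.assoc[of "scalar_op c"])
    finally show ?thesis
      using car by (simp add: x y v_def \<alpha>.rep_mult \<beta>.rep_mult)
  qed
  interpret \<tau>: operator_rep T ?\<tau>
  proof
    fix p q assume p: "p \<in> carrier T" and q: "q \<in> carrier T"
    from p have "Poly_Mapping.keys p \<subseteq> carrier A \<times> carrier B" by simp
    then show "?\<tau> (p \<otimes>\<^bsub>T\<^esub> q) = ?\<tau> p * ?\<tau> q"
    proof (induction p rule: poly_mapping_keys_induct)
      case (single x c)
      from q have "Poly_Mapping.keys q \<subseteq> carrier A \<times> carrier B" by simp
      then show ?case
        by (induction q rule: poly_mapping_keys_induct)
          (use single mult_single in
            \<open>simp_all add: tensor_free_mult_add_right linear_ext_add distrib_left\<close>)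
    qed (simp_all add: tensor_free_mult_add_left linear_ext_add distrib_right)
  next
    fix p c
    show "?\<tau> (c \<odot>\<^bsub>T\<^esub> p) = scalar_op c * ?\<tau> p"
      by (induction p rule: poly_mapping_induct')
        (simp_all add: tensor_free_smult_add linear_ext_add distrib_left scalar_op_mult mult.assoc)
  qed (simp_all add: linear_ext_add v_def)
  have "?\<tau> r = 0" if "r \<in> tensor_rels A B" for r
    using that unfolding tensor_rels_def
    by (elim UnE CollectE exE conjE)
      (simp_all add: linear_ext_diff v_def \<alpha>.rep_add \<beta>.rep_add \<alpha>.rep_smult \<beta>.rep_smult
        distrib_left distrib_right mult.assoc scalar_op_left_commute[of "\<alpha> _"])
  then have van: "?\<tau> i = 0" if "i \<in> Idl\<^bsub>T\<^esub> (tensor_rels A B)" for i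
    using \<tau>.rep_genideal[OF tensor_rels_carrier _ that] by blast
  show ?thesis
  proof
    show "operator_rep (tensor_alg A B) (quot_rep ?\<tau>)"
      using \<tau>.operator_rep_quotient[OF T_genideal van] by (simp add: tensor_alg_def)
    show "quot_rep ?\<tau> (pure a b) = \<alpha> a * \<beta> b" if "a \<in> carrier A" "b \<in> carrier B" for a b
      unfolding pure_def using that \<tau>.quot_rep_coset[OF T_genideal van] by (simp add: v_def)
  qed
qed

end


subsection \<open>Polynomials\<close>

lemma poly_alg_simps [simp]:
  "carrier poly_alg = UNIV" "mult poly_alg = (*)" "one poly_alg = 1" "zero poly_alg = 0"
  "add poly_alg = (+)" "c \<odot>\<^bsub>poly_alg\<^esub> p = Polynomial.smult c p"
  by (simp_all add: poly_alg_def)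

interpretation poly: nc_algebra "poly_alg :: ('k::field, 'k poly) module"
proof (intro nc_algebra.intro)
  show "ring (poly_alg :: ('k, 'k poly) module)"
    by (rule ring_of_class_subset) simp_all
  show "nc_algebra_axioms (poly_alg :: ('k, 'k poly) module)"
    by standard (simp_all add: Polynomial.smult_add_left Polynomial.smult_add_right)
qed

lemma generated_by_poly_alg: "generated_by (poly_alg :: ('k::field, 'k poly) module) {[:0, 1:]}"
  unfolding generated_by_def
proof (intro conjI allI impI)
  fix N :: "'k poly set"
  assume N: "\<one>\<^bsub>poly_alg\<^esub> \<in> N" "\<forall>x\<in>N. \<forall>y\<in>N. x \<oplus>\<^bsub>poly_alg\<^esub> y \<in> N"
    "\<forall>c. \<forall>x\<in>N. c \<odot>\<^bsub>poly_alg\<^esub> x \<in> N" "\<forall>g\<in>{[:0, 1:]}. \<forall>x\<in>N. g \<otimes>\<^bsub>poly_alg\<^esub> x \<in> N"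
  have c: "[:c:] \<in> N" for c
    using N(3)[rule_format, OF N(1), of c] by simp
  have "p \<in> N" for p
  proof (induction p)
    case 0 then show ?case using c[of 0] by simp
  next
    case (pCons a p)
    then have "pCons 0 p \<in> N" using N(4) by simp
    then have "[:a:] \<oplus>\<^bsub>poly_alg\<^esub> pCons 0 p \<in> N" using N(2) c by blast
    then show ?case by simp
  qed
  then show "carrier poly_alg \<subseteq> N" by blast
qed simp

lemma operator_rep_poly_const:
  "operator_rep (poly_alg :: ('k::field, 'k poly) module) (\<lambda>q. mult_op [:q:])"
proof
  fix p q :: "'k poly" and c :: 'k
  show "mult_op [:c \<odot>\<^bsub>poly_alg\<^esub> q:] = scalar_op c * mult_op [:q:]"
    by (simp add: scalar_op_def flip: mult_op_mult)
qed (simp_all flip: mult_op_add mult_op_mult one_pCons add: mult.commute)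


section \<open>A density criterion\<close>

lemma operator_subalgebra_mult_op:
  assumes add: "\<And>T U. T \<in> J \<Longrightarrow> U \<in> J \<Longrightarrow> T + U \<in> J"
    and mult: "\<And>T U. T \<in> J \<Longrightarrow> U \<in> J \<Longrightarrow> T * U \<in> J"
    and scalar: "\<And>c. scalar_op c \<in> J"
    and C: "mult_op [:[:0, 1:]:] \<in> J" and h: "mult_op [:0, 1:] \<in> J"
  shows "mult_op p \<in> J"
proof -
  have const: "mult_op [:q:] \<in> J" for q
  proof (induction q)
    case 0 then show ?case using scalar[of 0] by simp
  next
    case (pCons c q)
    have "[:pCons c q:] = [:[:c:]:] + [:[:0, 1:]:] * [:q:]" by simp
    then have "mult_op [:pCons c q:] = scalar_op c + mult_op [:[:0, 1:]:] * mult_op [:q:]"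
      by (simp only: mult_op_add mult_op_mult scalar_op_def)
    then show ?case using add mult scalar C pCons by simp
  qed
  show ?thesis
  proof (induction p)
    case 0 then show ?case using scalar[of 0] by simp
  next
    case (pCons q p)
    have "pCons q p = [:q:] + [:0, 1:] * p" by simp
    then have "mult_op (pCons q p) = mult_op [:q:] + mult_op [:0, 1:] * mult_op p"
      by (simp only: mult_op_add mult_op_mult)
    then show ?case using add mult const h pCons by simp
  qed
qed

text \<open>
  A subalgebra with \<open>C\<close>, \<open>h\<close> and \<open>\<sigma>\<close> contains all skew polynomials, and right multiplication by a high
  power of \<open>\<sigma>\<close> removes the negative powers from a skew Laurent polynomial.
\<close>

lemma dense_embedding_skew_laurent:
  fixes R :: "('k::field_char_0, 'a) module"
  assumes "operator_rep R \<rho>" "inj_on \<rho> (carrier R)" "\<rho> ` carrier R \<subseteq> laurent"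
    and C: "mult_op [:[:0, 1:]:] \<in> \<rho> ` carrier R" and h: "mult_op [:0, 1:] \<in> \<rho> ` carrier R"
    and e: "shift_op 1 \<in> \<rho> ` carrier R"
  shows "dense_embedding R skew_laurent_alg \<rho>"
proof -
  interpret operator_rep R \<rho> by fact
  define J where "J = \<rho> ` carrier R"
  have add: "T + U \<in> J" and mult: "T * U \<in> J" if "T \<in> J" "U \<in> J" for T U
  proof -
    obtain x y where xy: "x \<in> carrier R" "T = \<rho> x" "y \<in> carrier R" "U = \<rho> y"
      using \<open>T \<in> J\<close> \<open>U \<in> J\<close> unfolding J_def by blast
    have "T + U = \<rho> (x \<oplus>\<^bsub>R\<^esub> y)" "T * U = \<rho> (x \<otimes>\<^bsub>R\<^esub> y)" using xy by (simp_all add: rep_add rep_mult)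
    then show "T + U \<in> J" "T * U \<in> J" unfolding J_def using xy by blast+
  qed
  have scalar: "scalar_op c \<in> J" for c
    unfolding J_def using rep_smult[of "\<one>\<^bsub>R\<^esub>" c] by (auto simp: image_iff intro!: bexI[of _ "c \<odot>\<^bsub>R\<^esub> \<one>\<^bsub>R\<^esub>"])
  have mult_op: "mult_op p \<in> J" for p
    by (rule operator_subalgebra_mult_op[OF add mult scalar]) (use C h in \<open>simp_all add: J_def\<close>)
  have shift: "shift_op (int n) \<in> J" for n
  proof (induction n)
    case 0 then show ?case using scalar[of 1] by simp
  next
    case (Suc n)
    have "shift_op 1 \<in> J" using e by (simp add: J_def)
    from mult[OF this Suc] show ?case by (simp add: shift_op_add)
  qed
  have sum: "sum f A \<in> J" if "\<And>i. i \<in> A \<Longrightarrow> f i \<in> J" for f and A :: "int set"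
    using that by (induction A rule: infinite_finite_induct) (use scalar[of 0] add in auto)
  have inj: "inj_on \<rho> (carrier R)" by fact
  show ?thesis
  proof (intro dense_embedding.intro nc_algebra_axioms skew_laurent.ore_domain_axioms
      dense_embedding_axioms.intro)
    show "\<rho> \<in> ring_hom R skew_laurent_alg"
      by (rule ring_hom_memI) (use assms(3) in \<open>auto simp: rep_add rep_mult\<close>)
    show "inj_on \<rho> (carrier R)" by fact
    show "\<rho> (c \<odot>\<^bsub>R\<^esub> x) = c \<odot>\<^bsub>skew_laurent_alg\<^esub> \<rho> x" if "x \<in> carrier R" for c x
      using that by (simp add: rep_smult)
    fix l assume "l \<in> carrier (skew_laurent_alg :: ('k, 'k poly lin_op) module)"
    then obtain N where N: "0 \<le> N" "l \<in> laurent_range (- N) (N + 1)"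
      by (auto elim: laurentE)
    then obtain a where a: "l = skew_sum {- N..<N + 1} a" by (auto simp: laurent_range_def)
    have mono: "mult_op p * shift_op n * shift_op N \<in> J" if "- N \<le> n" for p n
      using mult[OF mult_op shift[of "nat (n + N)"]] that by (simp add: mult.assoc shift_op_add)
    have "l * shift_op N \<in> J"
      unfolding a skew_sum_def sum_distrib_right by (rule sum) (use mono in auto)
    then obtain r where r: "r \<in> carrier R" "l * shift_op N = \<rho> r" unfolding J_def by blast
    obtain s where s: "s \<in> carrier R" "shift_op N = \<rho> s"
      using shift[of "nat N"] N unfolding J_def by auto
    have "shift_op N * shift_op (- N) \<noteq> (0 :: 'k poly lin_op)"
      by (simp add: shift_op_add)
    then have "s \<noteq> \<zero>\<^bsub>R\<^esub>" using s by auto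
    then show "\<exists>r\<in>carrier R. \<exists>s\<in>carrier R. s \<noteq> \<zero>\<^bsub>R\<^esub> \<and> l \<otimes>\<^bsub>skew_laurent_alg\<^esub> \<rho> s = \<rho> r"
      using r s by auto
  qed
qed

section \<open>Generalised Weyl algebras inside the skew Laurent polynomials\<close>

text \<open>
  Horner evaluation with the powers of \<open>t\<close> to the left of the coefficients.  It is a ring homomorphism when the
  point \<open>t\<close> commutes with the image of the coefficients, which is assumed in the locale below.
\<close>

definition nc_eval :: "('a, 'm) ring_scheme \<Rightarrow> ('b::zero \<Rightarrow> 'a) \<Rightarrow> 'a \<Rightarrow> 'b poly \<Rightarrow> 'a" where
  "nc_eval R s t p = fold_coeffs (\<lambda>b x. s b \<oplus>\<^bsub>R\<^esub> t \<otimes>\<^bsub>R\<^esub> x) p \<zero>\<^bsub>R\<^esub>"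

locale poly_eval = ring R for R (structure) +
  fixes s :: "'b::comm_ring_1 \<Rightarrow> 'a" and t :: 'a
  assumes s_closed [simp]: "s b \<in> carrier R"
    and s_add: "s (b + c) = s b \<oplus> s c"
    and s_mult: "s (b * c) = s b \<otimes> s c"
    and s_one: "s 1 = \<one>"
    and t_closed [simp]: "t \<in> carrier R"
    and t_commute: "t \<otimes> s b = s b \<otimes> t"
begin

abbreviation (input) "ev \<equiv> nc_eval R s t"

lemma s_zero [simp]: "s 0 = \<zero>"
  using s_add[of 0 0] by simp

lemma ev_0 [simp]: "ev 0 = \<zero>"
  by (simp add: nc_eval_def)

lemma ev_pCons: "ev (pCons b p) = s b \<oplus> t \<otimes> ev p"
  by (cases "p = 0"; cases "b = 0") (simp_all add: nc_eval_def)

lemma ev_closed [simp]: "ev p \<in> carrier R"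
  by (induction p) (simp_all add: ev_pCons)

lemma ev_const [simp]: "ev [:b:] = s b"
  by (simp add: ev_pCons)

lemma ev_one [simp]: "ev 1 = \<one>"
  by (simp add: one_pCons s_one)

lemma ev_add: "ev (p + q) = ev p \<oplus> ev q"
proof (induction p q rule: poly_induct2)
  case (pCons a p b q)
  then show ?case
    by (simp add: ev_pCons s_add r_distr a_ac)
qed simp

lemma ev_diff: "ev (p - q) = ev p \<ominus> ev q"
proof -
  have "ev p = ev (p - q) \<oplus> ev q" by (simp flip: ev_add)
  then show ?thesis by (simp add: minus_eq a_assoc r_neg)
qed

lemma ev_smult: "ev (Polynomial.smult b p) = s b \<otimes> ev p"
proof (induction p)
  case (pCons a p)
  have "t \<otimes> (s b \<otimes> ev p) = s b \<otimes> (t \<otimes> ev p)"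
    by (simp add: t_commute flip: m_assoc)
  with pCons show ?case
    by (simp add: ev_pCons s_mult r_distr)
qed simp

lemma ev_mult: "ev (p * q) = ev p \<otimes> ev q"
proof (induction p)
  case (pCons a p)
  then show ?case
    by (simp add: ev_add ev_smult ev_pCons l_distr m_assoc)
qed simp

text \<open>
  An element that commutes with the coefficients and carries \<open>t\<close> to \<open>t'\<close> carries evaluation at \<open>t\<close> to
  evaluation at \<open>t'\<close>.  With \<open>t' = t\<close> it shows that whatever commutes with the coefficients and
  with \<open>t\<close> commutes with all values; with \<open>t' = t \<plusminus> 1\<close> it gives the skew commutation rules of \<open>e\<close> and \<open>f\<close>.
\<close>

lemma ev_intertwine:
  assumes z: "z \<in> carrier R" and s: "\<And>b. z \<otimes> s b = s b \<otimes> z"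
    and t': "t' \<in> carrier R" "z \<otimes> t = t' \<otimes> z"
  shows "z \<otimes> ev p = nc_eval R s t' p \<otimes> z \<and> nc_eval R s t' p \<in> carrier R"
proof (induction p)
  case 0 then show ?case using z by (simp add: nc_eval_def)
next
  case (pCons a p)
  have t'': "nc_eval R s t' (pCons a p) = s a \<oplus> t' \<otimes> nc_eval R s t' p"
    using t' by (cases "p = 0"; cases "a = 0") (simp_all add: nc_eval_def)
  have "z \<otimes> ev (pCons a p) = s a \<otimes> z \<oplus> (t' \<otimes> z) \<otimes> ev p"
    using z t' by (simp add: ev_pCons r_distr s flip: m_assoc)
  also have "\<dots> = s a \<otimes> z \<oplus> t' \<otimes> (nc_eval R s t' p \<otimes> z)"
    using z t' pCons by (simp add: m_assoc)
  also have "\<dots> = nc_eval R s t' (pCons a p) \<otimes> z"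
    using z t' pCons by (simp add: t'' l_distr m_assoc)
  finally show ?case using pCons t' by (simp add: t'')
qed

lemma ev_commute:
  assumes "z \<in> carrier R" "\<And>b. z \<otimes> s b = s b \<otimes> z" "z \<otimes> t = t \<otimes> z"
  shows "z \<otimes> ev p = ev p \<otimes> z"
  using ev_intertwine[OF assms(1,2) t_closed assms(3)] by simp

lemma ev_pcompose: "ev (pcompose p [:d, 1:]) = nc_eval R s (s d \<oplus> t) p"
proof (induction p)
  case 0 then show ?case by (simp add: nc_eval_def)
next
  case (pCons a p)
  have "nc_eval R s (s d \<oplus> t) (pCons a p) = s a \<oplus> (s d \<oplus> t) \<otimes> nc_eval R s (s d \<oplus> t) p"
    by (cases "p = 0"; cases "a = 0") (simp_all add: nc_eval_def)
  then show ?case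
    unfolding pcompose_pCons ev_add ev_mult pCons by (simp add: ev_pCons s_one)
qed

end

definition alg_eval2 :: "('k::field, 'a) module \<Rightarrow> 'a \<Rightarrow> 'a \<Rightarrow> 'k poly poly \<Rightarrow> 'a" where
  "alg_eval2 R C h = nc_eval R (nc_eval R (\<lambda>c. c \<odot>\<^bsub>R\<^esub> \<one>\<^bsub>R\<^esub>) C) h"

locale commuting_pair = nc_algebra R for R :: "('k::field, 'a) module" (structure) +
  fixes C h
  assumes C_closed [simp]: "C \<in> carrier R" and h_closed [simp]: "h \<in> carrier R"
    and h_C: "h \<otimes> C = C \<otimes> h"
begin

abbreviation (input) "\<psi> \<equiv> alg_eval2 R C h"

sublocale inner: poly_eval R "\<lambda>c. c \<odot> \<one>" C
proof
  show "(b * c) \<odot> \<one> = (b \<odot> \<one>) \<otimes> (c \<odot> \<one>)" for b c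
    by (simp add: smult_assoc smult_mult_left)
qed (simp_all add: smult_add_left smult_mult_left smult_mult_right)

lemma inner_commute:
  "z \<in> carrier R \<Longrightarrow> z \<otimes> C = C \<otimes> z \<Longrightarrow> z \<otimes> inner.ev p = inner.ev p \<otimes> z"
  by (rule inner.ev_commute) (simp_all add: smult_mult_left smult_mult_right)

sublocale poly_eval R "nc_eval R (\<lambda>c. c \<odot> \<one>) C" h
  rewrites "nc_eval R (nc_eval R (\<lambda>c. c \<odot> \<one>) C) h = \<psi>"
proof -
  show "poly_eval R (nc_eval R (\<lambda>c. c \<odot> \<one>) C) h"
    by standard
      (simp_all add: inner.ev_add inner.ev_mult inner.s_one inner_commute[of h] h_C)
qed (simp add: alg_eval2_def)

lemma eval_C: "\<psi> [:[:0, 1:]:] = C" and eval_h: "\<psi> [:0, 1:] = h"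
  by (simp_all add: ev_pCons inner.ev_pCons inner.s_one)

end

text \<open>
  A generalised Weyl algebra over \<open>k[C, h]\<close> with the automorphism \<open>h \<mapsto> h - 1\<close>, together with its
  representation in skew Laurent polynomials.  Both \<open>U(sl\<^sub>2)\<close> and \<open>k[C] \<otimes> A\<^sub>1\<close> are of this kind; they
  differ only in the polynomials \<open>e f\<close> and \<open>f e\<close>.
\<close>

locale generalised_weyl = operator_rep R \<rho> + commuting_pair R C h
  for R :: "('k::field_char_0, 'a) module" (structure) and \<rho> C h +
  fixes e f and q r a :: "'k::field_char_0 poly poly"
  assumes closed [simp]: "e \<in> carrier R" "f \<in> carrier R"
    and C_commute: "e \<otimes> C = C \<otimes> e" "f \<otimes> C = C \<otimes> f"
    and e_h: "e \<otimes> h = (h \<ominus> \<one>) \<otimes> e"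
    and f_h: "f \<otimes> h = (h \<oplus> \<one>) \<otimes> f"
    and e_f: "e \<otimes> f = alg_eval2 R C h q"
    and f_e: "f \<otimes> e = alg_eval2 R C h r"
    and generated: "generated_by R {C, h, e, f}"
    and rep_C: "\<rho> C = mult_op [:[:0, 1:]:]"
    and rep_h: "\<rho> h = mult_op [:0, 1:]"
    and rep_e: "\<rho> e = shift_op 1"
    and rep_f: "\<rho> f = mult_op a * shift_op (-1)"
    and a_nonzero: "a \<noteq> 0"
begin

lemma e_eval: "e \<otimes> \<psi> p = \<psi> (shift 1 p) \<otimes> e"
proof -
  have "inner.ev (-1) = \<ominus> \<one>"
    using inner.ev_add[of "-1" 1] by (intro minus_equality[symmetric]) simp_all
  then show ?thesis
    using ev_intertwine[of e "h \<ominus> \<one>" p] ev_pcompose[of p "- 1"]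
    by (simp add: inner_commute[of e] C_commute e_h shift_def minus_eq a_comm)
qed

lemma f_eval: "f \<otimes> \<psi> p = \<psi> (shift (- 1) p) \<otimes> f"
  using ev_intertwine[of f "h \<oplus> \<one>" p] ev_pcompose[of p 1]
  by (simp add: inner_commute[of f] C_commute f_h shift_def a_comm)

text \<open>
  Since \<open>e f\<close> lies in \<open>k[C, h]\<close>, the element \<open>f\<close> serves as \<open>e\<^sup>-\<^sup>1\<close> up to a coefficient.  Counting
  powers of \<open>f\<close> as negative powers of \<open>e\<close> matches the exponents of \<open>\<sigma>\<close>.
\<close>

definition e_power :: "int \<Rightarrow> 'a" where
  "e_power n = (if 0 \<le> n then e [^] nat n else f [^] nat (- n))"

declare pow_nat [simp del]

lemma e_power_closed [simp]: "e_power n \<in> carrier R"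
  by (simp add: e_power_def)

lemma pow_commute: "x \<in> carrier R \<Longrightarrow> x \<otimes> x [^] (k :: nat) = x [^] k \<otimes> x"
  by (induction k) (simp_all flip: m_assoc)

lemma e_mult_e_power: "\<exists>p. e \<otimes> e_power n = \<psi> p \<otimes> e_power (n + 1)"
proof (cases "0 \<le> n")
  case True
  then have "e \<otimes> e_power n = \<psi> 1 \<otimes> e_power (n + 1)"
    by (simp add: e_power_def nat_add_distrib pow_commute)
  then show ?thesis by blast
next
  case False
  then have "nat (- n) = Suc (nat (- (n + 1)))" by simp
  then have "e \<otimes> e_power n = (e \<otimes> f) \<otimes> f [^] nat (- (n + 1))"
    using False pow_commute[of f "nat (- (n + 1))"] by (simp add: e_power_def m_assoc)
  also have "f [^] nat (- (n + 1)) = e_power (n + 1)"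
    using False by (auto simp: e_power_def)
  finally show ?thesis unfolding e_f by blast
qed

lemma f_mult_e_power: "\<exists>p. f \<otimes> e_power n = \<psi> p \<otimes> e_power (n - 1)"
proof (cases "n \<le> 0")
  case True
  then have "nat (- (n - 1)) = Suc (nat (- n))" by simp
  then have "f \<otimes> e_power n = \<psi> 1 \<otimes> e_power (n - 1)"
    using True by (auto simp add: e_power_def pow_commute)
  then show ?thesis by blast
next
  case False
  then have "nat n = Suc (nat (n - 1))" by simp
  then have "f \<otimes> e_power n = (f \<otimes> e) \<otimes> e [^] nat (n - 1)"
    using False pow_commute[of e "nat (n - 1)"] by (simp add: e_power_def m_assoc)
  also have "e [^] nat (n - 1) = e_power (n - 1)"
    using False by (auto simp: e_power_def)
  finally show ?thesis unfolding f_e by blast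
qed

lemma rep_eval: "\<rho> (\<psi> p) = mult_op p"
proof -
  have inner: "\<rho> (inner.ev u) = mult_op [:u:]" for u
  proof (induction u)
    case (pCons c u)
    have "[:pCons c u:] = [:[:c:]:] + [:[:0, 1:]:] * [:u:]" by simp
    then have "mult_op [:pCons c u:] = scalar_op c + mult_op [:[:0, 1:]:] * mult_op [:u:]"
      by (simp only: mult_op_add mult_op_mult scalar_op_def)
    then show ?case
      by (simp add: inner.ev_pCons rep_add rep_mult rep_smult rep_C pCons)
  qed simp
  show ?thesis
  proof (induction p)
    case (pCons u p)
    have "pCons u p = [:u:] + [:0, 1:] * p" by simp
    then have "mult_op (pCons u p) = mult_op [:u:] + mult_op [:0, 1:] * mult_op p"
      by (simp only: mult_op_add mult_op_mult)
    then show ?case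
      by (simp add: ev_pCons rep_add rep_mult rep_h inner pCons)
  qed simp
qed

lemma rep_e_power: "\<exists>p. p \<noteq> 0 \<and> \<rho> (e_power n) = mult_op p * shift_op n"
proof -
  have e: "\<rho> (e [^] k) = shift_op (int k)" for k :: nat
    by (induction k) (simp_all add: rep_mult rep_e shift_op_add add.commute)
  have f: "\<exists>p. p \<noteq> 0 \<and> \<rho> (f [^] k) = mult_op p * shift_op (- int k)" for k :: nat
  proof (induction k)
    case 0 then show ?case by (intro exI[of _ 1]) simp
  next
    case (Suc k)
    then obtain p where "p \<noteq> 0" "\<rho> (f [^] k) = mult_op p * shift_op (- int k)" by blast
    then have "\<rho> (f [^] Suc k) = mult_op (p * shift (- int k) a) * shift_op (- int k + - 1)"
      by (simp only: nat_pow_Suc rep_mult nat_pow_closed closed rep_f monomial_mult)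
    also have "- int k + - 1 = - int (Suc k)" by simp
    finally have "\<rho> (f [^] Suc k) = mult_op (p * shift (- int k) a) * shift_op (- int (Suc k))" .
    then show ?case using \<open>p \<noteq> 0\<close> a_nonzero
      by (intro exI[of _ "p * shift (- int k) a"]) simp
  qed
  show ?thesis
    using f[of "nat (- n)"] e[of "nat n"]
    by (cases "0 \<le> n") (auto simp: e_power_def intro!: exI[of _ 1])
qed

definition normal_form :: "int set \<Rightarrow> (int \<Rightarrow> 'k poly poly) \<Rightarrow> 'a" where
  "normal_form A c = (\<Oplus>n\<in>A. \<psi> (c n) \<otimes> e_power n)"

lemma normal_form_closed [simp]: "normal_form A c \<in> carrier R"
  unfolding normal_form_def by (rule finsum_closed) simp

lemma normal_form_insert:
  "finite A \<Longrightarrow> n \<notin> A \<Longrightarrow>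
    normal_form (insert n A) c = \<psi> (c n) \<otimes> e_power n \<oplus> normal_form A c"
  unfolding normal_form_def by (rule finsum_insert) auto

lemma normal_form_add_monomial:
  assumes "finite A"
  shows "\<exists>A' c'. finite A' \<and> \<psi> p \<otimes> e_power n \<oplus> normal_form A c = normal_form A' c'"
proof -
  have cong: "normal_form (A - {n}) (c(n := b)) = normal_form (A - {n}) c" for b
    unfolding normal_form_def by (rule finsum_cong') auto
  have ins: "normal_form (insert n (A - {n})) (c(n := b)) =
      \<psi> b \<otimes> e_power n \<oplus> normal_form (A - {n}) c" for b
    using assms by (subst normal_form_insert) (simp_all add: cong)
  show ?thesis
  proof (cases "n \<in> A")
    case True
    then have A: "normal_form A c = \<psi> (c n) \<otimes> e_power n \<oplus> normal_form (A - {n}) c"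
      using ins[of "c n"] by (simp add: insert_absorb)
    have "\<psi> p \<otimes> e_power n \<oplus> normal_form A c =
        (\<psi> p \<oplus> \<psi> (c n)) \<otimes> e_power n \<oplus> normal_form (A - {n}) c"
      by (subst A) (simp add: l_distr a_assoc)
    also have "\<dots> = normal_form (insert n (A - {n})) (c(n := p + c n))"
      by (simp only: ins ev_add)
    finally show ?thesis using assms by (intro exI conjI) simp_all
  next
    case False
    then have "\<psi> p \<otimes> e_power n \<oplus> normal_form A c =
        normal_form (insert n (A - {n})) (c(n := p))"
      unfolding ins by simp
    then show ?thesis using assms by (intro exI conjI) simp_all
  qed
qed

text \<open>
  The normal forms are closed under sums and under left multiplication by the generators: \<open>e\<close> and \<open>f\<close>
  pass the coefficient by a shift and change the degree by one, up to a coefficient from \<open>e f\<close> or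
  \<open>f e\<close>.
\<close>

lemma normal_form_exists:
  assumes "x \<in> carrier R"
  obtains A c where "finite A" "x = normal_form A c"
proof -
  define N where "N = {normal_form A c | A c. finite A}"
  have NI: "normal_form A c \<in> N" if "finite A" for A c
    unfolding N_def using that by blast
  have zero: "\<zero> \<in> N" using NI[of "{}"] by (simp add: normal_form_def)
  have mono_add: "\<psi> p \<otimes> e_power n \<oplus> y \<in> N" if "y \<in> N" for p n y
    using that normal_form_add_monomial unfolding N_def by blast
  have car: "y \<in> carrier R" if "y \<in> N" for y using that unfolding N_def by auto
  have add: "y \<oplus> z \<in> N" if y: "y \<in> N" and z: "z \<in> N" for y z
  proof -
    obtain A c where A: "finite A" "y = normal_form A c" using y unfolding N_def by blast
    show ?thesis unfolding A(2) using A(1)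
    proof (induction A)
      case empty then show ?case using z car by (simp add: normal_form_def)
    next
      case (insert n A)
      then show ?case
        using mono_add[OF insert.IH, of "c n" n] car[OF z]
        by (simp add: normal_form_insert a_assoc)
    qed
  qed
  (* Left multiplication by a generator moves monomials to monomials, of the same or a neighbouring degree. *)
  have left: "g \<otimes> y \<in> N"
    if y: "y \<in> N" and g: "g \<in> carrier R"
      and step: "\<And>p n. \<exists>p' n'. g \<otimes> (\<psi> p \<otimes> e_power n) = \<psi> p' \<otimes> e_power n'" for g y
  proof -
    obtain A c where A: "finite A" "y = normal_form A c" using y unfolding N_def by blast
    show ?thesis unfolding A(2) using A(1)
    proof (induction A)
      case empty then show ?case using zero g by (simp add: normal_form_def)
    next
      case (insert n A)
      obtain p' n' where "g \<otimes> (\<psi> (c n) \<otimes> e_power n) = \<psi> p' \<otimes> e_power n'"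
        using step by blast
      then show ?case
        using mono_add[OF insert.IH, of p' n'] insert g
        by (simp add: normal_form_insert r_distr)
    qed
  qed
  have const_step: "\<exists>p' n'. \<psi> b \<otimes> (\<psi> p \<otimes> e_power n) = \<psi> p' \<otimes> e_power n'" for b p n
    by (intro exI[of _ "b * p"] exI[of _ n]) (simp add: ev_mult m_assoc)
  have c1: "c \<odot> \<one> = \<psi> [:[:c:]:]" for c by simp
  have e_step: "\<exists>p' n'. e \<otimes> (\<psi> p \<otimes> e_power n) = \<psi> p' \<otimes> e_power n'" for p n
  proof -
    obtain b where b: "e \<otimes> e_power n = \<psi> b \<otimes> e_power (n + 1)" using e_mult_e_power by blast
    have "e \<otimes> (\<psi> p \<otimes> e_power n) = \<psi> (shift 1 p) \<otimes> (e \<otimes> e_power n)"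
      by (simp add: e_eval flip: m_assoc)
    also have "\<dots> = \<psi> (shift 1 p * b) \<otimes> e_power (n + 1)"
      by (simp add: b ev_mult m_assoc)
    finally show ?thesis by blast
  qed
  have f_step: "\<exists>p' n'. f \<otimes> (\<psi> p \<otimes> e_power n) = \<psi> p' \<otimes> e_power n'" for p n
  proof -
    obtain b where b: "f \<otimes> e_power n = \<psi> b \<otimes> e_power (n - 1)" using f_mult_e_power by blast
    have "f \<otimes> (\<psi> p \<otimes> e_power n) = \<psi> (shift (- 1) p) \<otimes> (f \<otimes> e_power n)"
      by (simp add: f_eval flip: m_assoc)
    also have "\<dots> = \<psi> (shift (- 1) p * b) \<otimes> e_power (n - 1)"
      by (simp add: b ev_mult m_assoc)
    finally show ?thesis by blast
  qed
  have "x \<in> N" using generated assms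
  proof (induction rule: generated_by_induct)
    case one
    show ?case using mono_add[OF zero, of 1 0] by (simp add: e_power_def)
  next
    case (add x y) then show ?case using \<open>\<And>y z. y \<in> N \<Longrightarrow> z \<in> N \<Longrightarrow> y \<oplus> z \<in> N\<close> by blast
  next
    case (smult c x)
    have "(c \<odot> \<one>) \<otimes> x \<in> N"
      by (rule left[OF smult(2)]) (simp_all only: c1 const_step ev_closed)
    then show ?case using smult by (simp add: smult_mult_left)
  next
    case (mult g x)
    have "g = C \<or> g = h \<or> g = e \<or> g = f" using mult by blast
    then have "\<exists>p' n'. g \<otimes> (\<psi> p \<otimes> e_power n) = \<psi> p' \<otimes> e_power n'" for p n
      using e_step f_step const_step[of "[:[:0, 1:]:]", unfolded eval_C]
        const_step[of "[:0, 1:]", unfolded eval_h] by auto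
    then show ?case using mult left generated_byD[OF generated] by blast
  qed (rule nc_algebra_axioms)
  then show ?thesis using that unfolding N_def by blast
qed

lemma rep_normal_form:
  assumes "finite A"
  obtains w where "\<And>n. w n \<noteq> 0" "\<rho> (normal_form A c) = skew_sum A (\<lambda>n. c n * w n)"
proof -
  obtain w where w: "\<And>n. w n \<noteq> 0" "\<And>n. \<rho> (e_power n) = mult_op (w n) * shift_op n"
    using rep_e_power by metis
  have "\<rho> (normal_form A c) = skew_sum A (\<lambda>n. c n * w n)"
    using assms
    by (induction A)
      (simp_all add: normal_form_insert rep_add rep_mult rep_eval w skew_sum_def mult_op_mult
        mult.assoc, simp add: normal_form_def)
  then show ?thesis using that w by blast
qed

lemma rep_laurent:
  assumes "x \<in> carrier R"
  shows "\<rho> x \<in> laurent"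
  using generated assms
proof (induction rule: generated_by_induct)
  case (mult g x)
  have "g = C \<or> g = h \<or> g = e \<or> g = f" using mult by blast
  then have "\<rho> g \<in> laurent"
    by (auto simp: rep_C rep_h rep_e rep_f)
  then show ?case using mult generated_byD[OF generated] by (simp add: rep_mult)
qed (simp_all add: rep_add rep_smult nc_algebra_axioms)

text \<open>
  A normal form in the kernel has vanishing coefficients: each degree is represented by a nonzero
  multiple of its own power of \<open>\<sigma>\<close>, and different powers are independent.
\<close>

lemma rep_inj: "inj_on \<rho> (carrier R)"
proof (rule inj_onI)
  have kernel: "x = \<zero>" if x: "x \<in> carrier R" "\<rho> x = 0" for x
  proof -
    obtain A c where A: "finite A" "x = normal_form A c" using normal_form_exists[OF x(1)] .
    obtain w where w: "\<And>n. w n \<noteq> 0" "\<rho> (normal_form A c) = skew_sum A (\<lambda>n. c n * w n)"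
      using rep_normal_form[OF A(1)] by blast
    have "c n = 0" if "n \<in> A" for n
      using skew_sum_eq_0D[OF A(1) _ that, of "\<lambda>n. c n * w n"] w A x(2) by simp
    then show ?thesis
      unfolding A(2) normal_form_def by (intro add.finprod_one_eqI) simp
  qed
  fix x y assume xy: "x \<in> carrier R" "y \<in> carrier R" "\<rho> x = \<rho> y"
  then have "x \<ominus> y = \<zero>" by (intro kernel) (simp_all add: rep_diff)
  then have "(x \<ominus> y) \<oplus> y = y" using xy by simp
  then show "x = y" using xy by (simp add: minus_eq a_assoc l_neg)
qed

lemma dense: "dense_embedding R skew_laurent_alg \<rho>"
  by (rule dense_embedding_skew_laurent[OF operator_rep_axioms rep_inj])
    (auto simp: rep_laurent image_iff intro: bexI[of _ C] bexI[of _ h] bexI[of _ e]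
      simp flip: rep_C rep_h rep_e)

end


section \<open>The enveloping algebra of \<open>sl\<^sub>2\<close>\<close>

lemma UNIV_sl2_basis: "(UNIV :: sl2_basis set) = {E, F, H}"
  by (auto intro: sl2_basis.exhaust)

lemma lie_embed_sl2:
  "lie_embed x = Poly_Mapping.single [E] (x E) + Poly_Mapping.single [F] (x F) +
    Poly_Mapping.single [H] (x H)"
  by (simp add: lie_embed_def UNIV_sl2_basis add.assoc)

definition sl2_rels :: "(sl2_basis list \<Rightarrow>\<^sub>0 'k::field) set" where
  "sl2_rels =
    {lie_embed x * lie_embed y - lie_embed y * lie_embed x - lie_embed (sl2_bracket x y) | x y. True}"

lemma env_ideal_sl2: "env_ideal sl2_bracket = Idl\<^bsub>free_alg\<^esub> sl2_rels"
  by (simp add: env_ideal_def sl2_rels_def)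

lemma env_quotient:
  "quotient_algebra (free_alg :: ('k::field, sl2_basis list \<Rightarrow>\<^sub>0 'k) module) (env_ideal sl2_bracket)"
  unfolding env_ideal_sl2
  by (rule quotient_algebra_genideal[OF free.nc_algebra_axioms]) simp

lemmas env_ideal_is_ideal = quotient_algebra.axioms(2)[OF env_quotient]

interpretation U: nc_algebra "U_sl2 :: ('k::field, _) module"
  unfolding U_sl2_def by (rule quotient_algebra.nc_algebra_quotient[OF env_quotient])

abbreviation U_class :: "(sl2_basis list \<Rightarrow>\<^sub>0 'k::field) \<Rightarrow> (sl2_basis list \<Rightarrow>\<^sub>0 'k) set" where
  "U_class x \<equiv> env_ideal sl2_bracket +>\<^bsub>free_alg\<^esub> x"

lemma U_class_simps [simp]:
  "U_class x \<in> carrier U_sl2"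
  "U_class x \<otimes>\<^bsub>U_sl2\<^esub> U_class y = U_class (x * y)"
  "U_class x \<oplus>\<^bsub>U_sl2\<^esub> U_class y = U_class (x + y)"
  "\<one>\<^bsub>U_sl2\<^esub> = U_class 1"
  by (simp_all add: U_sl2_def quotient_algebra.proj_simps[OF env_quotient])

lemma U_class_smult [simp]: "c \<odot>\<^bsub>U_sl2\<^esub> U_class x = U_class (Poly_Mapping.single [] c * x)"
  by (simp add: U_sl2_def quotient_algebra.proj_smult[OF env_quotient])

lemma U_class_diff [simp]: "U_class x \<ominus>\<^bsub>U_sl2\<^esub> U_class y = U_class (x - y)"
proof -
  have zero: "U_class 0 = \<zero>\<^bsub>U_sl2\<^esub>"
    using U.r_zero[of "U_class 0"] U.add.r_cancel_one[of "U_class 0" "U_class 0"] by simp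
  then have "\<ominus>\<^bsub>U_sl2\<^esub> U_class y = U_class (- y)"
    by (intro U.add.inv_equality) (simp_all flip: zero)
  then show ?thesis by (simp add: a_minus_def)
qed

lemma U_class_eqI: "x - y \<in> env_ideal sl2_bracket \<Longrightarrow> U_class x = U_class y"
  by (simp add: quotient_algebra.proj_eq_iff[OF env_quotient] free_a_minus)

lemma sl2_rels_subset: "sl2_rels \<subseteq> env_ideal sl2_bracket"
  unfolding env_ideal_sl2 by (rule free.genideal_self) simp

lemma env_ideal_closed:
  "x \<in> env_ideal sl2_bracket \<Longrightarrow> y \<in> env_ideal sl2_bracket \<Longrightarrow> x + y \<in> env_ideal sl2_bracket"
  "x \<in> env_ideal sl2_bracket \<Longrightarrow> - x \<in> env_ideal sl2_bracket"
  "x \<in> env_ideal sl2_bracket \<Longrightarrow> y \<in> env_ideal sl2_bracket \<Longrightarrow> x - y \<in> env_ideal sl2_bracket"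
  "x \<in> env_ideal sl2_bracket \<Longrightarrow> z * x \<in> env_ideal sl2_bracket"
  "x \<in> env_ideal sl2_bracket \<Longrightarrow> x * z \<in> env_ideal sl2_bracket"
  using additive_subgroup.a_closed[OF ideal.axioms(1)[OF env_ideal_is_ideal], of x y]
    ideal.I_l_closed[OF env_ideal_is_ideal, of x z] ideal.I_r_closed[OF env_ideal_is_ideal, of x z]
    ideal.I_l_closed[OF env_ideal_is_ideal, of x "-1"]
    ideal.I_l_closed[OF env_ideal_is_ideal, of y "-1"]
    additive_subgroup.a_closed[OF ideal.axioms(1)[OF env_ideal_is_ideal], of x "- y"]
  by simp_all

definition sl2_C :: "sl2_basis list \<Rightarrow>\<^sub>0 'k::field" where
  "sl2_C = free_gen H * (free_gen H + 1) + free_gen F * free_gen E"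

lemma sl2_rels_basis:
  fixes r1 r2 r3 :: "sl2_basis list \<Rightarrow>\<^sub>0 'k::field"
  defines "r1 \<equiv> free_gen H * free_gen E - free_gen E * free_gen H - free_gen E"
    and "r2 \<equiv> free_gen H * free_gen F - free_gen F * free_gen H + free_gen F"
    and "r3 \<equiv> free_gen E * free_gen F - free_gen F * free_gen E - (free_gen H + free_gen H)"
  shows "r1 \<in> env_ideal sl2_bracket" "r2 \<in> env_ideal sl2_bracket" "r3 \<in> env_ideal sl2_bracket"
proof -
  define u :: "sl2_basis \<Rightarrow> sl2_basis \<Rightarrow> 'k" where "u a b = (if a = b then 1 else 0)" for a b
  have rel: "lie_embed x * lie_embed y - lie_embed y * lie_embed x - lie_embed (sl2_bracket x y)
      \<in> env_ideal sl2_bracket" for x y :: "sl2_basis \<Rightarrow> 'k"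
    using sl2_rels_subset unfolding sl2_rels_def by blast
  have emb: "lie_embed (u b) = free_gen b" for b
    by (cases b) (simp_all add: lie_embed_sl2 u_def)
  show "r1 \<in> env_ideal sl2_bracket"
    using rel[of "u H" "u E"] by (simp add: emb r1_def, simp add: lie_embed_sl2 u_def)
  show "r2 \<in> env_ideal sl2_bracket"
    using rel[of "u H" "u F"]
    by (simp add: emb r2_def, simp add: lie_embed_sl2 u_def single_uminus)
  have "Poly_Mapping.single [H] (2 :: 'k) = free_gen H + free_gen H"
    by (simp flip: single_add)
  then show "r3 \<in> env_ideal sl2_bracket"
    using rel[of "u E" "u F"] by (simp add: emb r3_def, simp add: lie_embed_sl2 u_def)
qed

text \<open>
  The element \<open>C = h (h + 1) + f e\<close> is central and determines \<open>e f\<close> and \<open>f e\<close>.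
  Each identity expresses the difference of two elements of the free algebra as a combination of
  the three commutation relations.
\<close>

lemma sl2_U_relations:
  fixes e f h :: "sl2_basis list \<Rightarrow>\<^sub>0 'k::field"
  defines "e \<equiv> free_gen E" and "f \<equiv> free_gen F" and "h \<equiv> free_gen H"
  shows "U_class (h * sl2_C) = U_class (sl2_C * h)"
    and "U_class (e * sl2_C) = U_class (sl2_C * e)"
    and "U_class (f * sl2_C) = U_class (sl2_C * f)"
    and "U_class (e * h) = U_class ((h - 1) * e)"
    and "U_class (f * h) = U_class ((h + 1) * f)"
    and "U_class (e * f) = U_class (sl2_C + h - h * h)"
    and "U_class (f * e) = U_class (sl2_C - h - h * h)"
proof -
  define r1 where "r1 = h * e - e * h - e"
  define r2 where "r2 = h * f - f * h + f"
  define r3 where "r3 = e * f - f * e - (h + h)"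
  note r = sl2_rels_basis[where 'k = 'k, folded e_def f_def h_def, folded r1_def r2_def r3_def]
  note cl = env_ideal_closed[where ?'a = 'k]
  have C: "sl2_C = h * (h + 1) + f * e" by (simp add: sl2_C_def e_def f_def h_def)
  have "h * sl2_C - sl2_C * h = r2 * e + f * r1"
    unfolding C r1_def r2_def by (simp add: algebra_simps)
  then show "U_class (h * sl2_C) = U_class (sl2_C * h)"
    using r cl by (intro U_class_eqI) simp
  have "e * sl2_C - sl2_C * e = r3 * e - h * r1 - r1 * h"
    unfolding C r1_def r3_def by (simp add: algebra_simps)
  then show "U_class (e * sl2_C) = U_class (sl2_C * e)"
    using r cl by (intro U_class_eqI) simp
  have "f * sl2_C - sl2_C * f = - (h * r2) - r2 * h - f * r3"
    unfolding C r2_def r3_def by (simp add: algebra_simps)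
  then show "U_class (f * sl2_C) = U_class (sl2_C * f)"
    using r cl by (intro U_class_eqI) simp
  have "e * h - (h - 1) * e = - r1" unfolding r1_def by (simp add: algebra_simps)
  then show "U_class (e * h) = U_class ((h - 1) * e)"
    using r cl by (intro U_class_eqI) simp
  have "f * h - (h + 1) * f = - r2" unfolding r2_def by (simp add: algebra_simps)
  then show "U_class (f * h) = U_class ((h + 1) * f)"
    using r cl by (intro U_class_eqI) simp
  have "e * f - (sl2_C + h - h * h) = r3" unfolding C r3_def by (simp add: algebra_simps)
  then show "U_class (e * f) = U_class (sl2_C + h - h * h)"
    using r by (intro U_class_eqI) simp
  have "f * e = sl2_C - h - h * h" unfolding C by (simp add: algebra_simps)
  then show "U_class (f * e) = U_class (sl2_C - h - h * h)" by simp
qed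

text \<open>
  The value \<open>C - h - h\<^sup>2\<close> of \<open>f e\<close>.
\<close>

definition sl2_a :: "'k::field poly poly" where
  "sl2_a = [:[:0, 1:]:] - [:0, 1:] - [:0, 1:] * [:0, 1:]"

primrec sl2_op :: "sl2_basis \<Rightarrow> 'k::field poly lin_op" where
  "sl2_op E = shift_op 1"
| "sl2_op F = mult_op sl2_a * shift_op (-1)"
| "sl2_op H = mult_op [:0, 1:]"

text \<open>
  Applied to a polynomial \<open>p\<close>, both sides of a relation become combinations of shifts of \<open>p\<close> with
  coefficients in a commutative ring, so bilinearity and the three basic brackets are checked in one
  polynomial identity.
\<close>

lemma free_eval_sl2_rels:
  assumes "r \<in> sl2_rels"
  shows "free_eval sl2_op r = (0 :: 'k::field poly lin_op)"
proof -
  define K :: "'k \<Rightarrow> 'k poly poly" where "K c = [:[:c:]:]" for c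
  define X :: "'k poly poly" where "X = [:0, 1:]"
  have K: "K (c + d) = K c + K d" "K (c - d) = K c - K d" "K (c * d) = K c * K d" for c d
    by (simp_all add: K_def)
  have K2: "K 2 = 2" unfolding K_def by (simp add: numeral_poly)
  have sK: "shift n (K c) = K c" for n c by (simp add: K_def)
  have sX: "shift n X = X - of_int n" for n by (simp add: X_def shift_X)
  have sa: "shift 1 sl2_a = sl2_a + 2 * X"
    unfolding sl2_a_def by (simp add: shift_diff shift_mult flip: X_def) (simp add: sX algebra_simps)
  have op: "apply_op (free_eval sl2_op (lie_embed x)) p =
      K (x E) * shift 1 p + K (x F) * sl2_a * shift (-1) p + K (x H) * X * p" for x p
    by (simp add: lie_embed_sl2 free_eval_add scalar_op_def apply_op_simps apply_mult_op
        apply_shift_op K_def X_def mult.assoc)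
  obtain x y where r: "r = lie_embed x * lie_embed y - lie_embed y * lie_embed x -
      lie_embed (sl2_bracket x y)"
    using assms unfolding sl2_rels_def by blast
  show ?thesis
  proof (rule lin_op_eqI)
    fix p
    show "apply_op (free_eval sl2_op r) p = apply_op 0 p"
      unfolding r free_eval_diff free_eval_mult apply_op_simps op
      by (simp add: shift_add shift_mult sK sX sa shift_shift K K2, simp add: algebra_simps)
  qed
qed

definition sl2_rep :: "(sl2_basis list \<Rightarrow>\<^sub>0 'k::field) set \<Rightarrow> 'k poly lin_op" where
  "sl2_rep = quot_rep (free_eval sl2_op)"

lemma free_eval_env_ideal:
  assumes "i \<in> env_ideal sl2_bracket"
  shows "free_eval sl2_op i = (0 :: 'k::field poly lin_op)"
  using operator_rep.rep_genideal[OF operator_rep_free_eval _ free_eval_sl2_rels, of sl2_rels]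
    assms
  by (simp add: env_ideal_sl2)

lemma operator_rep_sl2: "operator_rep U_sl2 sl2_rep"
  unfolding sl2_rep_def U_sl2_def
  by (rule operator_rep.operator_rep_quotient[OF operator_rep_free_eval env_ideal_is_ideal
        free_eval_env_ideal])

lemma sl2_rep_class [simp]: "sl2_rep (U_class x) = free_eval sl2_op x"
  unfolding sl2_rep_def
  by (rule operator_rep.quot_rep_coset[OF operator_rep_free_eval env_ideal_is_ideal
        free_eval_env_ideal]) simp_all

lemma sl2_a_nonzero: "sl2_a \<noteq> (0 :: 'k::field poly poly)"
proof
  assume "sl2_a = (0 :: 'k poly poly)"
  then have "poly (sl2_a :: 'k poly poly) 0 = 0" by simp
  then show False by (simp add: sl2_a_def)
qed

lemma generated_by_U: "generated_by (U_sl2 :: ('k::field, _) module) {U_gen E, U_gen F, U_gen H}"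
  using quotient_algebra.generated_by_quotient[OF env_quotient generated_by_free_alg]
  by (simp add: image_image UNIV_sl2_basis U_gen_def[abs_def] U_sl2_def)

interpretation sl2: generalised_weyl "U_sl2 :: ('k::field_char_0, _) module" sl2_rep
  "U_class sl2_C" "U_gen H" "U_gen E" "U_gen F"
  "[:[:0, 1:]:] + [:0, 1:] - [:0, 1:] * [:0, 1:]" sl2_a sl2_a
proof -
  note rels = sl2_U_relations[where 'k = 'k]
  interpret cp: commuting_pair "U_sl2 :: ('k, _) module" "U_class sl2_C" "U_gen H"
    by unfold_locales (simp_all add: U_gen_def rels)
  show "generalised_weyl U_sl2 sl2_rep (U_class sl2_C) (U_gen H) (U_gen E) (U_gen F)
      ([:[:0, 1:]:] + [:0, 1:] - [:0, 1:] * [:0, 1:]) sl2_a (sl2_a :: 'k poly poly)"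
  proof (intro generalised_weyl.intro generalised_weyl_axioms.intro operator_rep_sl2
      cp.commuting_pair_axioms)
    show "generated_by U_sl2 {U_class sl2_C, U_gen H, U_gen E, U_gen F :: (_ \<Rightarrow>\<^sub>0 'k) set}"
      by (rule generated_by_mono[OF generated_by_U]) (auto simp: U_gen_def)
    show "U_gen E \<otimes>\<^bsub>U_sl2\<^esub> U_gen F =
        alg_eval2 U_sl2 (U_class sl2_C) (U_gen H)
          ([:[:0, 1:]:] + [:0, 1:] - [:0, 1:] * [:0, 1 :: 'k poly:])"
      unfolding cp.ev_diff cp.ev_add cp.ev_mult cp.eval_C cp.eval_h by (simp add: U_gen_def rels)
    show "U_gen F \<otimes>\<^bsub>U_sl2\<^esub> U_gen E =
        alg_eval2 U_sl2 (U_class sl2_C) (U_gen H) (sl2_a :: 'k poly poly)"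
      unfolding sl2_a_def cp.ev_diff cp.ev_add cp.ev_mult cp.eval_C cp.eval_h by (simp add: U_gen_def rels)
    show "sl2_rep (U_class sl2_C) = mult_op [:[:0, 1 :: 'k:]:]"
    proof -
      have "sl2_rep (U_class sl2_C) =
          mult_op [:0, 1 :: 'k poly:] * (mult_op [:0, 1:] + 1) + mult_op sl2_a"
        by (simp add: sl2_C_def free_eval_add free_eval_mult mult.assoc shift_op_add)
      also have "\<dots> = mult_op ([:0, 1:] * ([:0, 1:] + 1) + sl2_a)"
        by (simp only: mult_op_add mult_op_mult mult_op_1)
      also have "[:0, 1:] * ([:0, 1:] + 1) + sl2_a = [:[:0, 1 :: 'k:]:]"
        by (simp add: sl2_a_def algebra_simps)
      finally show ?thesis .
    qed
  qed (simp_all add: U_gen_def rels sl2_a_nonzero)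
qed


section \<open>The algebra \<open>k[C] \<otimes> A\<^sub>1\<close>\<close>

lemma weyl_quotient:
  "quotient_algebra (free_alg :: ('k::field, weyl_gen list \<Rightarrow>\<^sub>0 'k) module) weyl_ideal"
  unfolding weyl_ideal_def
  by (rule quotient_algebra_genideal[OF free.nc_algebra_axioms]) simp

interpretation weyl: nc_algebra "weyl_alg :: ('k::field, _) module"
  unfolding weyl_alg_def by (rule quotient_algebra.nc_algebra_quotient[OF weyl_quotient])

abbreviation weyl_class :: "(weyl_gen list \<Rightarrow>\<^sub>0 'k::field) \<Rightarrow> (weyl_gen list \<Rightarrow>\<^sub>0 'k) set" where
  "weyl_class x \<equiv> weyl_ideal +>\<^bsub>free_alg\<^esub> x"

lemma weyl_class_simps [simp]:
  "weyl_class x \<in> carrier weyl_alg"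
  "weyl_class x \<otimes>\<^bsub>weyl_alg\<^esub> weyl_class y = weyl_class (x * y)"
  "weyl_class x \<oplus>\<^bsub>weyl_alg\<^esub> weyl_class y = weyl_class (x + y)"
  "\<one>\<^bsub>weyl_alg\<^esub> = weyl_class 1"
  by (simp_all add: weyl_alg_def quotient_algebra.proj_simps[OF weyl_quotient])

lemma weyl_relation:
  "weyl_class (free_gen WD * free_gen WX) = weyl_class (free_gen WX * free_gen WD + 1)"
proof -
  have "free_gen WD * free_gen WX - free_gen WX * free_gen WD - 1 \<in> weyl_ideal"
    unfolding weyl_ideal_def by (rule free.genideal_self') simp
  then show ?thesis
    by (simp add: quotient_algebra.proj_eq_iff[OF weyl_quotient] free_a_minus diff_diff_eq)
qed

text \<open>
  The polynomial \<open>h + 1\<close> is chosen so that \<open>x \<partial>\<close> acts as \<open>h\<close>; then \<open>\<partial> x\<close> acts as \<open>h + 1\<close>.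
\<close>

primrec weyl_op :: "weyl_gen \<Rightarrow> 'k::field poly lin_op" where
  "weyl_op WX = shift_op 1"
| "weyl_op WD = mult_op [:1, 1:] * shift_op (-1)"

lemma weyl_op_mult:
  "weyl_op WX * weyl_op WD = mult_op [:0, 1:]" "weyl_op WD * weyl_op WX = mult_op [:1, 1:]"
  using monomial_mult[of 1 1 "[:1, 1 :: 'k::field poly:]" "- 1"]
  by (simp_all add: shift_def pcompose_pCons mult.assoc shift_op_add)

lemma weyl_rep:
  obtains \<beta> :: "(weyl_gen list \<Rightarrow>\<^sub>0 'k::field) set \<Rightarrow> 'k poly lin_op"
  where "operator_rep weyl_alg \<beta>" "\<And>x. \<beta> (weyl_class x) = free_eval weyl_op x"
proof -
  have "free_eval weyl_op (free_gen WD * free_gen WX - free_gen WX * free_gen WD - 1) =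
      mult_op [:1, 1 :: 'k poly:] - mult_op [:0, 1:] - mult_op 1"
    by (simp add: free_eval_diff free_eval_mult weyl_op_mult del: weyl_op.simps)
  also have "\<dots> = mult_op ([:1, 1:] - [:0, 1:] - 1)"
    by (simp only: mult_op_diff)
  also have "\<dots> = 0" by (simp add: one_pCons)
  finally have rel: "free_eval weyl_op (free_gen WD * free_gen WX - free_gen WX * free_gen WD - 1) =
      (0 :: 'k poly lin_op)" .
  have van: "free_eval weyl_op i = (0 :: 'k poly lin_op)" if "i \<in> weyl_ideal" for i
    using operator_rep.rep_genideal[OF operator_rep_free_eval, of
        "{free_gen WD * free_gen WX - free_gen WX * free_gen WD - 1}" weyl_op i] rel that
    unfolding weyl_ideal_def by auto
  note I = quotient_algebra.axioms(2)[OF weyl_quotient]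
  show ?thesis
  proof
    show "operator_rep weyl_alg (quot_rep (free_eval weyl_op) :: _ \<Rightarrow> 'k poly lin_op)"
      unfolding weyl_alg_def by (rule operator_rep.operator_rep_quotient[OF operator_rep_free_eval I van])
    show "quot_rep (free_eval weyl_op) (weyl_class x) = (free_eval weyl_op x :: 'k poly lin_op)" for x
      by (rule operator_rep.quot_rep_coset[OF operator_rep_free_eval I van]) simp_all
  qed
qed

lemma UNIV_weyl_gen: "(UNIV :: weyl_gen set) = {WX, WD}"
  by (auto intro: weyl_gen.exhaust)

lemma generated_by_weyl:
  "generated_by (weyl_alg :: ('k::field, _) module) {weyl_class (free_gen WX), weyl_class (free_gen WD)}"
  using quotient_algebra.generated_by_quotient[OF weyl_quotient generated_by_free_alg]
  by (simp add: image_image UNIV_weyl_gen weyl_alg_def)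

text \<open>
  With \<open>h = x \<partial>\<close> the tensor product is a generalised Weyl algebra: the relation \<open>\<partial> x = x \<partial> + 1\<close> turns
  into \<open>x h = (h - 1) x\<close> and \<open>\<partial> h = (h + 1) \<partial>\<close>.
\<close>

lemma dense_embedding_tensor:
  obtains \<rho> where "dense_embedding
    (tensor_alg (poly_alg :: ('k::field_char_0, 'k poly) module) weyl_alg) skew_laurent_alg \<rho>"
proof -
  interpret TP: algebra_pair "poly_alg :: ('k, 'k poly) module" weyl_alg
    by (intro algebra_pair.intro poly.nc_algebra_axioms weyl.nc_algebra_axioms)
  let ?T = "tensor_alg (poly_alg :: ('k, 'k poly) module) weyl_alg"
  obtain \<beta> :: "(weyl_gen list \<Rightarrow>\<^sub>0 'k) set \<Rightarrow> 'k poly lin_op"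
    where \<beta>: "operator_rep weyl_alg \<beta>" "\<And>x. \<beta> (weyl_class x) = free_eval weyl_op x"
    using weyl_rep by blast
  obtain \<rho> where \<rho>: "operator_rep ?T \<rho>"
    and pure: "\<And>q w. w \<in> carrier weyl_alg \<Longrightarrow> \<rho> (TP.pure q w) = mult_op [:q:] * \<beta> w"
    using TP.operator_rep_tensor[OF operator_rep_poly_const \<beta>(1)] const_op_commute
    by (metis UNIV_I poly_alg_simps(1))
  define P where "P w = TP.pure 1 (weyl_class w)" for w
  define X where "X = (free_gen WX :: weyl_gen list \<Rightarrow>\<^sub>0 'k)"
  define D where "D = (free_gen WD :: weyl_gen list \<Rightarrow>\<^sub>0 'k)"
  define C where "C = TP.pure [:0, 1:] (weyl_class 1)"
  have P_closed [simp]: "P w \<in> carrier ?T" for w by (simp add: P_def)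
  have C_closed [simp]: "C \<in> carrier ?T" by (simp add: C_def)
  have P_mult: "P w \<otimes>\<^bsub>?T\<^esub> P w' = P (w * w')" for w w'
    using TP.pure_mult[of 1 "weyl_class w" 1 "weyl_class w'"] by (simp add: P_def)
  have P_add: "P w \<oplus>\<^bsub>?T\<^esub> P w' = P (w + w')" for w w'
    using TP.pure_add_right[of 1 "weyl_class w" "weyl_class w'"] by (simp add: P_def)
  have P_one: "\<one>\<^bsub>?T\<^esub> = P 1"
    using TP.pure_one by (simp add: P_def)
  have P_diff: "P w \<ominus>\<^bsub>?T\<^esub> P w' = P (w - w')" for w w'
  proof -
    have "P w = P (w - w') \<oplus>\<^bsub>?T\<^esub> P w'" by (simp add: P_add)
    then show ?thesis by (simp add: TP.TA.Q.minus_eq TP.TA.Q.a_assoc TP.TA.Q.r_neg)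
  qed
  have PC: "P w \<otimes>\<^bsub>?T\<^esub> C = C \<otimes>\<^bsub>?T\<^esub> P w" for w
    using TP.pure_mult[of 1 "weyl_class w" "[:0, 1:]" "weyl_class 1"]
      TP.pure_mult[of "[:0, 1:]" "weyl_class 1" 1 "weyl_class w"]
    by (simp add: P_def C_def)
  have PI: "P w = P w'" if "weyl_class w = weyl_class w'" for w w'
    using that by (simp add: P_def)
  have DX: "P (D * X) = P (X * D + 1)"
    by (rule PI) (simp add: D_def X_def weyl_relation)
  interpret cp: commuting_pair ?T C "P (X * D)"
    by unfold_locales (simp_all add: PC)
  have "generalised_weyl ?T \<rho> C (P (X * D)) (P X) (P D) [:0, 1:] ([:0, 1:] + 1) [:1, 1:]"
  proof (intro generalised_weyl.intro \<rho> cp.commuting_pair_axioms generalised_weyl_axioms.intro PC)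
    have "P X \<otimes>\<^bsub>?T\<^esub> P (X * D) = P X \<otimes>\<^bsub>?T\<^esub> (P (D * X) \<ominus>\<^bsub>?T\<^esub> \<one>\<^bsub>?T\<^esub>)"
      by (simp add: DX P_one P_diff)
    also have "\<dots> = (P (X * D) \<ominus>\<^bsub>?T\<^esub> \<one>\<^bsub>?T\<^esub>) \<otimes>\<^bsub>?T\<^esub> P X"
      by (simp add: P_one P_diff P_mult algebra_simps)
    finally show "P X \<otimes>\<^bsub>?T\<^esub> P (X * D) = (P (X * D) \<ominus>\<^bsub>?T\<^esub> \<one>\<^bsub>?T\<^esub>) \<otimes>\<^bsub>?T\<^esub> P X" .
    have "P D \<otimes>\<^bsub>?T\<^esub> P (X * D) = P (D * X) \<otimes>\<^bsub>?T\<^esub> P D"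
      by (simp add: P_mult mult.assoc)
    also have "\<dots> = (P (X * D) \<oplus>\<^bsub>?T\<^esub> \<one>\<^bsub>?T\<^esub>) \<otimes>\<^bsub>?T\<^esub> P D"
      by (simp add: DX P_one P_add)
    finally show "P D \<otimes>\<^bsub>?T\<^esub> P (X * D) = (P (X * D) \<oplus>\<^bsub>?T\<^esub> \<one>\<^bsub>?T\<^esub>) \<otimes>\<^bsub>?T\<^esub> P D" .
    show "P X \<otimes>\<^bsub>?T\<^esub> P D = alg_eval2 ?T C (P (X * D)) [:0, 1:]"
      by (simp add: cp.eval_h P_mult)
    show "P D \<otimes>\<^bsub>?T\<^esub> P X = alg_eval2 ?T C (P (X * D)) ([:0, 1:] + 1)"
      unfolding cp.ev_add cp.eval_h cp.ev_one by (simp add: P_mult DX P_add P_one)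
    show "generated_by ?T {C, P (X * D), P X, P D}"
    proof (rule generated_by_mono[OF TP.generated_by_tensor[OF generated_by_poly_alg generated_by_weyl]])
    qed (auto simp: C_def P_def X_def D_def)
    show "\<rho> C = mult_op [:[:0, 1:]:]"
      by (simp add: C_def pure \<beta>)
    have rP: "\<rho> (P w) = free_eval weyl_op w" for w
      by (simp add: P_def pure \<beta> flip: one_pCons)
    show "\<rho> (P (X * D)) = mult_op [:0, 1:]"
      by (simp add: rP X_def D_def free_eval_mult weyl_op_mult del: weyl_op.simps)
    show "\<rho> (P X) = shift_op 1" "\<rho> (P D) = mult_op [:1, 1:] * shift_op (- 1)"
      by (simp_all add: rP X_def D_def)
  qed simp_all
  then show ?thesis by (rule that[OF generalised_weyl.dense])
qed


section \<open>Invariants\<close>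

lemma (in nc_algebra) nc_algebra_subalgebra:
  assumes S: "S \<subseteq> carrier R" and "\<one> \<in> S"
    and add: "\<And>x y. x \<in> S \<Longrightarrow> y \<in> S \<Longrightarrow> x \<oplus> y \<in> S"
    and mult: "\<And>x y. x \<in> S \<Longrightarrow> y \<in> S \<Longrightarrow> x \<otimes> y \<in> S"
    and smult: "\<And>c x. x \<in> S \<Longrightarrow> c \<odot> x \<in> S"
  shows "nc_algebra (R\<lparr>carrier := S\<rparr>)"
proof -
  have car: "x \<in> carrier R" if "x \<in> S" for x using S that by blast
  have neg: "(- 1) \<odot> x \<oplus> x = \<zero>" if "x \<in> carrier R" for x
  proof -
    have "0 \<odot> x \<oplus> 0 \<odot> x = 0 \<odot> x" using smult_add_left[OF that, of 0 0] by simp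
    then have "0 \<odot> x = \<zero>" using that by simp
    then show ?thesis using smult_add_left[OF that, of "- 1" 1] that by simp
  qed
  have zero: "\<zero> \<in> S"
    using neg[OF one_closed] add[OF smult[OF \<open>\<one> \<in> S\<close>] \<open>\<one> \<in> S\<close>] by metis
  show ?thesis
  proof (intro nc_algebra.intro ringI nc_algebra_axioms.intro)
    show "abelian_group (R\<lparr>carrier := S\<rparr>)"
      by (rule abelian_groupI)
        (use neg smult in \<open>auto simp: car add zero a_ac intro!: bexI[of _ "(- 1) \<odot> _"]\<close>)
    show "Group.monoid (R\<lparr>carrier := S\<rparr>)"
      by (rule monoidI) (simp_all add: car mult \<open>\<one> \<in> S\<close> m_assoc)
  qed (simp_all add: car smult l_distr r_distr smult_add_left smult_add_right smult_assoc
      smult_mult_left smult_mult_right)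
qed

text \<open>
  The relation expresses that \<open>U\<close> arises from \<open>T\<close> by \<open>\<sigma> \<mapsto> \<xi> \<sigma>\<close>, which is how the generator of the
  group acts.  Stated as a relation, it makes sense before this map is known to be well defined.
\<close>

definition twisted :: "'k::field \<Rightarrow> 'k poly lin_op \<Rightarrow> 'k poly lin_op \<Rightarrow> bool" where
  "twisted \<xi> T U \<longleftrightarrow> (\<exists>A a. finite A \<and> (\<forall>n. n \<notin> A \<longrightarrow> a n = 0) \<and>
     T = skew_sum A a \<and> U = skew_sum A (\<lambda>n. [:[:\<xi> powi n:]:] * a n))"

lemma skew_sum_superset:
  "finite B \<Longrightarrow> A \<subseteq> B \<Longrightarrow> (\<And>n. n \<notin> A \<Longrightarrow> a n = 0) \<Longrightarrow> skew_sum A a = skew_sum B a"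
  unfolding skew_sum_def by (rule sum.mono_neutral_left) auto

lemma skew_sum_monomial_mult:
  "(mult_op p * shift_op d) * skew_sum A a =
    skew_sum ((+) d ` A) (\<lambda>n. p * shift d (a (n - d)))"
  unfolding skew_sum_def sum_distrib_left monomial_mult
  by (subst sum.reindex) (simp_all add: o_def)

lemma scalar_op_skew_sum: "scalar_op c * skew_sum A a = skew_sum A (\<lambda>n. [:[:c:]:] * a n)"
  by (simp add: skew_sum_def sum_distrib_left scalar_op_def mult_op_mult mult.assoc
      del: mult_pCons_left)

lemma twisted_add:
  assumes "twisted \<xi> T U" "twisted \<xi> T' U'" shows "twisted \<xi> (T + T') (U + U')"
proof -
  obtain A a where A: "finite A" "\<And>n. n \<notin> A \<Longrightarrow> a n = 0" "T = skew_sum A a"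
      "U = skew_sum A (\<lambda>n. [:[:\<xi> powi n:]:] * a n)"
    using assms(1) unfolding twisted_def by blast
  obtain B b where B: "finite B" "\<And>n. n \<notin> B \<Longrightarrow> b n = 0" "T' = skew_sum B b"
      "U' = skew_sum B (\<lambda>n. [:[:\<xi> powi n:]:] * b n)"
    using assms(2) unfolding twisted_def by blast
  have "T = skew_sum (A \<union> B) a" "U = skew_sum (A \<union> B) (\<lambda>n. [:[:\<xi> powi n:]:] * a n)"
    unfolding A(3,4) by (rule skew_sum_superset; use A B in auto)+
  moreover have "T' = skew_sum (A \<union> B) b" "U' = skew_sum (A \<union> B) (\<lambda>n. [:[:\<xi> powi n:]:] * b n)"
    unfolding B(3,4) by (rule skew_sum_superset; use A B in auto)+
  ultimately show ?thesis
    unfolding twisted_def using A(1,2) B(1,2)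
    by (intro exI[of _ "A \<union> B"] exI[of _ "\<lambda>n. a n + b n"])
      (simp add: skew_sum_add smult_add_right)
qed

lemma twisted_monomial_mult:
  assumes "twisted \<xi> T U" "\<xi> \<noteq> 0"
  shows "twisted \<xi> ((mult_op p * shift_op d) * T)
    (scalar_op (\<xi> powi d) * ((mult_op p * shift_op d) * U))"
proof -
  obtain A a where A: "finite A" "\<And>n. n \<notin> A \<Longrightarrow> a n = 0" "T = skew_sum A a"
      "U = skew_sum A (\<lambda>n. [:[:\<xi> powi n:]:] * a n)"
    using assms(1) unfolding twisted_def by blast
  have pw: "[:[:\<xi> powi d:]:] * [:[:\<xi> powi (n - d):]:] = [:[:\<xi> powi n:]:]" for n
    using assms(2) by (simp flip: power_int_add)
  have "scalar_op (\<xi> powi d) * ((mult_op p * shift_op d) * U) =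
      skew_sum ((+) d ` A) (\<lambda>n. [:[:\<xi> powi n:]:] * (p * shift d (a (n - d))))"
    unfolding A(4) skew_sum_monomial_mult scalar_op_skew_sum shift_mult shift_const
    by (subst pw[symmetric]) (simp only: mult_ac)
  moreover have "p * shift d (a (n - d)) = 0" if "n \<notin> (+) d ` A" for n
  proof -
    have "n - d \<notin> A" using that by (metis add_diff_cancel_left' diff_add_cancel add.commute imageI)
    then show ?thesis using A(2) by simp
  qed
  ultimately show ?thesis
    unfolding twisted_def A(3) skew_sum_monomial_mult using A(1)
    by (intro exI[of _ "(+) d ` A"] exI[of _ "\<lambda>n. p * shift d (a (n - d))"]) simp
qed

lemma twisted_one: "twisted \<xi> 1 1"
  unfolding twisted_def
  by (intro exI[of _ "{0}"] exI[of _ "\<lambda>n. if n = 0 then 1 else 0"])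
    (simp add: skew_sum_def flip: one_pCons)

lemma primitive_root_powi:
  fixes \<xi> :: "'k::field"
  assumes "primitive_root m \<xi>" "0 < m" "\<xi> powi n = 1"
  shows "int m dvd n"
proof -
  have xi: "\<xi> ^ m = 1" and min: "\<And>j. 0 < j \<Longrightarrow> j < m \<Longrightarrow> \<xi> ^ j \<noteq> 1"
    using assms(1) by (auto simp: primitive_root_def)
  have "\<xi> \<noteq> 0" using xi assms(2) by (auto simp: power_0_left)
  then have "\<xi> powi (int m * (n div int m) + n mod int m) =
      (\<xi> powi int m) powi (n div int m) * \<xi> powi (n mod int m)"
    by (subst power_int_add) (simp_all only: power_int_mult simp_thms)
  then have "\<xi> powi (n mod int m) = 1" using assms(3) xi by simp
  then have "\<xi> ^ nat (n mod int m) = 1" using assms(2) by (simp add: power_int_def split: if_splits)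
  moreover have "nat (n mod int m) < m" using assms(2) by (simp add: nat_less_iff)
  ultimately have "nat (n mod int m) = 0" using min[of "nat (n mod int m)"] by blast
  moreover have "0 \<le> n mod int m" using assms(2) by simp
  ultimately have "n mod int m = 0" by linarith
  then show ?thesis by (simp add: dvd_eq_mod_eq_0)
qed

definition scale_op :: "'k::field \<Rightarrow> 'k poly lin_op" where
  "scale_op c = subst_op [:0, [:c:]:]"

lemma const_poly_1: "[:1 :: 'k::field:] = 1"
  by (simp add: one_pCons)

lemma scale_op_inverse: "c \<noteq> 0 \<Longrightarrow> scale_op c * scale_op (inverse c) = 1"
  by (simp add: scale_op_def subst_op_mult pcompose_pCons const_poly_1)

lemma scale_op_shift:
  assumes "m \<noteq> 0"
  shows "scale_op (of_nat m) * shift_op (int m * k) * scale_op (inverse (of_nat m)) =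
    (shift_op k :: 'k::field_char_0 poly lin_op)"
proof -
  have "[:inverse (of_nat m):] * of_int (int m * k) = (of_int k :: 'k poly)"
    using assms by (simp add: of_int_poly of_nat_poly)
  then show ?thesis
    using assms
    by (simp add: scale_op_def shift_op_def subst_op_mult pcompose_pCons const_poly_1)
qed

text \<open>
  If \<open>T\<close> is fixed by \<open>\<sigma> \<mapsto> \<xi> \<sigma>\<close> then its coefficient in degree \<open>n\<close> is annihilated by \<open>\<xi>\<^sup>n - 1\<close>, so
  only degrees divisible by \<open>m\<close> survive, and in these conjugation yields a power of \<open>\<sigma>\<close>.
\<close>

lemma twisted_fixed:
  fixes \<xi> :: "'k::field_char_0"
  assumes root: "primitive_root m \<xi>" "0 < m" and T: "twisted \<xi> T T"
  shows "scale_op (of_nat m) * T * scale_op (inverse (of_nat m)) \<in> laurent"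
proof -
  obtain A a where A: "finite A" "T = skew_sum A a" "T = skew_sum A (\<lambda>n. [:[:\<xi> powi n:]:] * a n)"
    using T unfolding twisted_def by blast
  have "skew_sum A (\<lambda>n. [:[:\<xi> powi n - 1:]:] * a n) = 0"
  proof -
    have "[:[:\<xi> powi n - 1:]:] * a n = [:[:\<xi> powi n:]:] * a n + - a n" for n
    proof -
      have "[:[:\<xi> powi n - 1:]:] = [:[:\<xi> powi n:]:] - (1 :: 'k poly poly)"
        by (simp add: one_pCons)
      then show ?thesis by (simp only: left_diff_distrib mult_1_left) (simp only: diff_conv_add_uminus)
    qed
    then have "skew_sum A (\<lambda>n. [:[:\<xi> powi n - 1:]:] * a n) =
        skew_sum A (\<lambda>n. [:[:\<xi> powi n:]:] * a n) + skew_sum A (\<lambda>n. - a n)"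
      by (simp only: skew_sum_add)
    also have "skew_sum A (\<lambda>n. - a n) = - skew_sum A a"
      by (simp add: skew_sum_def mult_op_uminus sum_negf)
    finally show ?thesis using A(2,3) by simp
  qed
  then have zero: "[:[:\<xi> powi n - 1:]:] * a n = 0" if "n \<in> A" for n
    by (rule skew_sum_eq_0D[OF A(1) _ that])
  have summand: "scale_op (of_nat m) * (mult_op (a n) * shift_op n) * scale_op (inverse (of_nat m))
      \<in> laurent" if "n \<in> A" for n
  proof (cases "a n = 0")
    case False
    then have "\<xi> powi n = 1" using zero[OF that] by simp
    then obtain k where k: "n = int m * k" using primitive_root_powi[OF root] by (auto elim: dvdE)
    have "scale_op (of_nat m) * (mult_op (a n) * shift_op n) * scale_op (inverse (of_nat m)) =
        mult_op (pcompose (a n) [:0, [:of_nat m:]:]) *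
        (scale_op (of_nat m) * shift_op n * scale_op (inverse (of_nat m)))"
      by (simp add: scale_op_def subst_op_mult_op flip: mult.assoc)
    also have "\<dots> = mult_op (pcompose (a n) [:0, [:of_nat m:]:]) * shift_op k"
      unfolding k using root(2) by (simp add: scale_op_shift)
    finally show ?thesis by (simp add: laurent_monomial)
  qed simp
  have "scale_op (of_nat m) * T * scale_op (inverse (of_nat m)) = (\<Sum>n\<in>A.
      scale_op (of_nat m) * (mult_op (a n) * shift_op n) * scale_op (inverse (of_nat m)))"
    by (simp add: A(2) skew_sum_def sum_distrib_left sum_distrib_right)
  also have "\<dots> \<in> laurent"
    using summand by (induction A rule: infinite_finite_induct) auto
  finally show ?thesis .
qed

lemma group_action_fixed_generator:
  assumes "group_action G X \<phi>" "g \<in> carrier G" "generate G {g} = carrier G" "x \<in> X" "\<phi> g x = x"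
    and s: "s \<in> carrier G"
  shows "\<phi> s x = x"
proof -
  interpret group_action G X \<phi> by fact
  have "s \<in> generate G {g}" using s assms(3) by simp
  then show ?thesis
  proof (induction rule: generate.induct)
    case one
    then show ?case using id_eq_one assms(4) by (metis restrict_apply')
  next
    case (incl h) then show ?case using assms(5) by simp
  next
    case (inv h) then show ?case using orbit_sym_aux[OF assms(2,4,5)] by simp
  next
    case (eng h1 h2)
    then show ?case using composition_rule[OF assms(4)] assms(3) by simp
  qed
qed

text \<open>
  The representation of \<open>U(sl\<^sub>2)\<close>, conjugated by \<open>h \<mapsto> m h\<close>, sends the invariants into \<open>L\<close>, although
  it does not do so for all of \<open>U(sl\<^sub>2)\<close>.  The invariants \<open>e\<^sup>m\<close>, \<open>m\<^sup>-\<^sup>1 h\<close> and \<open>C\<close> are mapped to \<open>\<sigma>\<close>,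
  \<open>h\<close> and \<open>C\<close>, which makes the embedding dense.
\<close>

lemma dense_embedding_invariants:
  fixes \<xi> :: "'k::field_char_0"
  assumes m: "m > 1" and root: "primitive_root m \<xi>"
    and gG: "g \<in> carrier G" and gen: "generate G {g} = carrier G"
    and act: "alg_action G U_sl2 \<phi>"
    and gH: "\<phi> g (U_gen H) = U_gen H"
    and gE: "\<phi> g (U_gen E) = \<xi> \<odot>\<^bsub>U_sl2\<^esub> U_gen E"
    and gF: "\<phi> g (U_gen F) = inverse \<xi> \<odot>\<^bsub>U_sl2\<^esub> U_gen F"
  obtains \<rho> where "dense_embedding (invariant_subalg G \<phi> U_sl2) skew_laurent_alg \<rho>"
proof -
  let ?U = "U_sl2 :: ('k, _) module"
  let ?c = "of_nat m :: 'k"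
  define S where "S = {x \<in> carrier ?U. \<forall>s\<in>carrier G. \<phi> s x = x}"
  have inv: "invariant_subalg G \<phi> ?U = ?U\<lparr>carrier := S\<rparr>"
    by (simp add: invariant_subalg_def S_def)
  have xi0: "\<xi> \<noteq> 0" using root m by (auto simp: primitive_root_def power_0_left)
  have c0: "?c \<noteq> 0" using m by simp
  have ga: "group_action G (carrier ?U) \<phi>" using act by (simp add: alg_action_def)
  have iso: "\<phi> s \<in> ring_iso ?U ?U" if "s \<in> carrier G" for s
    using act that by (simp add: alg_action_def alg_iso_def)
  note hom_closed = ring_iso_memE(1)[OF iso] and hom_mult = ring_iso_memE(2)[OF iso]
    and hom_add = ring_iso_memE(3)[OF iso] and hom_one = ring_iso_memE(4)[OF iso]
  have hom_smult: "\<phi> s (c \<odot>\<^bsub>?U\<^esub> x) = c \<odot>\<^bsub>?U\<^esub> \<phi> s x"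
    if "s \<in> carrier G" "x \<in> carrier ?U" for s x c
    using act that by (simp add: alg_action_def alg_iso_def)
  note hom = hom_closed[OF gG] hom_mult[OF gG] hom_add[OF gG] hom_one[OF gG] hom_smult[OF gG]
  have one_U: "\<one>\<^bsub>?U\<^esub> \<in> carrier ?U" by (rule U.one_closed)
  have SI: "x \<in> S" if "x \<in> carrier ?U" "\<phi> g x = x" for x
    using group_action_fixed_generator[OF ga gG gen that] that(1) by (simp add: S_def)
  interpret R: nc_algebra "?U\<lparr>carrier := S\<rparr>"
  proof (rule U.nc_algebra_subalgebra)
    show "S \<subseteq> carrier ?U" by (auto simp: S_def)
    show "\<one>\<^bsub>?U\<^esub> \<in> S" using hom_one one_U unfolding S_def by blast
    fix x y c assume x: "x \<in> S"
    show "c \<odot>\<^bsub>?U\<^esub> x \<in> S" using x hom_smult unfolding S_def by simp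
    assume y: "y \<in> S"
    show "x \<oplus>\<^bsub>?U\<^esub> y \<in> S" "x \<otimes>\<^bsub>?U\<^esub> y \<in> S" using x y hom_mult hom_add unfolding S_def by simp_all
  qed
  have SU: "x \<in> carrier ?U" if "x \<in> S" for x using that by (simp add: S_def)
  note rep = sl2.rep_add sl2.rep_mult sl2.rep_smult sl2.rep_e sl2.rep_f sl2.rep_h
  have gens: "U_gen E \<in> carrier ?U" "U_gen F \<in> carrier ?U" "U_gen H \<in> carrier ?U"
    by (simp_all add: U_gen_def)
  have twist: "twisted \<xi> (sl2_rep x) (sl2_rep (\<phi> g x))" if "x \<in> carrier ?U" for x
    using generated_by_U that
  proof (induction rule: generated_by_induct)
    case one
    show ?case using twisted_one hom(4) by simp
  next
    case (add x y)
    then show ?case using gG by (simp add: hom rep twisted_add)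
  next
    case (smult c x)
    then show ?case
      using twisted_monomial_mult[OF smult.IH xi0, of "[:[:c:]:]" 0, folded scalar_op_def]
      by (simp add: hom rep)
  next
    case (mult u x)
    consider "u = U_gen E" | "u = U_gen F" | "u = U_gen H" using mult by blast
    then show ?case
    proof cases
      case 1
      show ?thesis
        using twisted_monomial_mult[OF mult.IH xi0, of 1 1] mult gens
        by (simp add: 1 hom rep gE mult.assoc)
    next
      case 2
      show ?thesis
        using twisted_monomial_mult[OF mult.IH xi0, of sl2_a "- 1"] mult gens
        by (simp add: 2 hom rep gF mult.assoc power_int_minus)
    next
      case 3
      show ?thesis
        using twisted_monomial_mult[OF mult.IH xi0, of "[:0, 1:]" 0] mult gens
        by (simp add: 3 hom rep gH mult.assoc)
    qed
  qed (rule U.nc_algebra_axioms)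
  define \<rho> where "\<rho> x = scale_op ?c * sl2_rep x * scale_op (inverse ?c)" for x
  have inverses: "scale_op (inverse ?c) * scale_op ?c = 1" "scale_op ?c * scale_op (inverse ?c) = 1"
    using scale_op_inverse[OF c0] scale_op_inverse[of "inverse ?c"] c0 by simp_all
  have "operator_rep (?U\<lparr>carrier := S\<rparr>) \<rho>"
  proof
    fix x y assume xy: "x \<in> carrier (?U\<lparr>carrier := S\<rparr>)" "y \<in> carrier (?U\<lparr>carrier := S\<rparr>)"
    have "\<rho> x * \<rho> y = scale_op ?c * sl2_rep x * (scale_op (inverse ?c) * scale_op ?c) * sl2_rep y *
        scale_op (inverse ?c)"
      unfolding \<rho>_def by (simp only: mult.assoc)
    then show "\<rho> (x \<otimes>\<^bsub>?U\<lparr>carrier := S\<rparr>\<^esub> y) = \<rho> x * \<rho> y"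
      using xy by (simp add: inverses \<rho>_def rep SU mult.assoc)
    show "\<rho> (x \<oplus>\<^bsub>?U\<lparr>carrier := S\<rparr>\<^esub> y) = \<rho> x + \<rho> y"
      using xy by (simp add: \<rho>_def rep SU distrib_left distrib_right)
  next
    fix x c assume "x \<in> carrier (?U\<lparr>carrier := S\<rparr>)"
    then show "\<rho> (c \<odot>\<^bsub>?U\<lparr>carrier := S\<rparr>\<^esub> x) = scalar_op c * \<rho> x"
      by (simp add: \<rho>_def rep SU mult.assoc scalar_op_left_commute[of "scale_op _"])
  qed (simp add: \<rho>_def inverses)
  moreover have "inj_on \<rho> (carrier (?U\<lparr>carrier := S\<rparr>))"
  proof (rule inj_onI)
    have recover: "scale_op (inverse ?c) * \<rho> x * scale_op ?c = sl2_rep x" for x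
    proof -
      have "scale_op (inverse ?c) * \<rho> x * scale_op ?c = (scale_op (inverse ?c) * scale_op ?c) *
          sl2_rep x * (scale_op (inverse ?c) * scale_op ?c)"
        unfolding \<rho>_def by (simp only: mult.assoc)
      then show ?thesis by (simp add: inverses)
    qed
    fix x y
    assume xy: "x \<in> carrier (?U\<lparr>carrier := S\<rparr>)" "y \<in> carrier (?U\<lparr>carrier := S\<rparr>)" "\<rho> x = \<rho> y"
    have "sl2_rep x = sl2_rep y" using recover[of x] recover[of y] xy(3) by simp
    then show "x = y" by (rule inj_onD[OF sl2.rep_inj]) (use xy in \<open>simp_all add: SU\<close>)
  qed
  moreover have "\<rho> ` carrier (?U\<lparr>carrier := S\<rparr>) \<subseteq> laurent"
  proof -
    have "\<rho> x \<in> laurent" if "x \<in> S" for x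
      unfolding \<rho>_def
      by (rule twisted_fixed[OF root])
        (use m twist[OF SU[OF that]] that gG in \<open>auto simp: S_def\<close>)
    then show ?thesis by auto
  qed
  moreover have "mult_op [:[:0, 1:]:] \<in> \<rho> ` carrier (?U\<lparr>carrier := S\<rparr>)"
  proof -
    have C: "U_class sl2_C = U_gen H \<otimes>\<^bsub>?U\<^esub> (U_gen H \<oplus>\<^bsub>?U\<^esub> \<one>\<^bsub>?U\<^esub>) \<oplus>\<^bsub>?U\<^esub> U_gen F \<otimes>\<^bsub>?U\<^esub> U_gen E"
      by (simp add: U_gen_def sl2_C_def)
    have "\<phi> g (U_class sl2_C) = U_class sl2_C"
      unfolding C using gens xi0
      by (simp add: hom gE gF gH one_U U.smult_mult_left U.smult_mult_right
          U.smult_assoc[symmetric] del: U_class_simps(4))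
    then have "U_class sl2_C \<in> S" by (intro SI) simp_all
    moreover have "\<rho> (U_class sl2_C) = mult_op [:[:0, 1:]:]"
      unfolding \<rho>_def sl2.rep_C
      by (simp add: scale_op_def subst_op_mult_op mult.assoc)
        (simp add: inverses[unfolded scale_op_def])
    ultimately show ?thesis by (auto simp: image_iff intro!: bexI[of _ "U_class sl2_C"])
  qed
  moreover have "mult_op [:0, 1:] \<in> \<rho> ` carrier (?U\<lparr>carrier := S\<rparr>)"
  proof -
    define x where "x = inverse ?c \<odot>\<^bsub>?U\<^esub> U_gen H"
    have "\<phi> g x = x" unfolding x_def using gens by (simp add: hom gH)
    then have "x \<in> S" using gens by (intro SI) (simp_all add: x_def)
    moreover have "\<rho> x = mult_op [:0, 1:]"
    proof -
      have "\<rho> x = scalar_op (inverse ?c) * (scale_op ?c * mult_op [:0, 1:] * scale_op (inverse ?c))"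
        using gens by (simp add: x_def \<rho>_def rep mult.assoc scalar_op_left_commute[of "scale_op _"])
      also have "scale_op ?c * mult_op [:0, 1:] * scale_op (inverse ?c) = mult_op [:0, [:?c:]:]"
        using inverses(2)
        by (simp add: scale_op_def subst_op_mult_op pcompose_pCons mult.assoc)
      also have "scalar_op (inverse ?c) * mult_op [:0, [:?c:]:] = mult_op [:0, 1:]"
        using c0 by (simp add: scalar_op_def flip: mult_op_mult one_pCons)
      finally show ?thesis .
    qed
    ultimately show ?thesis by (auto simp: image_iff intro!: bexI[of _ x])
  qed
  moreover have "shift_op 1 \<in> \<rho> ` carrier (?U\<lparr>carrier := S\<rparr>)"
  proof -
    define x where "x = U_gen E [^]\<^bsub>?U\<^esub> m"
    have pow: "\<phi> g (U_gen E [^]\<^bsub>?U\<^esub> k) = \<xi> ^ k \<odot>\<^bsub>?U\<^esub> (U_gen E [^]\<^bsub>?U\<^esub> k) \<and>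
        sl2_rep (U_gen E [^]\<^bsub>?U\<^esub> k) = shift_op (int k)" for k :: nat
    proof (induction k)
      case 0
      show ?case using hom(4) by (simp flip: one_free)
    next
      case (Suc k)
      then show ?case
        using gens
        by (simp add: hom gE rep U.smult_mult_left U.smult_mult_right U.smult_assoc[symmetric]
            shift_op_add add.commute mult.commute)
    qed
    have xU: "x \<in> carrier ?U" using gens by (simp add: x_def)
    have "\<phi> g x = x" using pow[of m] root xU by (simp add: x_def primitive_root_def)
    then have "x \<in> S" using xU by (intro SI)
    moreover have "\<rho> x = shift_op 1"
      using scale_op_shift[of m 1, where 'k = 'k] m pow[of m] by (simp add: \<rho>_def x_def)
    ultimately show ?thesis by (auto simp: image_iff intro!: bexI[of _ x])
  qed
  ultimately have "dense_embedding (?U\<lparr>carrier := S\<rparr>) skew_laurent_alg \<rho>"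
    by (rule dense_embedding_skew_laurent)
  then show ?thesis using that unfolding inv by blast
qed

section \<open>Comparison of the skew fields\<close>

text \<open>
  Together with the symmetry of isomorphisms of skew fields, this lets chains of isomorphisms pass
  through \<open>Frac L\<close> in both directions.
\<close>

lemma dense_embedding_ore_domain: "dense_embedding R L \<iota> \<Longrightarrow> ore_domain R"
proof -
  assume "dense_embedding R L \<iota>"
  then interpret dense_embedding R L \<iota> .
  show ?thesis by (rule R.ore_domain_axioms)
qed

theorem corollary3:
  fixes m :: nat
    and \<xi> :: "'k::{alg_closed_field, field_char_0}"
    and G :: "'g monoid"
    and g :: 'g
    and \<phi> :: "'g \<Rightarrow> (sl2_basis list \<Rightarrow>\<^sub>0 'k) set \<Rightarrow> (sl2_basis list \<Rightarrow>\<^sub>0 'k) set"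
  assumes "m > 1"
    and "primitive_root m \<xi>"
    and "group G" and "order G = m" and "g \<in> carrier G" and "generate G {g} = carrier G"
    and "alg_action G U_sl2 \<phi>"
    and "\<phi> g (U_gen H) = U_gen H"
    and "\<phi> g (U_gen E) = \<xi> \<odot>\<^bsub>U_sl2\<^esub> U_gen E"
    and "\<phi> g (U_gen F) = inverse \<xi> \<odot>\<^bsub>U_sl2\<^esub> U_gen F"
  shows "Frac (invariant_subalg G \<phi> U_sl2)
           \<cong>\<^sub>a Frac (tensor_alg (poly_alg :: ('k, 'k poly) module) weyl_alg)
       \<and> Frac (tensor_alg (poly_alg :: ('k, 'k poly) module) weyl_alg)
           \<cong>\<^sub>a Frac (U_sl2 :: ('k, (sl2_basis list \<Rightarrow>\<^sub>0 'k) set) module)"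
proof -
  obtain \<rho> where inv: "dense_embedding (invariant_subalg G \<phi> U_sl2) skew_laurent_alg \<rho>"
    using dense_embedding_invariants[OF assms(1,2,5-10)] .
  obtain \<tau> where tensor: "dense_embedding
      (tensor_alg (poly_alg :: ('k, 'k poly) module) weyl_alg) skew_laurent_alg \<tau>"
    using dense_embedding_tensor .
  note U = sl2.dense[where 'k = 'k]
  have sym: "Frac skew_laurent_alg \<cong>\<^sub>a Frac R"
    if "dense_embedding R (skew_laurent_alg :: ('k, 'k poly lin_op) module) \<iota>"
    for R :: "('k, 'r) module" and \<iota>
    using alg_isomorphic_Frac_sym[OF dense_embedding_ore_domain[OF that]
        dense_embedding.Frac_isomorphic[OF that]] .
  show ?thesis
    using alg_isomorphic_trans[OF dense_embedding.Frac_isomorphic[OF inv] sym[OF tensor]]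
      alg_isomorphic_trans[OF dense_embedding.Frac_isomorphic[OF tensor] sym[OF U]] ..
qed

end
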